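(* Let $D=\begin{pmatrix} I_r & M\end{pmatrix}$ be an $r\times n$ standard representative matrix and $(w,\widehat w)$, with $w\in\mathbb R^r$, $\widehat w\in\mathbb R^{n-r}$, a shifting vector for $D$. Define $T'(D)=\bigcup_{B\in\mathcal B(D)}\ \bigcup_{z\in\mathbb Z^{n-r}\ \widehat w\text{-associated with }B}\big(P_1(B)+Mz\big)\subseteq\mathbb R^r$ and $T''(D)=\bigcup_{B\in\mathcal B(D)}\ \bigcup_{z\in\mathbb Z^{r}\ w\text{-associated with }B}\big(P_2(B)-M^Tz\big)\subseteq\mathbb R^{n-r}$. Then: (1) the parallelepipeds $P_1(B)+Mz$ making up $T'(D)$ only intersect at their boundaries; (2) the parallelepipeds $P_2(B)-M^Tz$ making up $T''(D)$ only intersect at their boundaries; (3) the translates $T'(D)+DD^Tu$, $u\in\mathbb Z^r$, cover $\mathbb R^r$ and only intersect at their boundaries; (4) the translates $T''(D)+\widehat D\widehat D^T\widehat u$, $\widehat u\in\mathbb Z^{n-r}$, cover $\mathbb R^{n-r}$ and only intersect at their boundaries; (5) for each $B\in\mathcal B(D)$ there are exactly $m(B)^2$ integer points $y\in\mathbb Z^r$ of $T'(D)$ such that for all sufficiently small $\epsilon>0$, $y+\epsilon w$ lies in one of the translates $P_1(B)+Mz$ of $P_1(B)$ making up $T'(D)$; (6) for each $B\in\mathcal B(D)$ there are exactly $m(B)^2$ integer points $\widehat y\in\mathbb Z^{n-r}$ of $T''(D)$ such that for all sufficiently small $\epsilon>0$, $\widehat y+\epsilon\widehat w$ lies in one of the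 translates $P_2(B)-M^Tz$ of $P_2(B)$ making up $T''(D)$.
   Context: Let $r\le n$ be nonnegative integers, $M$ an $r\times(n-r)$ integer matrix, $D=\begin{pmatrix} I_r & M\end{pmatrix}$, $\widehat D=\begin{pmatrix} -M^T & I_{n-r}\end{pmatrix}$. $\mathcal B(D)$ is the set of $r$-element subsets $B\subseteq[n]$ such that the submatrix of $D$ on the columns indexed by $B$ has nonzero determinant, and $m(B)$ is the absolute value of that determinant. The fundamental parallelepiped of vectors $c_1,\dots,c_k$ is $\{\sum_i a_ic_i: 0\le a_i\le 1\}$. For $B\in\mathcal B(D)$, $P_1(B)\subseteq\mathbb R^r$ is the fundamental parallelepiped of the columns of $D$ indexed by $B$, $P_2(B)\subseteq\mathbb R^{n-r}$ is that of the columns of $\widehat D$ indexed by $[n]\setminus B$, and $P(B)=P_1(B)\times P_2(B)$. A shifting vector is $\mathfrak w\in\mathbb R^n$ which, for every $B$, does not lie in the linear span of any facet of $P(B)$ (the linear hyperplane parallel to that facet); we write $\mathfrak w=(w,\widehat w)$ with $w$ the first $r$ and $\widehat w$ the last $n-r$ coordinates. A point $z\in\mathbb R^r$ is $w$-associated with $B$ if $z+\epsilon w\in P_1(B)$ for all sufficiently small $\epsilon>0$; a point $z\in\mathbb R^{n-r}$ is $\widehat w$-associated with $B$ if $z+\epsilon\widehat w\in P_2(B)$ for all sufficiently small $\epsilon>0$. *)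

theory Defs
  imports
    "HOL-Analysis.Analysis"
    "Jordan_Normal_Form.DL_Submatrix"
    "Jordan_Normal_Form.VS_Connect"
begin

text \<open>
  Vectors and matrices are those of \<open>Jordan_Normal_Form\<close>: \<open>\<real>\<^sup>k\<close> is the set
  \<open>carrier_vec k\<close> of real vectors and \<open>\<int>\<^sup>k\<close> the set \<open>carrier_vec k\<close> of integer vectors, for
  every natural number \<open>k\<close>, including 0.  Indices are 0-based, so \<open>[n]\<close> is \<open>{..<n}\<close>.
\<close>

abbreviation real_vec :: "int vec \<Rightarrow> real vec" where
  "real_vec \<equiv> map_vec real_of_int"

abbreviation real_mat :: "int mat \<Rightarrow> real mat" where
  "real_mat \<equiv> map_mat real_of_int"


section \<open>Euclidean topology on \<open>carrier_vec k\<close>\<close>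

definition vec_dist :: "nat \<Rightarrow> real vec \<Rightarrow> real vec \<Rightarrow> real" where
  "vec_dist k x y = L2_set (\<lambda>i. vec_index x i - vec_index y i) {..<k}"

lemma Metric_space_carrier_vec: "Metric_space (carrier_vec k) (vec_dist k)"
proof
  fix x y :: "real vec"
  show "0 \<le> vec_dist k x y"
    by (simp add: vec_dist_def)
  show "vec_dist k x y = vec_dist k y x"
    by (simp add: vec_dist_def L2_set_def power2_commute)
next
  fix x y :: "real vec"
  assume "x \<in> carrier_vec k" "y \<in> carrier_vec k"
  then show "vec_dist k x y = 0 \<longleftrightarrow> x = y"
    by (auto simp: vec_dist_def L2_set_eq_0_iff)
next
  fix x y z :: "real vec"
  show "vec_dist k x z \<le> vec_dist k x y + vec_dist k y z"
    using L2_set_triangle_ineq[of "\<lambda>i. vec_index x i - vec_index y i"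
        "\<lambda>i. vec_index y i - vec_index z i" "{..<k}"]
    by (simp add: vec_dist_def)
qed

definition euclidean_vec_top :: "nat \<Rightarrow> real vec topology" where
  "euclidean_vec_top k = Metric_space.mtopology (carrier_vec k) (vec_dist k)"

definition meet_only_at_boundary :: "nat \<Rightarrow> real vec set \<Rightarrow> real vec set \<Rightarrow> bool" where
  "meet_only_at_boundary k S T \<longleftrightarrow>
     S \<inter> T \<subseteq> euclidean_vec_top k frontier_of S \<inter> euclidean_vec_top k frontier_of T"

definition translate :: "real vec set \<Rightarrow> real vec \<Rightarrow> real vec set" where
  "translate S v = (\<lambda>x. x + v) ` S"


section \<open>Facets of polytopes\<close>

definition polytope_face :: "nat \<Rightarrow> real vec set \<Rightarrow> real vec set \<Rightarrow> bool" where
  "polytope_face k F P \<longleftrightarrow>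
     (\<exists>c \<in> carrier_vec k. \<exists>c0. (\<forall>x\<in>P. scalar_prod c x \<le> c0) \<and> F = {x \<in> P. scalar_prod c x = c0})"

text \<open>
  Facets are the inclusion-maximal proper faces.  The empty face is excluded, so that a point,
  in particular the polytope \<open>\<real>\<^sup>0\<close>, has no facets.
\<close>

definition polytope_facet :: "nat \<Rightarrow> real vec set \<Rightarrow> real vec set \<Rightarrow> bool" where
  "polytope_facet k F P \<longleftrightarrow>
     polytope_face k F P \<and> F \<noteq> {} \<and> F \<noteq> P \<and>
     (\<forall>G. polytope_face k G P \<and> F \<subseteq> G \<and> G \<noteq> P \<longrightarrow> G = F)"

text \<open>The linear subspace parallel to the affine hull of \<open>F\<close>.\<close>

definition parallel_subspace :: "nat \<Rightarrow> real vec set \<Rightarrow> real vec set" where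
  "parallel_subspace k F =
     LinearCombinations.module.span class_ring (module_vec TYPE(real) k) {x - y | x y. x \<in> F \<and> y \<in> F}"


section \<open>Standard representative matrices\<close>

text \<open>
  For \<open>M \<in> carrier_mat r (n - r)\<close>, the matrix \<open>(I\<^sub>r M)\<close> is \<open>std_mat M\<close> and
  the matrix \<open>(-M\<^sup>T I\<^sub>n\<^sub>-\<^sub>r)\<close> is \<open>std_mat_hat M\<close>.
\<close>

definition append_cols :: "'a :: zero mat \<Rightarrow> 'a mat \<Rightarrow> 'a mat" where
  "append_cols A B = four_block_mat A B (0\<^sub>m 0 (dim_col A)) (0\<^sub>m 0 (dim_col B))"

definition std_mat :: "int mat \<Rightarrow> int mat" where
  "std_mat M = append_cols (1\<^sub>m (dim_row M)) M"

definition std_mat_hat :: "int mat \<Rightarrow> int mat" where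
  "std_mat_hat M = append_cols (- transpose_mat M) (1\<^sub>m (dim_col M))"

definition bases :: "int mat \<Rightarrow> nat set set" where
  "bases D = {B. B \<subseteq> {..<dim_col D} \<and> card B = dim_row D \<and> det (submatrix D UNIV B) \<noteq> 0}"

definition multiplicity_of :: "int mat \<Rightarrow> nat set \<Rightarrow> nat" where
  "multiplicity_of D B = nat \<bar>det (submatrix D UNIV B)\<bar>"


section \<open>Parallelepipeds, shifting vectors and associated points\<close>

definition cols_parallelepiped :: "real mat \<Rightarrow> nat set \<Rightarrow> real vec set" where
  "cols_parallelepiped A J =
     {finsum_vec TYPE(real) (dim_row A) (\<lambda>j. a j \<cdot>\<^sub>v col A j) J | a. \<forall>j\<in>J. 0 \<le> a j \<and> a j \<le> 1}"

definition P1 :: "int mat \<Rightarrow> nat set \<Rightarrow> real vec set" where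
  "P1 M B = cols_parallelepiped (real_mat (std_mat M)) B"

definition P2 :: "int mat \<Rightarrow> nat set \<Rightarrow> real vec set" where
  "P2 M B = cols_parallelepiped (real_mat (std_mat_hat M)) ({..<dim_col (std_mat_hat M)} - B)"

definition P12 :: "int mat \<Rightarrow> nat set \<Rightarrow> real vec set" where
  "P12 M B = {x @\<^sub>v y | x y. x \<in> P1 M B \<and> y \<in> P2 M B}"

definition shifting_vector :: "int mat \<Rightarrow> real vec \<Rightarrow> bool" where
  "shifting_vector M v \<longleftrightarrow>
     v \<in> carrier_vec (dim_row M + dim_col M) \<and>
     (\<forall>B \<in> bases (std_mat M). \<forall>F. polytope_facet (dim_row M + dim_col M) F (P12 M B) \<longrightarrow>
        v \<notin> parallel_subspace (dim_row M + dim_col M) F)"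

definition associated :: "real vec \<Rightarrow> real vec set \<Rightarrow> real vec \<Rightarrow> bool" where
  "associated w P z \<longleftrightarrow> (\<forall>\<^sub>F \<epsilon> in at_right 0. z + \<epsilon> \<cdot>\<^sub>v w \<in> P)"

text \<open>
  The integer points \<open>z\<close> indexing the translates of \<open>P1 M B\<close> in \<open>T'(D)\<close> (those associated with
  \<open>B\<close> through \<open>P2 M B\<close>), and the integer points indexing the translates of \<open>P2 M B\<close> in
  \<open>T''(D)\<close> (those associated with \<open>B\<close> through \<open>P1 M B\<close>).
\<close>

definition idx1 :: "int mat \<Rightarrow> real vec \<Rightarrow> nat set \<Rightarrow> int vec set" where
  "idx1 M w' B = {z \<in> carrier_vec (dim_col M). associated w' (P2 M B) (real_vec z)}"

definition idx2 :: "int mat \<Rightarrow> real vec \<Rightarrow> nat set \<Rightarrow> int vec set" where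
  "idx2 M w B = {z \<in> carrier_vec (dim_row M). associated w (P1 M B) (real_vec z)}"

definition tile1 :: "int mat \<Rightarrow> nat set \<Rightarrow> int vec \<Rightarrow> real vec set" where
  "tile1 M B z = translate (P1 M B) (real_vec (M *\<^sub>v z))"

definition tile2 :: "int mat \<Rightarrow> nat set \<Rightarrow> int vec \<Rightarrow> real vec set" where
  "tile2 M B z = translate (P2 M B) (- real_vec (transpose_mat M *\<^sub>v z))"

definition T1 :: "int mat \<Rightarrow> real vec \<Rightarrow> real vec set" where
  "T1 M w' = (\<Union>B \<in> bases (std_mat M). \<Union>z \<in> idx1 M w' B. tile1 M B z)"

definition T2 :: "int mat \<Rightarrow> real vec \<Rightarrow> real vec set" where
  "T2 M w = (\<Union>B \<in> bases (std_mat M). \<Union>z \<in> idx2 M w B. tile2 M B z)"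

end

theory Submission
  imports Defs
begin

text \<open>
  Write \<open>D = (I M)\<close>, \<open>E = (-M\<^sup>T I)\<close>, and for \<open>B \<subseteq> [n]\<close> let \<open>Q B\<close> be the matrix obtained by stacking
  \<open>D\<close>, with the columns outside \<open>B\<close> zeroed, on top of \<open>E\<close>, with the columns in \<open>B\<close> zeroed; its columns
  span \<open>P(B)\<close>, and \<open>\<bar>det (Q B)\<bar> = m(B)\<^sup>2\<close> because complementary minors of \<open>D\<close> and \<open>E\<close> agree up to sign.
  The translates of the cells \<open>P(B)\<close> by the lattice \<open>{(D k, -E k). k \<in> \<int>\<^sup>n}\<close> tile \<open>\<real>\<^sup>n\<close>:

  \<^item> They are disjoint (in the interior). A common point of two cells gives vectors \<open>a - a' - k \<in> ker D\<close>
    and \<open>b - b' + k \<in> ker E\<close>. The kernels are orthogonal, whereas every term of the scalar product is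
    nonpositive and vanishes only if the two cells agree at that index.
  \<^item> They cover, by counting points of a coset \<open>x + \<int>\<^sup>n\<close> modulo the lattice: there are \<open>\<bar>det N\<bar>\<close> classes,
    where \<open>N\<close> is \<open>D\<close> on top of \<open>-E\<close>; a half-open cell contains \<open>\<bar>det (Q B)\<bar>\<close> points, in different classes;
    and \<open>\<bar>det N\<bar> \<le> \<Sum>B. \<bar>det (Q B)\<bar>\<close> by expanding the determinant.

  The shifting vector selects the half-open cells. Cutting the tiling with the slice of second coordinate
  \<open>0\<close> (shifted by \<open>\<epsilon> w'\<close>) yields the tiles \<open>P\<^sub>1(B) + M z + D D\<^sup>T u\<close>, and the statements about \<open>T''\<close> follow
  by exchanging \<open>D\<close> and \<open>E\<close>.
\<close>

text \<open>Covering is derived from disjointness by a pigeonhole argument carried out at each point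
  of \<real>^n separately, so no volume enters. Disjointness makes the map from coset points in
  half-open cells to classes modulo the lattice injective; as there are at least as many points as
  classes, it is onto, and the class of the given point is hit. Half-open cells matter because each
  coordinate then has exactly one admissible integer shift, which makes the number of coset points
  in a cell independent of the coset. The slice is read off from the coordinates
  \<open>k = J z + D\<^sup>T u\<close> of \<open>\<int>\<^sup>n\<close>, for which
  \<open>E k = z\<close> and \<open>D k = M z + D D\<^sup>T u\<close>: the cell
  \<open>P(B) + (D k, -E k)\<close> contains \<open>(p, 0)\<close> exactly if \<open>z\<close> lies
  in \<open>P\<^sub>2(B)\<close> and \<open>p - M z - D D\<^sup>T u\<close> lies in
  \<open>P\<^sub>1(B)\<close>. This is where the association condition and the two kinds of
  translation come from. Statements about boundaries are reduced to the uniqueness of half-open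
  cells by testing interiors with short segments in direction \<open>w\<close>.\<close>

unbundle no vec_syntax and no inner_syntax

section \<open>The index of an integer lattice\<close>

text \<open>A system of representatives for the cosets of the lattice spanned by the columns of
  \<open>A\<close>. Its cardinality is the index of that lattice.\<close>

definition lattice_transversal :: "int mat \<Rightarrow> int vec set \<Rightarrow> bool" where
  "lattice_transversal A R \<longleftrightarrow> R \<subseteq> carrier_vec (dim_row A) \<and>
     (\<forall>x\<in>carrier_vec (dim_row A). \<exists>!y. y \<in> R \<and> (\<exists>q\<in>carrier_vec (dim_col A). x = y + A *\<^sub>v q))"

text \<open>\<open>A\<close> and \<open>A * U\<close> have the same column lattice:
  \<open>A q = (A U) (V q)\<close> and \<open>(A U) q = A (U q)\<close>. This justifies the integral
  column operations below.\<close>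

lemma lattice_transversal_right_unimodular:
  assumes A: "A \<in> carrier_mat k l" and U: "U \<in> carrier_mat l l" and V: "V \<in> carrier_mat l l"
    and UV: "A * U * V = A" and R: "lattice_transversal (A * U) R"
  shows "lattice_transversal A R"
proof -
  have "(\<exists>q\<in>carrier_vec l. x = y + A *\<^sub>v q) \<longleftrightarrow> (\<exists>q\<in>carrier_vec l. x = y + (A * U) *\<^sub>v q)" for x y
  proof
    assume "\<exists>q\<in>carrier_vec l. x = y + A *\<^sub>v q"
    then obtain q where q: "q \<in> carrier_vec l" "x = y + A *\<^sub>v q" by blast
    have "(A * U) *\<^sub>v (V *\<^sub>v q) = (A * U * V) *\<^sub>v q"
      using A U V q by (intro assoc_mult_mat_vec[symmetric]) auto
    then have "x = y + (A * U) *\<^sub>v (V *\<^sub>v q)" using q UV by simp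
    then show "\<exists>q\<in>carrier_vec l. x = y + (A * U) *\<^sub>v q"
      using V q by (intro bexI[of _ "V *\<^sub>v q"]) auto
  next
    assume "\<exists>q\<in>carrier_vec l. x = y + (A * U) *\<^sub>v q"
    then obtain q where q: "q \<in> carrier_vec l" "x = y + (A * U) *\<^sub>v q" by blast
    have "(A * U) *\<^sub>v q = A *\<^sub>v (U *\<^sub>v q)"
      using A U q by (intro assoc_mult_mat_vec) auto
    then show "\<exists>q\<in>carrier_vec l. x = y + A *\<^sub>v q"
      using U q by (intro bexI[of _ "U *\<^sub>v q"]) auto
  qed
  then show ?thesis
    using R A U unfolding lattice_transversal_def by simp
qed

text \<open>Both sets biject with the cosets; each element is sent to the representative of its own
  coset in the other set. Hence the size of one transversal determines the size of all.\<close>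

lemma lattice_transversal_bij:
  assumes A: "A \<in> carrier_mat k l"
    and R: "lattice_transversal A R" and S: "lattice_transversal A S"
  shows "\<exists>f. bij_betw f R S"
proof -
  define E where "E x y \<longleftrightarrow> (\<exists>q\<in>carrier_vec l. x = y + A *\<^sub>v q)" for x y
  have car: "A *\<^sub>v q \<in> carrier_vec k" if "q \<in> carrier_vec l" for q using A that by simp
  have sym: "E y x" if xy: "E x y" and x: "x \<in> carrier_vec k" and y: "y \<in> carrier_vec k" for x y
  proof -
    obtain q where q: "q \<in> carrier_vec l" "x = y + A *\<^sub>v q" using xy by (auto simp: E_def)
    have "A *\<^sub>v (- q) = - (A *\<^sub>v q)" using A q by (auto intro!: eq_vecI)
    then have "y = x + A *\<^sub>v (- q)" using A q x y by (auto intro!: eq_vecI)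
    then show ?thesis unfolding E_def using q by (intro bexI[of _ "- q"]) auto
  qed
  have trans: "E x z" if xy: "E x y" and yz: "E y z" and z: "z \<in> carrier_vec k" for x y z
  proof -
    obtain q p where q: "q \<in> carrier_vec l" "x = y + A *\<^sub>v q"
      and p: "p \<in> carrier_vec l" "y = z + A *\<^sub>v p" using xy yz by (auto simp: E_def)
    have "x = z + A *\<^sub>v (p + q)"
      using A q p z car[OF q(1)] car[OF p(1)] mult_add_distrib_mat_vec[OF A p(1) q(1)] by simp
    then show ?thesis unfolding E_def using p q by (intro bexI[of _ "p + q"]) auto
  qed
  have Rc: "R \<subseteq> carrier_vec k" and Sc: "S \<subseteq> carrier_vec k"
    using R S A by (auto simp: lattice_transversal_def)
  have R1: "\<exists>!y. y \<in> R \<and> E x y" if "x \<in> carrier_vec k" for x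
    using R A that by (auto simp: lattice_transversal_def E_def)
  have S1: "\<exists>!y. y \<in> S \<and> E x y" if "x \<in> carrier_vec k" for x
    using S A that by (auto simp: lattice_transversal_def E_def)
  define f where "f x = (THE y. y \<in> S \<and> E x y)" for x
  define g where "g x = (THE y. y \<in> R \<and> E x y)" for x
  have f: "f x \<in> S" "E x (f x)" "y \<in> S \<Longrightarrow> E x y \<Longrightarrow> f x = y" if "x \<in> R" for x y
    using theI'[OF S1[of x]] S1[of x] the1_equality[OF S1[of x]] Rc that by (auto simp: f_def)
  have g: "g x \<in> R" "E x (g x)" "y \<in> R \<Longrightarrow> E x y \<Longrightarrow> g x = y" if "x \<in> S" for x y
    using theI'[OF R1[of x]] R1[of x] the1_equality[OF R1[of x]] Sc that by (auto simp: g_def)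
  have "bij_betw f R S"
  proof (rule bij_betw_byWitness[of _ g])
    show "\<forall>a\<in>R. g (f a) = a" using Rc Sc by (auto intro!: g(3) f sym dest: f(1))
    show "\<forall>a\<in>S. f (g a) = a" using Rc Sc by (auto intro!: f(3) g sym dest: g(1))
  qed (use f g in auto)
  then show ?thesis by blast
qed

lemma vec_carrier_Suc_cases:
  assumes "v \<in> carrier_vec (Suc k)"
  obtains a u where "v = vCons a u" "u \<in> carrier_vec k"
  using assms by (cases v) auto

lemma vCons_add: "vCons a u + vCons b v = vCons (a + b) (u + v)"
  by (intro eq_vecI) (auto simp: vec_index_vCons)

text \<open>With first row \<open>(a, 0, ..., 0)\<close>, the first coordinate of a lattice vector
  is a multiple of \<open>a\<close> and fixes the first coefficient \<open>t\<close>. After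
  subtracting \<open>t\<close> times the first column, the other coordinates are reduced by the
  smaller matrix. The representatives are the pairs of a residue modulo \<open>\<bar>a\<bar>\<close>
  and an element of \<open>R\<close>.\<close>

lemma lattice_transversal_Suc:
  assumes A: "A \<in> carrier_mat (Suc k) (Suc k)"
    and z: "\<And>j. 0 < j \<Longrightarrow> j \<le> k \<Longrightarrow> A $$ (0, j) = 0" and a: "A $$ (0, 0) \<noteq> 0"
    and R: "lattice_transversal (mat_delete A 0 0) R" and fin: "finite R"
  shows "\<exists>S. finite S \<and> card S = nat \<bar>A $$ (0, 0)\<bar> * card R \<and> lattice_transversal A S"
proof -
  define a where "a = A $$ (0, 0)"
  define B where "B = mat_delete A 0 0"
  define c where "c = vec k (\<lambda>i. A $$ (Suc i, 0))"
  have B: "B \<in> carrier_mat k k" using A unfolding B_def by (simp add: mat_delete_def)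
  have c: "c \<in> carrier_vec k" by (simp add: c_def)
  have row0: "row A 0 = vCons a (0\<^sub>v k)"
    using A z by (intro eq_vecI) (auto simp: a_def vec_index_vCons)
  have rowS: "row A (Suc i) = vCons (c $ i) (row B i)" if "i < k" for i
  proof (rule eq_vecI)
    fix j assume "j < dim_vec (vCons (c $ i) (row B i))"
    then have j: "j < Suc k" using B that by simp
    show "row A (Suc i) $ j = vCons (c $ i) (row B i) $ j"
      using A B that j by (cases j) (auto simp: c_def B_def mat_delete_def)
  qed (use A B that in auto)
  have mult: "A *\<^sub>v vCons t q = vCons (a * t) (t \<cdot>\<^sub>v c + B *\<^sub>v q)" if q: "q \<in> carrier_vec k" for t q
  proof (rule eq_vecI)
    fix i assume i: "i < dim_vec (vCons (a * t) (t \<cdot>\<^sub>v c + B *\<^sub>v q))"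
    show "(A *\<^sub>v vCons t q) $ i = vCons (a * t) (t \<cdot>\<^sub>v c + B *\<^sub>v q) $ i"
    proof (cases i)
      case 0
      then show ?thesis using A q by (simp add: row0)
    next
      case (Suc i')
      then show ?thesis using A B q i c by (simp add: rowS)
    qed
  qed (use A B in simp)
  have Rc: "R \<subseteq> carrier_vec k" using R B unfolding B_def[symmetric] lattice_transversal_def by auto
  have R1: "\<exists>!y. y \<in> R \<and> (\<exists>q\<in>carrier_vec k. x = y + B *\<^sub>v q)" if "x \<in> carrier_vec k" for x
    using R B that unfolding B_def[symmetric] lattice_transversal_def by auto
  define S where "S = (\<lambda>(s, y). vCons s y) ` ({0..<\<bar>a\<bar>} \<times> R)"
  have inj: "inj_on (\<lambda>(s, y). vCons s y) ({0..<\<bar>a\<bar>} \<times> R)"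
    by (auto simp: inj_on_def)
  have "card S = nat \<bar>a\<bar> * card R"
    unfolding S_def by (subst card_image[OF inj]) (simp add: card_cartesian_product)
  moreover have "finite S" unfolding S_def using fin by simp
  moreover have "lattice_transversal A S"
    unfolding lattice_transversal_def
  proof (intro conjI ballI)
    show "S \<subseteq> carrier_vec (dim_row A)" using Rc A by (auto simp: S_def)
    fix x :: "int vec" assume "x \<in> carrier_vec (dim_row A)"
    then have "x \<in> carrier_vec (Suc k)" using A by simp
    then obtain \<xi> x' where x: "x = vCons \<xi> x'" "x' \<in> carrier_vec k"
      by (rule vec_carrier_Suc_cases)
    have a0: "a \<noteq> 0" using a by (simp add: a_def)
    define s where "s = \<xi> mod \<bar>a\<bar>"
    \<comment> \<open>The sign makes \<open>\<xi> = s + a * t\<close> hold for negative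
      \<open>a\<close> too, while \<open>s\<close> stays in
      \<open>{0..<\<bar>a\<bar>}\<close>.\<close>
    define t where "t = sgn a * (\<xi> div \<bar>a\<bar>)"
    have st: "\<xi> = s + a * t" unfolding s_def t_def
      by (metis abs_sgn add.commute div_mult_mod_eq mult.assoc mult.commute)
    have s: "s \<in> {0..<\<bar>a\<bar>}" using a0 by (simp add: s_def)
    obtain y q where y: "y \<in> R" and q: "q \<in> carrier_vec k" and xy: "x' - t \<cdot>\<^sub>v c = y + B *\<^sub>v q"
      using R1[of "x' - t \<cdot>\<^sub>v c"] x c by auto
    have yc: "y \<in> carrier_vec k" using y Rc by auto
    show "\<exists>!y. y \<in> S \<and> (\<exists>q\<in>carrier_vec (dim_col A). x = y + A *\<^sub>v q)"
    proof (rule ex1I[of _ "vCons s y"])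
      have "x' = (x' - t \<cdot>\<^sub>v c) + t \<cdot>\<^sub>v c" using x c by (auto intro!: eq_vecI)
      also have "\<dots> = y + (t \<cdot>\<^sub>v c + B *\<^sub>v q)" unfolding xy using yc B c q by (auto intro!: eq_vecI)
      finally have "x = vCons s y + A *\<^sub>v vCons t q"
        using st q x by (simp add: mult vCons_add)
      then show "vCons s y \<in> S \<and> (\<exists>q\<in>carrier_vec (dim_col A). x = vCons s y + A *\<^sub>v q)"
        using A q s y by (auto simp: S_def)
    next
      fix y' assume "y' \<in> S \<and> (\<exists>q\<in>carrier_vec (dim_col A). x = y' + A *\<^sub>v q)"
      then obtain s' y1 q' where y': "y' = vCons s' y1" and s': "s' \<in> {0..<\<bar>a\<bar>}" and y1: "y1 \<in> R"
        and q': "q' \<in> carrier_vec (Suc k)" and xx: "x = y' + A *\<^sub>v q'" using A by (auto simp: S_def)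
      from q' obtain t' q1 where q'_eq: "q' = vCons t' q1" and q1: "q1 \<in> carrier_vec k"
        by (rule vec_carrier_Suc_cases)
      have y1c: "y1 \<in> carrier_vec k" using y1 Rc by auto
      have e: "\<xi> = s' + a * t'" "x' = y1 + (t' \<cdot>\<^sub>v c + B *\<^sub>v q1)"
        using xx x by (simp_all add: y' q'_eq mult[OF q1] vCons_add)
      have "s' = s" unfolding s_def e(1) using s'
        by (metis atLeastLessThan_iff mod_mult_self1 mod_pos_pos_trivial mult.commute abs_dvd_iff dvd_triv_left mod_add_right_eq dvd_eq_mod_eq_0 add_0_right)
      with e(1) st a0 have t: "t' = t" by simp
      have "x' - t \<cdot>\<^sub>v c = y1 + B *\<^sub>v q1"
        unfolding e(2) t using y1c c B q1 by (auto intro!: eq_vecI)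
      moreover have "x' - t \<cdot>\<^sub>v c \<in> carrier_vec k" using x c by simp
      ultimately have "y1 = y" using R1[of "x' - t \<cdot>\<^sub>v c"] xy y y1 q q1 by blast
      with \<open>s' = s\<close> show "y' = vCons s y" by (simp add: y')
    qed
  qed
  ultimately show ?thesis unfolding a_def by blast
qed

lemma det_first_row_sparse:
  assumes A: "(A :: 'a :: comm_ring_1 mat) \<in> carrier_mat (Suc k) (Suc k)"
    and z: "\<And>j. 0 < j \<Longrightarrow> j \<le> k \<Longrightarrow> A $$ (0, j) = 0"
  shows "det A = A $$ (0, 0) * det (mat_delete A 0 0)"
proof -
  have "det A = (\<Sum>j<Suc k. A $$ (0, j) * cofactor A 0 j)"
    by (rule laplace_expansion_row[OF A]) simp
  also have "\<dots> = A $$ (0, 0) * cofactor A 0 0"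
    unfolding sum.lessThan_Suc_shift using z by simp
  finally show ?thesis by (simp add: cofactor_def)
qed

text \<open>Euclid's algorithm on the first row: column operations lower the sum of the absolute
  values of its entries until a single nonzero entry is left, which is swapped into column 0. Then
  the previous lemma and the induction hypothesis for the minor apply.\<close>

lemma lattice_transversal_exists:
  assumes "A \<in> carrier_mat k k" "det A \<noteq> 0"
  shows "\<exists>R. finite R \<and> card R = nat \<bar>det A\<bar> \<and> lattice_transversal A R"
  using assms
proof (induction k arbitrary: A)
  case 0
  then have "lattice_transversal A {0\<^sub>v 0}" by (auto simp: lattice_transversal_def intro!: bexI[of _ "0\<^sub>v 0"] eq_vecI)
  with 0 show ?case by (intro exI[of _ "{0\<^sub>v 0}"]) simp
next
  case (Suc k)
  have base: "\<exists>R. finite R \<and> card R = nat \<bar>det A\<bar> \<and> lattice_transversal A R"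
    if A: "A \<in> carrier_mat (Suc k) (Suc k)" and d: "det A \<noteq> 0"
      and z: "\<And>j. 0 < j \<Longrightarrow> j \<le> k \<Longrightarrow> A $$ (0, j) = 0" for A :: "int mat"
  proof -
    have e: "det A = A $$ (0, 0) * det (mat_delete A 0 0)"
      by (rule det_first_row_sparse[OF A z])
    have "mat_delete A 0 0 \<in> carrier_mat k k" using A by (simp add: mat_delete_def)
    then obtain R where "finite R" "card R = nat \<bar>det (mat_delete A 0 0)\<bar>"
      "lattice_transversal (mat_delete A 0 0) R" using Suc.IH[of "mat_delete A 0 0"] d e by auto
    with lattice_transversal_Suc[OF A z, of R] d e show ?thesis
      by (auto simp: abs_mult nat_mult_distrib)
  qed
  have "\<exists>R. finite R \<and> card R = nat \<bar>det A\<bar> \<and> lattice_transversal A R"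
    if "A \<in> carrier_mat (Suc k) (Suc k)" and "det A \<noteq> 0" for A :: "int mat"
    using that
  proof (induction "\<Sum>j<Suc k. nat \<bar>A $$ (0, j)\<bar>" arbitrary: A rule: less_induct)
    case less
    note A = less.prems(1) and d = less.prems(2)
    show ?case
    proof (cases "\<exists>i j. i < Suc k \<and> j < Suc k \<and> i \<noteq> j \<and> A $$ (0, i) \<noteq> 0 \<and> A $$ (0, j) \<noteq> 0")
      case True
      then obtain i j where ij: "i < Suc k" "j < Suc k" "i \<noteq> j" "A $$ (0, j) \<noteq> 0"
        "\<bar>A $$ (0, j)\<bar> \<le> \<bar>A $$ (0, i)\<bar>" by (metis linear)
      \<comment> \<open>Adding \<open>b\<close> times column \<open>j\<close> to column
        \<open>i\<close> lowers \<open>\<bar>A $$ (0, i)\<bar>\<close> by exactly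
        \<open>\<bar>A $$ (0, j)\<bar>\<close>, because the latter is the smaller of the
        two.\<close>
      define b where "b = - (sgn (A $$ (0, i)) * sgn (A $$ (0, j)))"
      define U where "U = addrow_mat (Suc k) b j i"
      define V where "V = addrow_mat (Suc k) (- b) j i"
      have U: "U \<in> carrier_mat (Suc k) (Suc k)" and V: "V \<in> carrier_mat (Suc k) (Suc k)"
        by (simp_all add: U_def V_def)
      have AU: "addcol b i j A = A * U" unfolding U_def by (rule addcol_mat[OF A ij(2)])
      have "A * U * V = addcol (- b) i j (addcol b i j A)" unfolding V_def AU
        by (rule addcol_mat[symmetric]) (use A U ij in auto)
      also have "\<dots> = A" using A ij by (intro eq_matI) auto
      finally have UV: "A * U * V = A" .
      have dd: "det (A * U) = det A" unfolding AU[symmetric] by (rule det_addcol[OF ij(2,3) A])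
      have lt: "nat \<bar>(A * U) $$ (0, i)\<bar> < nat \<bar>A $$ (0, i)\<bar>"
        unfolding AU[symmetric] using A ij by (auto simp: b_def sgn_if)
      have eq: "(A * U) $$ (0, l) = A $$ (0, l)" if "l < Suc k" "l \<noteq> i" for l
        unfolding AU[symmetric] using A ij that by auto
      have "(\<Sum>l<Suc k. nat \<bar>(A * U) $$ (0, l)\<bar>) < (\<Sum>l<Suc k. nat \<bar>A $$ (0, l)\<bar>)"
        by (rule sum_strict_mono_ex1) (use lt eq ij in \<open>auto intro!: bexI[of _ i]\<close>, metis eq lt nat_less_le lessThan_iff order.order_iff_strict)
      then obtain R where "finite R" "card R = nat \<bar>det A\<bar>" "lattice_transversal (A * U) R"
        using less.hyps[of "A * U"] A U d dd by auto
      with lattice_transversal_right_unimodular[OF A U V UV] show ?thesis by blast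
    next
      case False
      \<comment> \<open>At most one entry of the first row is nonzero here; the determinant
        guarantees that there is one.\<close>
      have "det A = (\<Sum>j<Suc k. A $$ (0, j) * cofactor A 0 j)"
        by (rule laplace_expansion_row[OF A]) simp
      with d obtain j where j: "j < Suc k" "A $$ (0, j) \<noteq> 0"
        by (metis (no_types, lifting) lessThan_iff mult_eq_0_iff sum.neutral)
      show ?thesis
      proof (cases "j = 0")
        case True
        then show ?thesis using base[OF A d] False j by (metis less_Suc_eq_le less_numeral_extra(3))
      next
        case j0: False
        define U :: "int mat" where "U = swaprows_mat (Suc k) 0 j"
        have U: "U \<in> carrier_mat (Suc k) (Suc k)" by (simp add: U_def)
        have AU: "swapcols 0 j A = A * U" unfolding U_def by (rule swapcols_mat[OF A]) (use j in auto)
        have "A * U * U = swapcols 0 j (swapcols 0 j A)" unfolding AU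
          unfolding U_def by (rule swapcols_mat[symmetric]) (use A U j in auto)
        also have "\<dots> = A" using A j by (intro eq_matI) auto
        finally have UV: "A * U * U = A" .
        have dd: "det (A * U) = - det A" unfolding AU[symmetric]
          by (rule det_swapcols) (use A j j0 in auto)
        have "A $$ (0, l) = 0" if "l < Suc k" "l \<noteq> j" for l
          using False j that by blast
        then have "(A * U) $$ (0, l) = 0" if "0 < l" "l \<le> k" for l
          unfolding AU[symmetric] using A j j0 that by auto
        then obtain R where "finite R" "card R = nat \<bar>det A\<bar>" "lattice_transversal (A * U) R"
          using base[of "A * U"] A U d dd by auto
        with lattice_transversal_right_unimodular[OF A U U UV] show ?thesis by blast
      qed
    qed
  qed
  with Suc.prems show ?case by blast
qed

lemma lattice_transversal_card:
  assumes "A \<in> carrier_mat k k" "det A \<noteq> 0" "lattice_transversal A R"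
  shows "finite R" "card R = nat \<bar>det A\<bar>"
  using lattice_transversal_exists[OF assms(1,2)] lattice_transversal_bij[OF assms(1) _ assms(3)]
  by (metis bij_betw_finite, metis bij_betw_same_card)

section \<open>Determinants\<close>

lemma permutes_less:
  fixes n :: nat
  shows "p permutes {0..<n} \<Longrightarrow> i < n \<Longrightarrow> p i < n"
  using permutes_in_image[of p "{0..<n}" i] by simp

lemma abs_signof_mult: "\<bar>signof p * x\<bar> = \<bar>x :: int\<bar>"
  by (simp add: abs_mult sign_def)

lemma abs_det_permute_cols:
  assumes A: "(A :: int mat) \<in> carrier_mat n n" and p: "p permutes {0..<n}"
  shows "\<bar>det (mat n n (\<lambda>(i, j). A $$ (i, p j)))\<bar> = \<bar>det A\<bar>"
proof -
  have "det (mat n n (\<lambda>(i, j). A $$ (i, p j))) = det (transpose_mat (mat n n (\<lambda>(i, j). A $$ (i, p j))))"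
    by (rule det_transpose[of _ n, symmetric]) simp
  also have "transpose_mat (mat n n (\<lambda>(i, j). A $$ (i, p j)))
      = mat n n (\<lambda>(i, j). transpose_mat A $$ (p i, j))"
    using A p by (intro eq_matI) (auto simp: permutes_less)
  also have "det \<dots> = signof p * det (transpose_mat A)"
    by (rule det_permute_rows) (use A p in auto)
  finally show ?thesis using det_transpose[OF A] by (simp only: abs_signof_mult)
qed

section \<open>Laplace expansion along the first \<open>r\<close> rows\<close>

definition split_rows :: "nat \<Rightarrow> 'a :: zero mat \<Rightarrow> nat set \<Rightarrow> 'a mat" where
  "split_rows r N B = mat (dim_row N) (dim_col N)
     (\<lambda>(i, j). if (i < r) = (j \<in> B) then N $$ (i, j) else 0)"

lemma split_rows_carrier [simp]: "N \<in> carrier_mat n m \<Longrightarrow> split_rows r N B \<in> carrier_mat n m"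
  by (auto simp: split_rows_def)

lemma permutes_split_iff:
  fixes n :: nat
  assumes p: "p permutes {0..<n}" and r: "r \<le> n" and B: "B \<subseteq> {..<n}"
  shows "(\<forall>i<n. (i < r) = (p i \<in> B)) \<longleftrightarrow> B = p ` {..<r}"
proof
  assume *: "\<forall>i<n. (i < r) = (p i \<in> B)"
  show "B = p ` {..<r}"
  proof
    show "B \<subseteq> p ` {..<r}"
    proof
      fix j assume j: "j \<in> B"
      then have "j \<in> p ` {0..<n}" using B permutes_image[OF p] by auto
      then obtain i where "i < n" "j = p i" by auto
      then show "j \<in> p ` {..<r}" using * j by auto
    qed
    show "p ` {..<r} \<subseteq> B" using * r by (auto dest: less_le_trans)
  qed
next
  assume "B = p ` {..<r}"
  then show "\<forall>i<n. (i < r) = (p i \<in> B)"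
    using permutes_inj[OF p] by (auto simp: inj_image_mem_iff dest: injD)
qed

text \<open>The term of \<open>p\<close> avoids all zeroed entries exactly if \<open>p\<close> maps
  the first \<open>r\<close> rows onto the columns \<open>B\<close>. The sum still runs over all
  permutations, so that it can later be exchanged with the sum over \<open>B\<close>.\<close>

lemma det_split_rows_leibniz:
  assumes N: "(N :: 'a :: comm_ring_1 mat) \<in> carrier_mat n n" and r: "r \<le> n" and B: "B \<subseteq> {..<n}"
  shows "det (split_rows r N B) =
    (\<Sum>p | p permutes {0..<n}. if B = p ` {..<r} then signof p * (\<Prod>i = 0..<n. N $$ (i, p i)) else 0)"
proof -
  have "signof p * (\<Prod>i = 0..<n. split_rows r N B $$ (i, p i))
      = (if B = p ` {..<r} then signof p * (\<Prod>i = 0..<n. N $$ (i, p i)) else 0)"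
    if p: "p permutes {0..<n}" for p
  proof -
    have lt: "p i < n" if "i < n" for i using p that by (simp add: permutes_less)
    show ?thesis
    proof (cases "B = p ` {..<r}")
      case True
      then have "\<forall>i<n. (i < r) = (p i \<in> B)" using permutes_split_iff[OF p r B] by blast
      then have "(\<Prod>i = 0..<n. split_rows r N B $$ (i, p i)) = (\<Prod>i = 0..<n. N $$ (i, p i))"
        using N lt by (intro prod.cong) (auto simp: split_rows_def)
      with True show ?thesis by simp
    next
      case False
      then obtain i where "i < n" "(i < r) \<noteq> (p i \<in> B)" using permutes_split_iff[OF p r B] by blast
      then have "split_rows r N B $$ (i, p i) = 0" using N lt by (auto simp: split_rows_def)
      then have "(\<Prod>i = 0..<n. split_rows r N B $$ (i, p i)) = 0"
        using \<open>i < n\<close> by (intro prod_zero) auto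
      with False show ?thesis by simp
    qed
  qed
  then show ?thesis
    using det_def'[of "split_rows r N B" n] N by (simp only: split_rows_carrier) (rule sum.cong, auto)
qed

lemma det_eq_sum_split_rows:
  assumes N: "(N :: 'a :: comm_ring_1 mat) \<in> carrier_mat n n" and r: "r \<le> n"
  shows "det N = (\<Sum>B\<in>Pow {..<n}. det (split_rows r N B))"
proof -
  have "(\<Sum>B\<in>Pow {..<n}. det (split_rows r N B)) = (\<Sum>B\<in>Pow {..<n}. \<Sum>p | p permutes {0..<n}.
      if B = p ` {..<r} then signof p * (\<Prod>i = 0..<n. N $$ (i, p i)) else 0)"
    using det_split_rows_leibniz[OF N r] by (intro sum.cong) auto
  also have "\<dots> = (\<Sum>p | p permutes {0..<n}. \<Sum>B\<in>Pow {..<n}.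
      if B = p ` {..<r} then signof p * (\<Prod>i = 0..<n. N $$ (i, p i)) else 0)"
    by (rule sum.swap)
  also have "\<dots> = (\<Sum>p | p permutes {0..<n}. signof p * (\<Prod>i = 0..<n. N $$ (i, p i)))"
  proof (rule sum.cong[OF refl])
    fix p assume "p \<in> {p. p permutes {0..<n}}"
    then have "p ` {..<r} \<in> Pow {..<n}" using r by (auto simp: permutes_less)
    then show "(\<Sum>B\<in>Pow {..<n}. if B = p ` {..<r} then signof p * (\<Prod>i = 0..<n. N $$ (i, p i)) else 0)
        = signof p * (\<Prod>i = 0..<n. N $$ (i, p i))" by simp
  qed
  also have "\<dots> = det N" using det_def'[OF N] by simp
  finally show ?thesis by simp
qed

lemma det_split_rows_nonzero_card:
  assumes N: "(N :: 'a :: comm_ring_1 mat) \<in> carrier_mat n n" and r: "r \<le> n" and B: "B \<subseteq> {..<n}"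
    and d: "det (split_rows r N B) \<noteq> 0"
  shows "card B = r"
proof -
  obtain p where p: "p permutes {0..<n}" "B = p ` {..<r}"
  proof (rule ccontr)
    assume "\<not> thesis"
    then have "\<And>p. p permutes {0..<n} \<Longrightarrow> B \<noteq> p ` {..<r}" using that by blast
    then have "det (split_rows r N B) = 0"
      unfolding det_split_rows_leibniz[OF N r B] by (intro sum.neutral) auto
    with d show False by simp
  qed
  then show ?thesis using permutes_inj[OF p(1)] by (simp add: card_image inj_on_subset)
qed

text \<open>Lists \<open>B\<close> in increasing order and then its complement, in the order in
  which \<open>submatrix\<close> lists columns. The identity from \<open>n\<close> on is required by
  \<open>permutes\<close>.\<close>

definition pick_split :: "nat \<Rightarrow> nat \<Rightarrow> nat set \<Rightarrow> nat \<Rightarrow> nat" where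
  "pick_split r n B j =
     (if j < r then pick B j else if j < n then pick ({..<n} - B) (j - r) else j)"

lemma pick_inj:
  assumes "pick S i = pick S j" "i < card S" "j < card S"
  shows "i = j"
  using assms pick_mono_le[of i S j] pick_mono_le[of j S i] by (metis less_irrefl nat_neq_iff)

lemma pick_split_permutes:
  assumes B: "B \<subseteq> {..<n}" and c: "card B = r" and r: "r \<le> n"
  shows "pick_split r n B permutes {0..<n}"
proof (rule bij_imp_permutes)
  have c': "card ({..<n} - B) = n - r" using B c by (simp add: card_Diff_subset finite_subset)
  have 1: "pick B j \<in> B" if "j < r" for j using that c by (simp add: pick_in_set_le)
  have 2: "pick ({..<n} - B) (j - r) \<in> {..<n} - B" if "r \<le> j" "j < n" for j
    using that c' by (intro pick_in_set_le) auto
  have sub: "pick_split r n B ` {0..<n} \<subseteq> {0..<n}"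
    using 1 2 B by (auto simp: pick_split_def subset_iff not_less)
  have "inj_on (pick_split r n B) {0..<n}"
  proof (rule inj_onI)
    fix i j assume ij: "i \<in> {0..<n}" "j \<in> {0..<n}" "pick_split r n B i = pick_split r n B j"
    have iff: "pick_split r n B l \<in> B \<longleftrightarrow> l < r" if "l < n" for l
      using 1[of l] 2[of l] that by (cases "l < r") (auto simp: pick_split_def)
    show "i = j"
    proof (cases "i < r")
      case True
      with iff[of i] iff[of j] ij have "j < r" by simp
      with True ij c have "pick B i = pick B j" "i < card B" "j < card B"
        by (simp_all add: pick_split_def)
      then show ?thesis by (rule pick_inj)
    next
      case False
      with iff[of i] iff[of j] ij have jr: "\<not> j < r" by simp
      have "i - r = j - r"
        by (rule pick_inj[of "{..<n} - B"]) (use jr ij False c' in \<open>simp_all add: pick_split_def\<close>)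
      with jr False show ?thesis by simp
    qed
  qed
  then show "bij_betw (pick_split r n B) {0..<n} {0..<n}"
    using sub by (simp add: bij_betw_def endo_inj_surj)
qed (use r in \<open>auto simp: pick_split_def\<close>)

text \<open>Moving the columns in \<open>B\<close> to the front makes the matrix block diagonal. The
  sign of the column permutation disappears in the absolute value.\<close>

lemma abs_det_split_rows:
  assumes D: "(D :: int mat) \<in> carrier_mat r n" and E: "E \<in> carrier_mat m n" and n: "n = r + m"
    and B: "B \<subseteq> {..<n}" and c: "card B = r"
  shows "\<bar>det (split_rows r (D @\<^sub>r E) B)\<bar>
    = \<bar>det (submatrix D UNIV B)\<bar> * \<bar>det (submatrix E UNIV ({..<n} - B))\<bar>"
proof -
  let ?Q = "split_rows r (D @\<^sub>r E) B" and ?p = "pick_split r n B"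
  have p: "?p permutes {0..<n}" using pick_split_permutes[OF B c] n by simp
  have DE: "D @\<^sub>r E \<in> carrier_mat n n" using carrier_append_rows[OF D E] n by simp
  have c': "card ({..<n} - B) = m" using B c n by (simp add: card_Diff_subset finite_subset)
  have e1: "{j. j < n \<and> j \<in> B} = B" "{j. j < n \<and> j \<in> {..<n} - B} = {..<n} - B" using B by auto
  have SD: "submatrix D UNIV B = mat r r (\<lambda>(i, j). D $$ (i, pick B j))"
    using D c e1(1) by (simp add: submatrix_def pick_UNIV)
  have SE: "submatrix E UNIV ({..<n} - B) = mat m m (\<lambda>(i, j). E $$ (i, pick ({..<n} - B) j))"
    using E c' unfolding submatrix_def pick_UNIV carrier_matD(2)[OF E] e1(2) by simp
  have 1: "pick B j \<in> B" if "j < r" for j using that c by (simp add: pick_in_set_le)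
  have 2: "pick ({..<n} - B) j \<in> {..<n} - B" if "j < m" for j
    using that c' by (intro pick_in_set_le) auto
  have "mat n n (\<lambda>(i, j). ?Q $$ (i, ?p j))
      = four_block_mat (submatrix D UNIV B) (0\<^sub>m r m) (0\<^sub>m m r) (submatrix E UNIV ({..<n} - B))"
    (is "?L = ?R")
  proof (rule eq_matI)
    fix i j assume "i < dim_row ?R" "j < dim_col ?R"
    then have ij: "i < r + m" "j < r + m" by (simp_all add: SD SE)
    then have ijn: "i < n" "j < n" by (simp_all add: n)
    have pj: "?p j < n" using p ijn by (simp add: permutes_less)
    show "?L $$ (i, j) = ?R $$ (i, j)"
    proof (cases "j < r")
      case True
      then have "?p j \<in> B" "?p j = pick B j" using 1 by (simp_all add: pick_split_def)
      then show ?thesis using ij ijn True pj D E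
        by (auto simp: SD SE split_rows_def append_rows_def)
    next
      case False
      then have "?p j = pick ({..<n} - B) (j - r)" using ij n by (simp add: pick_split_def)
      moreover from this have "?p j \<notin> B" using 2[of "j - r"] False ij by auto
      ultimately show ?thesis using ij ijn False pj D E
        by (auto simp: SD SE split_rows_def append_rows_def)
    qed
  qed (simp_all add: SD SE, simp_all add: n)
  then have "\<bar>det ?Q\<bar> = \<bar>det ?R\<bar>"
    using abs_det_permute_cols[of ?Q, OF _ p] DE by simp
  also have "det ?R = det (submatrix D UNIV B) * det (submatrix E UNIV ({..<n} - B))"
    by (rule det_four_block_mat_upper_right_zero) (auto simp: SD SE)
  finally show ?thesis by (simp add: abs_mult)
qed

text \<open>Jacobi's identity for a minor and the complementary minor of the inverse, proved without
  division: one block matrix is multiplied by \<open>U\<close> and determinants are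
  compared.\<close>

lemma jacobi_complementary_minor:
  assumes U: "(U :: 'a :: idom mat) \<in> carrier_mat (r + m) (r + m)" and V: "V \<in> carrier_mat (r + m) (r + m)"
    and UV: "U * V = 1\<^sub>m (r + m)"
  shows "det (mat r r (\<lambda>(i, j). U $$ (i, j))) = det U * det (mat m m (\<lambda>(i, j). V $$ (i + r, j + r)))"
proof -
  define U1 where "U1 = mat r r (\<lambda>(i, j). U $$ (i, j))"
  define U2 where "U2 = mat r m (\<lambda>(i, j). U $$ (i, j + r))"
  define U3 where "U3 = mat m r (\<lambda>(i, j). U $$ (i + r, j))"
  define U4 where "U4 = mat m m (\<lambda>(i, j). U $$ (i + r, j + r))"
  define V1 where "V1 = mat r r (\<lambda>(i, j). V $$ (i, j))"
  define V2 where "V2 = mat r m (\<lambda>(i, j). V $$ (i, j + r))"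
  define V3 where "V3 = mat m r (\<lambda>(i, j). V $$ (i + r, j))"
  define V4 where "V4 = mat m m (\<lambda>(i, j). V $$ (i + r, j + r))"
  note defs = U1_def U2_def U3_def U4_def V1_def V2_def V3_def V4_def
  have c: "U1 \<in> carrier_mat r r" "U2 \<in> carrier_mat r m" "U3 \<in> carrier_mat m r" "U4 \<in> carrier_mat m m"
    "V1 \<in> carrier_mat r r" "V2 \<in> carrier_mat r m" "V3 \<in> carrier_mat m r" "V4 \<in> carrier_mat m m"
    by (simp_all add: defs)
  have Ub: "U = four_block_mat U1 U2 U3 U4" using U by (intro eq_matI) (auto simp: defs)
  have Vb: "V = four_block_mat V1 V2 V3 V4" using V by (intro eq_matI) (auto simp: defs)
  have one: "four_block_mat (U1 * V1 + U2 * V3) (U1 * V2 + U2 * V4) (U3 * V1 + U4 * V3) (U3 * V2 + U4 * V4)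
      = four_block_mat (1\<^sub>m r) (0\<^sub>m r m) (0\<^sub>m m r) (1\<^sub>m m)"
    using UV mult_four_block_mat[OF c] unfolding Ub Vb by simp
  have z: "U1 * V2 + U2 * V4 = 0\<^sub>m r m"
  proof (rule eq_matI)
    fix i j assume ij: "i < dim_row (0\<^sub>m r m)" "j < dim_col (0\<^sub>m r m)"
    have "four_block_mat (U1 * V1 + U2 * V3) (U1 * V2 + U2 * V4) (U3 * V1 + U4 * V3) (U3 * V2 + U4 * V4)
       $$ (i, j + r) = four_block_mat (1\<^sub>m r) (0\<^sub>m r m) (0\<^sub>m m r) (1\<^sub>m m) $$ (i, j + r)"
      by (simp only: one)
    then show "(U1 * V2 + U2 * V4) $$ (i, j) = 0\<^sub>m r m $$ (i, j)" using ij c by simp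
  qed (use c in auto)
  have i: "U3 * V2 + U4 * V4 = 1\<^sub>m m"
  proof (rule eq_matI)
    fix i j assume ij: "i < dim_row (1\<^sub>m m)" "j < dim_col (1\<^sub>m m)"
    have "four_block_mat (U1 * V1 + U2 * V3) (U1 * V2 + U2 * V4) (U3 * V1 + U4 * V3) (U3 * V2 + U4 * V4)
       $$ (i + r, j + r) = four_block_mat (1\<^sub>m r) (0\<^sub>m r m) (0\<^sub>m m r) (1\<^sub>m m) $$ (i + r, j + r)"
      by (simp only: one)
    then show "(U3 * V2 + U4 * V4) $$ (i, j) = 1\<^sub>m m $$ (i, j)" using ij c by simp
  qed (use c in auto)
  \<comment> \<open>The last \<open>m\<close> columns of \<open>V\<close>, preceded by the first
    \<open>r\<close> columns of the identity. Multiplication by \<open>U\<close> turns the former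
    into identity columns and keeps the first \<open>r\<close> columns of \<open>U\<close>.\<close>
  let ?T = "four_block_mat (1\<^sub>m r) V2 (0\<^sub>m m r) V4"
  have "U * ?T = four_block_mat (U1 * 1\<^sub>m r + U2 * 0\<^sub>m m r) (U1 * V2 + U2 * V4)
      (U3 * 1\<^sub>m r + U4 * 0\<^sub>m m r) (U3 * V2 + U4 * V4)"
    unfolding Ub by (rule mult_four_block_mat) (use c in auto)
  also have "\<dots> = four_block_mat U1 (0\<^sub>m r m) U3 (1\<^sub>m m)"
    unfolding z i using c by simp
  finally have e: "U * ?T = four_block_mat U1 (0\<^sub>m r m) U3 (1\<^sub>m m)" .
  have "det U * det ?T = det (U * ?T)"
    by (rule det_mult[symmetric]) (use U c in auto)
  also have "\<dots> = det U1 * det (1\<^sub>m m :: 'a mat)"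
    unfolding e by (rule det_four_block_mat_upper_right_zero) (use c in auto)
  also have "det ?T = det (1\<^sub>m r :: 'a mat) * det V4"
    by (rule det_four_block_mat_lower_left_zero) (use c in auto)
  finally show ?thesis by (simp add: U1_def V4_def)
qed

text \<open>\<open>F\<close> and \<open>K\<close> complete \<open>D\<close> and \<open>E\<close> to
  two square integer matrices, each the inverse transpose of the other. Permuting the columns of
  both in the same way preserves this and moves \<open>B\<close> to the front, where Jacobi's
  identity applies.\<close>

lemma abs_det_complementary_cols:
  assumes D: "(D :: int mat) \<in> carrier_mat r n" and F: "F \<in> carrier_mat m n"
    and K: "K \<in> carrier_mat r n" and E: "E \<in> carrier_mat m n" and n: "n = r + m"
    and UV: "(D @\<^sub>r F) * transpose_mat (K @\<^sub>r E) = 1\<^sub>m n"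
    and B: "B \<subseteq> {..<n}" and c: "card B = r"
  shows "\<bar>det (submatrix D UNIV B)\<bar> = \<bar>det (submatrix E UNIV ({..<n} - B))\<bar>"
proof -
  let ?p = "pick_split r n B"
  have p: "?p permutes {0..<n}" using pick_split_permutes[OF B c] n by simp
  have DF: "D @\<^sub>r F \<in> carrier_mat n n" and KE: "K @\<^sub>r E \<in> carrier_mat n n"
    using carrier_append_rows D F K E n by auto
  have c': "card ({..<n} - B) = m" using B c n by (simp add: card_Diff_subset finite_subset)
  have e1: "{j. j < n \<and> j \<in> B} = B" "{j. j < n \<and> j \<in> {..<n} - B} = {..<n} - B" using B by auto
  have SD: "submatrix D UNIV B = mat r r (\<lambda>(i, j). D $$ (i, pick B j))"
    using D c e1(1) by (simp add: submatrix_def pick_UNIV)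
  have SE: "submatrix E UNIV ({..<n} - B) = mat m m (\<lambda>(i, j). E $$ (i, pick ({..<n} - B) j))"
    using E c' unfolding submatrix_def pick_UNIV carrier_matD(2)[OF E] e1(2) by simp
  have 1: "pick B j \<in> B" if "j < r" for j using that c by (simp add: pick_in_set_le)
  have 2: "pick ({..<n} - B) j \<in> {..<n} - B" if "j < m" for j
    using that c' by (intro pick_in_set_le) auto
  define U where "U = mat n n (\<lambda>(i, j). (D @\<^sub>r F) $$ (i, ?p j))"
  define W where "W = mat n n (\<lambda>(i, j). (K @\<^sub>r E) $$ (i, ?p j))"
  have U: "U \<in> carrier_mat n n" and W: "W \<in> carrier_mat n n" by (simp_all add: U_def W_def)
  have UW: "U * transpose_mat W = 1\<^sub>m n"
  proof (rule eq_matI)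
    fix i j assume ij: "i < dim_row (1\<^sub>m n :: int mat)" "j < dim_col (1\<^sub>m n :: int mat)"
    then have "(U * transpose_mat W) $$ (i, j)
        = (\<Sum>k = 0..<n. (D @\<^sub>r F) $$ (i, ?p k) * (K @\<^sub>r E) $$ (j, ?p k))"
      by (simp add: U_def W_def scalar_prod_def)
    also have "\<dots> = (\<Sum>k = 0..<n. (D @\<^sub>r F) $$ (i, k) * (K @\<^sub>r E) $$ (j, k))"
      by (rule sum.permute[OF p, symmetric, unfolded comp_def])
    also have "\<dots> = ((D @\<^sub>r F) * transpose_mat (K @\<^sub>r E)) $$ (i, j)"
      using ij DF KE by (simp add: scalar_prod_def)
    finally show "(U * transpose_mat W) $$ (i, j) = 1\<^sub>m n $$ (i, j)" unfolding UV .
  qed (simp_all add: U_def W_def)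
  \<comment> \<open>Both determinants are integers, so they are units; this removes the factor
    \<open>det U\<close> from Jacobi's identity.\<close>
  have "det U * det (transpose_mat W) = 1"
    using det_mult[of U n "transpose_mat W"] U W UW by simp
  then have dU: "\<bar>det U\<bar> = 1"
    by (metis abs_zmult_eq_1 abs_one)
  have pl: "?p j < n" if "j < n" for j using p that by (simp add: permutes_less)
  have U1: "mat r r (\<lambda>(i, j). U $$ (i, j)) = submatrix D UNIV B"
    unfolding SD
  proof (rule cong_mat)
    fix i j assume ij: "i < r" "j < r"
    then show "(\<lambda>(i, j). U $$ (i, j)) (i, j) = (\<lambda>(i, j). D $$ (i, pick B j)) (i, j)"
      using D F n pl[of j] by (simp add: U_def append_rows_def) (simp add: pick_split_def)
  qed simp_all
  have V4: "mat m m (\<lambda>(i, j). transpose_mat W $$ (i + r, j + r))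
      = transpose_mat (submatrix E UNIV ({..<n} - B))"
    unfolding SE
  proof (rule eq_matI)
    fix i j assume "i < dim_row (transpose_mat (mat m m (\<lambda>(i, j). E $$ (i, pick ({..<n} - B) j))))"
      "j < dim_col (transpose_mat (mat m m (\<lambda>(i, j). E $$ (i, pick ({..<n} - B) j))))"
    then have ij: "i < m" "j < m" by simp_all
    have "W $$ (j + r, i + r) = E $$ (j, ?p (i + r))"
      using ij n K E pl[of "i + r"] by (simp add: W_def append_rows_def)
    moreover have "?p (i + r) = pick ({..<n} - B) i" using ij n by (simp add: pick_split_def)
    ultimately show "mat m m (\<lambda>(i, j). transpose_mat W $$ (i + r, j + r)) $$ (i, j)
        = transpose_mat (mat m m (\<lambda>(i, j). E $$ (i, pick ({..<n} - B) j))) $$ (i, j)"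
      using ij n W by simp
  qed simp_all
  have "det (submatrix D UNIV B) = det U * det (transpose_mat (submatrix E UNIV ({..<n} - B)))"
    unfolding U1[symmetric] V4[symmetric]
    by (rule jacobi_complementary_minor) (use U W UW in \<open>simp_all add: n[symmetric]\<close>)
  also have "det (transpose_mat (submatrix E UNIV ({..<n} - B))) = det (submatrix E UNIV ({..<n} - B))"
    by (rule det_transpose[of _ m]) (simp add: SE)
  finally show ?thesis using dU by (simp add: abs_mult)
qed

section \<open>Half-open parallelepipeds and boundaries\<close>

text \<open>One coordinate of the disjointness argument; \<open>P\<close> and \<open>Q\<close> say
  whether the index belongs to the first and to the second basis. As \<open>a - a'\<close> and
  \<open>b - b'\<close> lie strictly between -1 and 1, a nonzero \<open>k\<close> gives the two
  factors opposite signs. For \<open>k = 0\<close> the product is \<open>- a * b'\<close> or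
  \<open>- a' * b\<close> if \<open>P\<close> and \<open>Q\<close> differ, and 0 if they
  agree.\<close>

lemma pack_term:
  fixes a a' b b' :: real and k :: int
  assumes P: "if P then 0 < a \<and> a < 1 \<and> b = 0 else a = 0 \<and> 0 < b \<and> b < 1"
    and Q: "if Q then 0 < a' \<and> a' < 1 \<and> b' = 0 else a' = 0 \<and> 0 < b' \<and> b' < 1"
  shows "(a - a' - k) * (b - b' + k) \<le> 0"
    and "(a - a' - k) * (b - b' + k) = 0 \<Longrightarrow> P = Q \<and> k = 0"
proof -
  have *: "k = 0 \<and> P = Q \<or> (a - a' - k) * (b - b' + k) < 0"
  proof -
    consider "k = 0" | "k \<ge> 1" | "k \<le> - 1" by linarith
    then show ?thesis
    proof cases
      case 1
      then show ?thesis using P Q by (cases P; cases Q) (auto simp: mult_less_0_iff)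
    next
      case 2
      then have "real_of_int k \<ge> 1" by simp
      then show ?thesis using P Q by (cases P; cases Q) (auto simp: mult_less_0_iff zero_less_mult_iff)
    next
      case 3
      then have "real_of_int k \<le> - 1" by linarith
      then show ?thesis using P Q by (cases P; cases Q) (auto simp: mult_less_0_iff zero_less_mult_iff)
    qed
  qed
  show "(a - a' - k) * (b - b' + k) \<le> 0"
    using * P Q by (cases P; cases Q) auto
  show "(a - a' - k) * (b - b' + k) = 0 \<Longrightarrow> P = Q \<and> k = 0"
    using * by auto
qed

text \<open>For \<open>s \<noteq> 0\<close>, the \<open>c\<close> for which
  \<open>c + \<epsilon> * s\<close> lies in the unit interval for all small positive
  \<open>\<epsilon>\<close>: the endpoint from which \<open>s\<close> points inwards is
  kept.\<close>

definition half_unit :: "real \<Rightarrow> real \<Rightarrow> bool" where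
  "half_unit s c \<longleftrightarrow> (if 0 < s then 0 \<le> c \<and> c < 1 else 0 < c \<and> c \<le> 1)"

lemma half_unit_bounds: "half_unit s c \<Longrightarrow> 0 \<le> c \<and> c \<le> 1"
  by (auto simp: half_unit_def split: if_splits)

lemma tendsto_line: "((\<lambda>\<epsilon>. c + \<epsilon> * s) \<longlongrightarrow> c) (at_right (0 :: real))"
proof -
  have "((\<lambda>\<epsilon>. c + \<epsilon> * s) \<longlongrightarrow> c + 0 * s) (at_right 0)"
    by (intro tendsto_add tendsto_mult tendsto_const tendsto_ident_at)
  then show ?thesis by simp
qed

text \<open>Outside the half-open interval the moving point is eventually outside the closed one, so
  "frequently" already decides. The weak hypothesis is what is left when a finite union of tiles is
  split into its members.\<close>

lemma frequently_in_unit_imp_half_unit: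
  assumes "\<exists>\<^sub>F \<epsilon> in at_right 0. 0 \<le> c + \<epsilon> * s \<and> c + \<epsilon> * s \<le> 1" and "s \<noteq> 0"
  shows "half_unit s c"
proof (rule ccontr)
  assume "\<not> half_unit s c"
  then consider "c < 0" | "c > 1" | "c = 1" "s > 0" | "c = 0" "s < 0"
    using assms(2) by (auto simp: half_unit_def not_less split: if_splits) linarith+
  then have "\<forall>\<^sub>F \<epsilon> in at_right 0. \<not> (0 \<le> c + \<epsilon> * s \<and> c + \<epsilon> * s \<le> 1)"
  proof cases
    case 1
    then show ?thesis using order_tendstoD(2)[OF tendsto_line, of c 0 s] by (auto elim: eventually_mono)
  next
    case 2
    then show ?thesis using order_tendstoD(1)[OF tendsto_line, of 1 c s] by (auto elim: eventually_mono)
  next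
    case 3
    then show ?thesis
      using eventually_at_right_less[of "0 :: real"] by (auto elim!: eventually_mono simp: not_le)
  next
    case 4
    then show ?thesis
      using eventually_at_right_less[of "0 :: real"]
      by (auto elim!: eventually_mono simp: not_le mult_less_0_iff)
  qed
  with assms(1) show False by (simp add: frequently_def)
qed

lemma half_unit_eventually:
  assumes "half_unit s c" and s: "s \<noteq> 0"
  shows "\<forall>\<^sub>F \<epsilon> in at_right 0. 0 < c + \<epsilon> * s \<and> c + \<epsilon> * s < 1"
proof (rule eventually_conj)
  show "\<forall>\<^sub>F \<epsilon> in at_right 0. 0 < c + \<epsilon> * s"
  proof (cases "c > 0")
    case True
    then show ?thesis using order_tendstoD(1)[OF tendsto_line] by blast
  next
    case False
    with assms have "c = 0" "s > 0" by (auto simp: half_unit_def split: if_splits)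
    then show ?thesis using eventually_at_right_less[of "0 :: real"] by (auto elim!: eventually_mono)
  qed
  show "\<forall>\<^sub>F \<epsilon> in at_right 0. c + \<epsilon> * s < 1"
  proof (cases "c < 1")
    case True
    then show ?thesis using order_tendstoD(2)[OF tendsto_line] by blast
  next
    case False
    with assms have "c = 1" "s < 0" by (auto simp: half_unit_def split: if_splits)
    then show ?thesis using eventually_at_right_less[of "0 :: real"]
      by (auto elim!: eventually_mono simp: mult_less_0_iff)
  qed
qed

lemma half_unit_int_shift:
  assumes "s \<noteq> 0"
  shows "\<exists>!q :: int. half_unit s (c - of_int q)"
proof (cases "s > 0")
  case True
  show ?thesis
  proof (rule ex1I[of _ "\<lfloor>c\<rfloor>"])
    show "half_unit s (c - \<lfloor>c\<rfloor>)" using True by (simp add: half_unit_def) linarith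
    show "q = \<lfloor>c\<rfloor>" if "half_unit s (c - of_int q)" for q :: int
      using that True by (simp add: half_unit_def) linarith
  qed
next
  case False
  show ?thesis
  \<comment> \<open>The remainder has to lie in the interval open at 0 and closed at 1, so an
    integer \<open>c\<close> leaves 1 and not 0.\<close>
  proof (rule ex1I[of _ "\<lceil>c\<rceil> - 1"])
    show "half_unit s (c - of_int (\<lceil>c\<rceil> - 1))" using False by (simp add: half_unit_def) linarith
    show "q = \<lceil>c\<rceil> - 1" if "half_unit s (c - of_int q)" for q :: int
      using that False by (simp add: half_unit_def) linarith
  qed
qed

section \<open>Coordinates of parallelepipeds\<close>

definition restrict_vec :: "nat set \<Rightarrow> 'a :: zero vec \<Rightarrow> 'a vec" where
  "restrict_vec B c = vec (dim_vec c) (\<lambda>j. if j \<in> B then c $ j else 0)"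

lemma restrict_vec_index [simp]:
  "j < dim_vec c \<Longrightarrow> restrict_vec B c $ j = (if j \<in> B then c $ j else 0)"
  by (simp add: restrict_vec_def)

lemma restrict_vec_dim [simp]: "dim_vec (restrict_vec B c) = dim_vec c"
  by (simp add: restrict_vec_def)

lemma restrict_vec_carrier [simp]: "restrict_vec B c \<in> carrier_vec n \<longleftrightarrow> c \<in> carrier_vec n"
  unfolding carrier_vec_def by simp

lemma restrict_vec_add:
  "c \<in> carrier_vec n \<Longrightarrow> d \<in> carrier_vec n \<Longrightarrow>
    restrict_vec B (c + d) = restrict_vec B c + (restrict_vec B d :: 'a :: monoid_add vec)"
  by (intro eq_vecI) auto

lemma restrict_vec_minus:
  "c \<in> carrier_vec n \<Longrightarrow> d \<in> carrier_vec n \<Longrightarrow>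
    restrict_vec B (c - d) = restrict_vec B c - (restrict_vec B d :: 'a :: group_add vec)"
  by (intro eq_vecI) auto

lemma restrict_vec_smult:
  "restrict_vec B (a \<cdot>\<^sub>v c) = a \<cdot>\<^sub>v (restrict_vec B c :: 'a :: mult_zero vec)"
  by (intro eq_vecI) auto

lemma restrict_vec_real: "restrict_vec B (real_vec c) = real_vec (restrict_vec B c)"
  by (intro eq_vecI) auto

lemma restrict_vec_cong:
  "c \<in> carrier_vec n \<Longrightarrow> B \<inter> {..<n} = C \<inter> {..<n} \<Longrightarrow> restrict_vec B c = restrict_vec C c"
  unfolding restrict_vec_def by (intro eq_vecI) (simp_all, metis IntD1 IntI lessThan_iff)

text \<open>Coefficients are given for all \<open>n\<close> columns and cut down to \<open>B\<close>
  afterwards. Thus one vector \<open>c\<close> serves as the coordinates of a point of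
  \<open>P\<^sub>1(B)\<close> and of a point of \<open>P\<^sub>2(B)\<close> at once.\<close>

lemma cols_parallelepiped_iff:
  assumes A: "A \<in> carrier_mat k n" and B: "B \<subseteq> {..<n}"
  shows "x \<in> cols_parallelepiped A B \<longleftrightarrow>
    (\<exists>c\<in>carrier_vec n. (\<forall>j<n. 0 \<le> c $ j \<and> c $ j \<le> 1) \<and> x = A *\<^sub>v restrict_vec B c)"
proof -
  have eq: "finsum_vec TYPE(real) (dim_row A) (\<lambda>j. a j \<cdot>\<^sub>v col A j) B = A *\<^sub>v restrict_vec B (vec n a')"
    if aa': "\<And>j. j \<in> B \<Longrightarrow> a' j = a j" for a a'
  proof (rule eq_vecI)
    have fin: "finite B" using B finite_subset by blast
    have car: "(\<lambda>j. a j \<cdot>\<^sub>v col A j) \<in> B \<rightarrow> carrier_vec k" using A by auto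
    show "dim_vec (finsum_vec TYPE(real) (dim_row A) (\<lambda>j. a j \<cdot>\<^sub>v col A j) B)
        = dim_vec (A *\<^sub>v restrict_vec B (vec n a'))"
      using finsum_vec_closed[OF car] A by simp
    fix i assume i: "i < dim_vec (A *\<^sub>v restrict_vec B (vec n a'))"
    then have i: "i < k" using A by simp
    have "finsum_vec TYPE(real) k (\<lambda>j. a j \<cdot>\<^sub>v col A j) B $ i = (\<Sum>j\<in>B. (a j \<cdot>\<^sub>v col A j) $ i)"
      by (rule index_finsum_vec[OF fin i car])
    also have "\<dots> = (\<Sum>j\<in>B. A $$ (i, j) * (if j \<in> B then a' j else 0))"
      using A B i aa' by (intro sum.cong) auto
    also have "\<dots> = (\<Sum>j\<in>{0..<n}. A $$ (i, j) * (if j \<in> B then a' j else 0))"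
      by (rule sum.mono_neutral_left) (use B in auto)
    also have "\<dots> = (A *\<^sub>v restrict_vec B (vec n a')) $ i"
      using A i by (auto simp: scalar_prod_def intro!: sum.cong)
    finally show "finsum_vec TYPE(real) (dim_row A) (\<lambda>j. a j \<cdot>\<^sub>v col A j) B $ i
        = (A *\<^sub>v restrict_vec B (vec n a')) $ i" using A by simp
  qed
  show ?thesis
  proof
    assume "x \<in> cols_parallelepiped A B"
    then obtain a where a: "\<forall>j\<in>B. 0 \<le> a j \<and> a j \<le> 1"
      "x = finsum_vec TYPE(real) (dim_row A) (\<lambda>j. a j \<cdot>\<^sub>v col A j) B"
      unfolding cols_parallelepiped_def by blast
    let ?c = "vec n (\<lambda>j. if j \<in> B then a j else 0)"
    have "x = A *\<^sub>v restrict_vec B ?c" unfolding a(2) by (rule eq) simp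
    with a(1) show "\<exists>c\<in>carrier_vec n. (\<forall>j<n. 0 \<le> c $ j \<and> c $ j \<le> 1) \<and> x = A *\<^sub>v restrict_vec B c"
      by (intro bexI[of _ ?c]) auto
  next
    assume "\<exists>c\<in>carrier_vec n. (\<forall>j<n. 0 \<le> c $ j \<and> c $ j \<le> 1) \<and> x = A *\<^sub>v restrict_vec B c"
    then obtain c where c: "c \<in> carrier_vec n" "\<forall>j<n. 0 \<le> c $ j \<and> c $ j \<le> 1" "x = A *\<^sub>v restrict_vec B c"
      by blast
    have "c = vec n (\<lambda>j. c $ j)" using c(1) by auto
    with eq[of "\<lambda>j. c $ j" "\<lambda>j. c $ j"] c(3)
    have "x = finsum_vec TYPE(real) (dim_row A) (\<lambda>j. c $ j \<cdot>\<^sub>v col A j) B" by simp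
    with c(2) B show "x \<in> cols_parallelepiped A B"
      unfolding cols_parallelepiped_def by (intro CollectI exI[of _ "\<lambda>j. c $ j"]) auto
  qed
qed

lemma cols_parallelepiped_subset:
  "A \<in> carrier_mat k n \<Longrightarrow> B \<subseteq> {..<n} \<Longrightarrow> cols_parallelepiped A B \<subseteq> carrier_vec k"
  by (auto simp: cols_parallelepiped_iff)

lemma mem_translate_iff:
  assumes S: "S \<subseteq> carrier_vec k" and t: "t \<in> carrier_vec k" and x: "x \<in> carrier_vec k"
  shows "x \<in> translate S t \<longleftrightarrow> x - t \<in> S"
proof
  assume "x \<in> translate S t"
  then obtain s where s: "s \<in> S" "x = s + t" by (auto simp: translate_def)
  then have "x - t = s" using S t by (intro eq_vecI) auto
  with s show "x - t \<in> S" by simp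
next
  assume "x - t \<in> S"
  moreover have "x = (x - t) + t" using x t by (intro eq_vecI) auto
  ultimately show "x \<in> translate S t" by (auto simp: translate_def)
qed

lemma translate_subset: "S \<subseteq> carrier_vec k \<Longrightarrow> t \<in> carrier_vec k \<Longrightarrow> translate S t \<subseteq> carrier_vec k"
  by (auto simp: translate_def)

text \<open>
  A point of a parallelepiped is approached by points \<open>x'\<close> whose small shifts \<open>x' + \<epsilon> w\<close> stay in the
  parallelepiped: move a little towards the centre.
\<close>

definition approachable :: "nat \<Rightarrow> real vec \<Rightarrow> real vec set \<Rightarrow> bool" where
  "approachable k w S \<longleftrightarrow> (\<forall>x\<in>S. \<forall>\<delta>>0. \<exists>x'\<in>carrier_vec k.
     \<forall>\<^sub>F \<epsilon> in at_right 0. x' + \<epsilon> \<cdot>\<^sub>v w \<in> S \<and> vec_dist k x (x' + \<epsilon> \<cdot>\<^sub>v w) < \<delta>)"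

lemma approachable_UN:
  assumes "\<And>i. i \<in> I \<Longrightarrow> approachable k w (S i)"
  shows "approachable k w (\<Union>i\<in>I. S i)"
  unfolding approachable_def
proof (intro ballI allI impI)
  fix x \<delta> assume "x \<in> (\<Union>i\<in>I. S i)" "(0 :: real) < \<delta>"
  then obtain i x' where i: "i \<in> I" "x' \<in> carrier_vec k"
    "\<forall>\<^sub>F \<epsilon> in at_right 0. x' + \<epsilon> \<cdot>\<^sub>v w \<in> S i \<and> vec_dist k x (x' + \<epsilon> \<cdot>\<^sub>v w) < \<delta>"
    using assms unfolding approachable_def by blast
  then show "\<exists>x'\<in>carrier_vec k. \<forall>\<^sub>F \<epsilon> in at_right 0. x' + \<epsilon> \<cdot>\<^sub>v w \<in> (\<Union>i\<in>I. S i) \<and> vec_dist k x (x' + \<epsilon> \<cdot>\<^sub>v w) < \<delta>"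
    by (intro bexI[of _ x']) (auto elim: eventually_mono)
qed

lemma approachable_translate:
  assumes S: "approachable k w S" "S \<subseteq> carrier_vec k" and t: "t \<in> carrier_vec k" and w: "w \<in> carrier_vec k"
  shows "approachable k w (translate S t)"
  unfolding approachable_def
proof (intro ballI allI impI)
  fix x \<delta> assume "x \<in> translate S t" "(0 :: real) < \<delta>"
  then obtain y where y: "y \<in> S" "x = y + t" by (auto simp: translate_def)
  with S \<open>0 < \<delta>\<close> obtain x' where x': "x' \<in> carrier_vec k"
    "\<forall>\<^sub>F \<epsilon> in at_right 0. x' + \<epsilon> \<cdot>\<^sub>v w \<in> S \<and> vec_dist k y (x' + \<epsilon> \<cdot>\<^sub>v w) < \<delta>"
    unfolding approachable_def by blast
  have e: "(x' + t) + \<epsilon> \<cdot>\<^sub>v w = (x' + \<epsilon> \<cdot>\<^sub>v w) + t" for \<epsilon>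
    using x' t w by (intro eq_vecI) auto
  have d: "vec_dist k x ((x' + t) + \<epsilon> \<cdot>\<^sub>v w) = vec_dist k y (x' + \<epsilon> \<cdot>\<^sub>v w)" for \<epsilon>
    unfolding e y(2) vec_dist_def using x' t w y S by (intro L2_set_cong) auto
  show "\<exists>x'\<in>carrier_vec k. \<forall>\<^sub>F \<epsilon> in at_right 0. x' + \<epsilon> \<cdot>\<^sub>v w \<in> translate S t \<and> vec_dist k x (x' + \<epsilon> \<cdot>\<^sub>v w) < \<delta>"
    using x'(1) t x'(2)
    by (intro bexI[of _ "x' + t"]) (auto elim!: eventually_mono simp: d, auto simp: e translate_def)
qed

lemma approachable_cols_parallelepiped:
  assumes A: "A \<in> carrier_mat k n" and B: "B \<subseteq> {..<n}" and s: "s \<in> carrier_vec n"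
  shows "approachable k (A *\<^sub>v restrict_vec B s) (cols_parallelepiped A B)"
  unfolding approachable_def
proof (intro ballI allI impI)
  fix x and \<delta> :: real assume x: "x \<in> cols_parallelepiped A B" and \<delta>: "0 < \<delta>"
  define w where "w = A *\<^sub>v restrict_vec B s"
  obtain c where c: "c \<in> carrier_vec n" "\<forall>j<n. 0 \<le> c $ j \<and> c $ j \<le> 1" and xc: "x = A *\<^sub>v restrict_vec B c"
    using x cols_parallelepiped_iff[OF A B] by blast
  \<comment> \<open>The direction from \<open>c\<close> to the centre of the cube:
    \<open>c + \<tau> \<cdot>\<^sub>v h\<close> has all coordinates strictly between 0 and 1 for
    \<open>0 < \<tau> \<le> 1\<close>.\<close>
  define h where "h = vec n (\<lambda>j. 1 / 2 - c $ j)"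
  have h: "h \<in> carrier_vec n" by (simp add: h_def)
  define u where "u = A *\<^sub>v restrict_vec B h"
  have u: "u \<in> carrier_vec k" and w: "w \<in> carrier_vec k" 
    unfolding u_def w_def using h s by (auto intro!: mult_mat_vec_carrier[OF A])
  have xk: "x \<in> carrier_vec k" using x cols_parallelepiped_subset[OF A B] by blast
  define U where "U = (\<Sum>i<k. \<bar>u $ i\<bar>)"
  define W where "W = (\<Sum>i<k. \<bar>w $ i\<bar>)"
  have U: "0 \<le> U" by (simp add: U_def)
  \<comment> \<open>The move towards the centre uses up less than \<open>\<delta> / 2\<close> of the
    distance; the other half is kept for the shift by
    \<open>\<epsilon> \<cdot>\<^sub>v w\<close>.\<close>
  define \<tau> where "\<tau> = min 1 (\<delta> / (2 * (U + 1)))"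
  have \<tau>: "0 < \<tau>" "\<tau> \<le> 1" using U \<delta> by (auto simp: \<tau>_def)
  have "\<tau> * U \<le> \<delta> / (2 * (U + 1)) * U" using U by (intro mult_right_mono) (auto simp: \<tau>_def)
  also have "\<dots> < \<delta> / 2" using U \<delta> by (simp add: field_simps)
  finally have \<tau>U: "\<tau> * U < \<delta> / 2" .
  define x' where "x' = x + \<tau> \<cdot>\<^sub>v u"
  have x': "x' \<in> carrier_vec k" using xk u by (simp add: x'_def)
  have e1: "x' + \<epsilon> \<cdot>\<^sub>v w = A *\<^sub>v restrict_vec B (c + \<tau> \<cdot>\<^sub>v h + \<epsilon> \<cdot>\<^sub>v s)" for \<epsilon>
  proof -
    have "restrict_vec B (c + \<tau> \<cdot>\<^sub>v h + \<epsilon> \<cdot>\<^sub>v s)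
        = restrict_vec B c + \<tau> \<cdot>\<^sub>v restrict_vec B h + \<epsilon> \<cdot>\<^sub>v restrict_vec B s"
      using c h s by (simp add: restrict_vec_add[of _ n] restrict_vec_smult)
    then show ?thesis
      using A c h s by (simp add: x'_def xc u_def w_def mult_add_distrib_mat_vec[OF A] mult_mat_vec[OF A])
        (intro eq_vecI, auto)
  qed
  have "\<forall>\<^sub>F \<epsilon> in at_right 0. \<forall>j\<in>{..<n}. 0 < (c + \<tau> \<cdot>\<^sub>v h) $ j + \<epsilon> * s $ j \<and> (c + \<tau> \<cdot>\<^sub>v h) $ j + \<epsilon> * s $ j < 1"
  proof (intro eventually_ball_finite ballI)
    fix j assume "j \<in> {..<n}"
    then have j: "j < n" by simp
    define g where "g = (c + \<tau> \<cdot>\<^sub>v h) $ j"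
    have g: "g = (1 - \<tau>) * c $ j + \<tau> / 2" using c h j by (simp add: g_def h_def field_simps)
    have c01: "0 \<le> c $ j" "c $ j \<le> 1" using c j by auto
    have "0 \<le> (1 - \<tau>) * c $ j" using c01 \<tau> by (intro mult_nonneg_nonneg) auto
    moreover have "(1 - \<tau>) * c $ j \<le> (1 - \<tau>) * 1" using c01 \<tau> by (intro mult_left_mono) auto
    ultimately have "0 < g" "g < 1" using \<tau> by (auto simp: g)
    then show "\<forall>\<^sub>F \<epsilon> in at_right 0. 0 < g + \<epsilon> * s $ j \<and> g + \<epsilon> * s $ j < 1"
      by (intro eventually_conj order_tendstoD[OF tendsto_line])
  qed simp
  then have ev1: "\<forall>\<^sub>F \<epsilon> in at_right 0. x' + \<epsilon> \<cdot>\<^sub>v w \<in> cols_parallelepiped A B"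
  proof (rule eventually_mono)
    fix \<epsilon> assume *: "\<forall>j\<in>{..<n}. 0 < (c + \<tau> \<cdot>\<^sub>v h) $ j + \<epsilon> * s $ j \<and> (c + \<tau> \<cdot>\<^sub>v h) $ j + \<epsilon> * s $ j < 1"
    have "0 \<le> (c + \<tau> \<cdot>\<^sub>v h + \<epsilon> \<cdot>\<^sub>v s) $ j \<and> (c + \<tau> \<cdot>\<^sub>v h + \<epsilon> \<cdot>\<^sub>v s) $ j \<le> 1" if "j < n" for j
      using *[rule_format, of j] that c h s by simp
    moreover have "c + \<tau> \<cdot>\<^sub>v h + \<epsilon> \<cdot>\<^sub>v s \<in> carrier_vec n" using c h s by simp
    ultimately show "x' + \<epsilon> \<cdot>\<^sub>v w \<in> cols_parallelepiped A B"
      unfolding e1 cols_parallelepiped_iff[OF A B] by blast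
  qed
  have "((\<lambda>\<epsilon>. 0 + \<epsilon> * W) \<longlongrightarrow> 0) (at_right 0)" by (rule tendsto_line)
  then have "\<forall>\<^sub>F \<epsilon> in at_right 0. 0 + \<epsilon> * W < \<delta> / 2" by (rule order_tendstoD) (use \<delta> in simp)
  then have "\<forall>\<^sub>F \<epsilon> in at_right 0. vec_dist k x (x' + \<epsilon> \<cdot>\<^sub>v w) < \<delta>"
    using eventually_at_right_less[of "0 :: real"]
  proof eventually_elim
    case (elim \<epsilon>)
    have "vec_dist k x (x' + \<epsilon> \<cdot>\<^sub>v w) \<le> (\<Sum>i<k. \<bar>x $ i - (x' + \<epsilon> \<cdot>\<^sub>v w) $ i\<bar>)"
      unfolding vec_dist_def by (rule L2_set_le_sum_abs)
    also have "\<dots> = (\<Sum>i<k. \<bar>\<tau> * u $ i + \<epsilon> * w $ i\<bar>)"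
      using xk u w by (intro sum.cong) (auto simp: x'_def)
    also have "\<dots> \<le> (\<Sum>i<k. \<tau> * \<bar>u $ i\<bar> + \<epsilon> * \<bar>w $ i\<bar>)"
      using \<tau> elim by (intro sum_mono order.trans[OF abs_triangle_ineq]) (auto simp: abs_mult)
    also have "\<dots> = \<tau> * U + \<epsilon> * W"
      by (simp add: sum.distrib sum_distrib_left U_def W_def)
    finally show ?case using elim \<tau>U by simp
  qed
  with ev1 have "\<forall>\<^sub>F \<epsilon> in at_right 0. x' + \<epsilon> \<cdot>\<^sub>v w \<in> cols_parallelepiped A B \<and> vec_dist k x (x' + \<epsilon> \<cdot>\<^sub>v w) < \<delta>"
    by (rule eventually_conj)
  with x' show "\<exists>x'\<in>carrier_vec k. \<forall>\<^sub>F \<epsilon> in at_right 0. x' + \<epsilon> \<cdot>\<^sub>v (A *\<^sub>v restrict_vec B s) \<in> cols_parallelepiped A B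
      \<and> vec_dist k x (x' + \<epsilon> \<cdot>\<^sub>v (A *\<^sub>v restrict_vec B s)) < \<delta>"
    unfolding w_def by blast
qed

text \<open>If a ball around \<open>x\<close> were contained in \<open>S\<close>, the points
  \<open>x' + \<epsilon> \<cdot>\<^sub>v w\<close> of \<open>T\<close> that approximate
  \<open>x\<close> within its radius would lie in both sets for all small
  \<open>\<epsilon>\<close>.\<close>

lemma interior_disjoint_approachable:
  assumes S: "S \<subseteq> carrier_vec k" and T: "approachable k w T"
    and disj: "\<And>x'. x' \<in> carrier_vec k \<Longrightarrow> \<forall>\<^sub>F \<epsilon> in at_right 0. x' + \<epsilon> \<cdot>\<^sub>v w \<in> S \<Longrightarrow>
      \<forall>\<^sub>F \<epsilon> in at_right 0. x' + \<epsilon> \<cdot>\<^sub>v w \<in> T \<Longrightarrow> False"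
    and x: "x \<in> T" and w: "w \<in> carrier_vec k"
  shows "x \<notin> euclidean_vec_top k interior_of S"
proof
  interpret M: Metric_space "carrier_vec k" "vec_dist k" by (rule Metric_space_carrier_vec)
  assume "x \<in> euclidean_vec_top k interior_of S"
  then obtain V where V: "openin M.mtopology V" "x \<in> V" "V \<subseteq> S"
    by (auto simp: interior_of_def euclidean_vec_top_def)
  then obtain \<delta> where \<delta>: "\<delta> > 0" "M.mball x \<delta> \<subseteq> S" by (auto simp: M.openin_mtopology)
  have xk: "x \<in> carrier_vec k" using V S by auto
  obtain x' where x': "x' \<in> carrier_vec k"
    "\<forall>\<^sub>F \<epsilon> in at_right 0. x' + \<epsilon> \<cdot>\<^sub>v w \<in> T \<and> vec_dist k x (x' + \<epsilon> \<cdot>\<^sub>v w) < \<delta>"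
    using T x \<delta>(1) unfolding approachable_def by blast
  have "\<forall>\<^sub>F \<epsilon> in at_right 0. x' + \<epsilon> \<cdot>\<^sub>v w \<in> S" "\<forall>\<^sub>F \<epsilon> in at_right 0. x' + \<epsilon> \<cdot>\<^sub>v w \<in> T"
    using x'(2) by (eventually_elim, use \<delta>(2) xk x'(1) w in \<open>auto simp: M.in_mball\<close>)+
  with disj x'(1) show False by blast
qed

text \<open>A common point lies in both closures trivially, so only the two interiors have to be
  excluded. What remains to be proved for tiles is that no point enters two of them in direction
  \<open>w\<close>.\<close>

lemma meet_only_at_boundaryI:
  assumes S: "S \<subseteq> carrier_vec k" "approachable k w S" and T: "T \<subseteq> carrier_vec k" "approachable k w T"
    and disj: "\<And>x'. x' \<in> carrier_vec k \<Longrightarrow> \<forall>\<^sub>F \<epsilon> in at_right 0. x' + \<epsilon> \<cdot>\<^sub>v w \<in> S \<Longrightarrow>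
      \<forall>\<^sub>F \<epsilon> in at_right 0. x' + \<epsilon> \<cdot>\<^sub>v w \<in> T \<Longrightarrow> False"
    and w: "w \<in> carrier_vec k"
  shows "meet_only_at_boundary k S T"
proof -
  interpret M: Metric_space "carrier_vec k" "vec_dist k" by (rule Metric_space_carrier_vec)
  have "topspace (euclidean_vec_top k) = carrier_vec k" by (simp add: euclidean_vec_top_def)
  then have "S \<subseteq> euclidean_vec_top k closure_of S" "T \<subseteq> euclidean_vec_top k closure_of T"
    using S T by (simp_all add: closure_of_subset)
  moreover have "x \<notin> euclidean_vec_top k interior_of S" if "x \<in> T" for x
    using interior_disjoint_approachable[OF S(1) T(2) _ that w] disj by blast
  moreover have "x \<notin> euclidean_vec_top k interior_of T" if "x \<in> S" for x
    using interior_disjoint_approachable[OF T(1) S(2) _ that w] disj by blast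
  ultimately show ?thesis
    unfolding meet_only_at_boundary_def frontier_of_def by blast
qed

section \<open>The tiling of \<open>\<real>\<^sup>n\<close>\<close>

lemma split_rows_mult_vec:
  fixes D E :: "'a :: comm_ring_1 mat"
  assumes D: "D \<in> carrier_mat r n" and E: "E \<in> carrier_mat m n" and c: "c \<in> carrier_vec n"
  shows "split_rows r (D @\<^sub>r E) B *\<^sub>v c = (D *\<^sub>v restrict_vec B c) @\<^sub>v (E *\<^sub>v restrict_vec (- B) c)"
proof (rule eq_vecI)
  fix i assume "i < dim_vec ((D *\<^sub>v restrict_vec B c) @\<^sub>v (E *\<^sub>v restrict_vec (- B) c))"
  then have i: "i < r + m" using D E by simp
  have "split_rows r (D @\<^sub>r E) B $$ (i, j) * c $ j
      = (if i < r then D $$ (i, j) * restrict_vec B c $ j else E $$ (i - r, j) * restrict_vec (- B) c $ j)"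
    if "j < n" for j
    using i that D E c by (auto simp: split_rows_def append_rows_def)
  then show "(split_rows r (D @\<^sub>r E) B *\<^sub>v c) $ i
      = ((D *\<^sub>v restrict_vec B c) @\<^sub>v (E *\<^sub>v restrict_vec (- B) c)) $ i"
    using i D E c by (auto simp: scalar_prod_def split_rows_def append_rows_def intro!: sum.cong)
qed (use D E in \<open>simp add: split_rows_def append_rows_def\<close>)

text \<open>Negating the last \<open>m\<close> rows multiplies every Leibniz term by the same sign;
  the rest is the triangle inequality in the Laplace expansion.\<close>

lemma det_append_rows_uminus_le:
  fixes D E :: "int mat"
  assumes D: "D \<in> carrier_mat r n" and E: "E \<in> carrier_mat m n" and n: "n = r + m"
  shows "\<bar>det (D @\<^sub>r (- E))\<bar> \<le> (\<Sum>B\<in>Pow {..<n}. \<bar>det (split_rows r (D @\<^sub>r E) B)\<bar>)"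
proof -
  have DE: "D @\<^sub>r E \<in> carrier_mat n n" "D @\<^sub>r (- E) \<in> carrier_mat n n"
    using carrier_append_rows[OF D E] carrier_append_rows[OF D, of "- E" m] E n by auto
  define \<sigma> :: "nat \<Rightarrow> int" where "\<sigma> i = (if i < r then 1 else - 1)" for i
  have "det (D @\<^sub>r (- E)) = (\<Sum>p | p permutes {0..<n}. (\<Prod>i = 0..<n. \<sigma> i) * (signof p * (\<Prod>i = 0..<n. (D @\<^sub>r E) $$ (i, p i))))"
    unfolding det_def'[OF DE(2)]
  proof (rule sum.cong[OF refl])
    fix p assume "p \<in> {p. p permutes {0..<n}}"
    then have p: "p i < n" if "i < n" for i using that by (simp add: permutes_less)
    have "(\<Prod>i = 0..<n. (D @\<^sub>r (- E)) $$ (i, p i)) = (\<Prod>i = 0..<n. \<sigma> i * (D @\<^sub>r E) $$ (i, p i))"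
    proof (rule prod.cong[OF refl])
      fix i assume "i \<in> {0..<n}"
      then have i: "i < n" by simp
      then have "i < r + m" using n by simp
      with i p[OF i] D E show "(D @\<^sub>r (- E)) $$ (i, p i) = \<sigma> i * (D @\<^sub>r E) $$ (i, p i)"
        by (auto simp: \<sigma>_def append_rows_def)
    qed
    then show "signof p * (\<Prod>i = 0..<n. (D @\<^sub>r (- E)) $$ (i, p i))
        = (\<Prod>i = 0..<n. \<sigma> i) * (signof p * (\<Prod>i = 0..<n. (D @\<^sub>r E) $$ (i, p i)))"
      by (simp add: prod.distrib)
  qed
  also have "\<dots> = (\<Prod>i = 0..<n. \<sigma> i) * det (D @\<^sub>r E)"
    unfolding det_def'[OF DE(1)] by (simp add: sum_distrib_left)
  finally have "\<bar>det (D @\<^sub>r (- E))\<bar> = \<bar>\<Prod>i = 0..<n. \<sigma> i\<bar> * \<bar>det (D @\<^sub>r E)\<bar>"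
    by (simp add: abs_mult)
  also have "\<bar>\<Prod>i = 0..<n. \<sigma> i\<bar> = (1 :: int)" by (auto simp: abs_prod \<sigma>_def intro: prod.neutral)
  also have "det (D @\<^sub>r E) = (\<Sum>B\<in>Pow {..<n}. det (split_rows r (D @\<^sub>r E) B))"
    by (rule det_eq_sum_split_rows[OF DE(1)]) (use n in simp)
  finally show ?thesis using sum_abs[of "\<lambda>B. det (split_rows r (D @\<^sub>r E) B)" "Pow {..<n}"] by simp
qed

lemma zero_vec_append: "0\<^sub>v (k + l) = 0\<^sub>v k @\<^sub>v 0\<^sub>v l"
  by (intro eq_vecI) auto

lemma real_mat_mult_real_vec:
  "A \<in> carrier_mat k n \<Longrightarrow> v \<in> carrier_vec n \<Longrightarrow> real_mat A *\<^sub>v real_vec v = real_vec (A *\<^sub>v v)"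
  by (rule of_int_hom.mult_mat_vec_hom[symmetric])

text \<open>
  \<open>D\<close> and \<open>E\<close> stand for the two matrices \<open>(I M)\<close> and \<open>(-M\<^sup>T I)\<close>; \<open>K\<close> and \<open>J\<close> are right inverses
  of \<open>D\<close> and \<open>E\<close> for which \<open>M = D J\<close> and \<open>-M\<^sup>T = E K\<close>.  The axioms are symmetric
  under exchanging \<open>(r, D, K)\<close> with \<open>(m, E, J)\<close>, so each result about \<open>T'\<close> has its dual about \<open>T''\<close>.
\<close>

locale dual_pair =
  fixes r m n :: nat and D E K J :: "int mat"
  assumes D: "D \<in> carrier_mat r n" and E: "E \<in> carrier_mat m n"
    and K: "K \<in> carrier_mat n r" and J: "J \<in> carrier_mat n m"
    and n: "n = r + m"
    and DK: "D * K = 1\<^sub>m r" and EJ: "E * J = 1\<^sub>m m"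
    and ED: "E * transpose_mat D = 0\<^sub>m m r"
    and decomp: "K * D + transpose_mat E * transpose_mat J = 1\<^sub>m n"
begin

lemma dual: "dual_pair m r n E D J K"
proof
  have "transpose_mat (E * transpose_mat D) = D * transpose_mat E"
    using D E by (subst transpose_mult[of _ m n]) auto
  then show "D * transpose_mat E = 0\<^sub>m r m" using ED by simp
  have "transpose_mat (K * D + transpose_mat E * transpose_mat J) = transpose_mat D * transpose_mat K + J * E"
    using D E K J by (subst transpose_add[of _ n n]) (auto simp: transpose_mult[of _ n r] transpose_mult[of _ n m])
  then show "J * E + transpose_mat D * transpose_mat K = 1\<^sub>m n"
    using decomp D E K J by (subst comm_add_mat[of _ n n]) auto
qed (use D E K J n DK EJ in auto)

lemma DE: "D * transpose_mat E = 0\<^sub>m r m"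
  using dual by (rule dual_pair.ED)

lemma decomp': "J * E + transpose_mat D * transpose_mat K = 1\<^sub>m n"
  using dual by (rule dual_pair.decomp)

text \<open>Multiplying \<open>decomp\<close> by \<open>J\<^sup>T\<close> from the left and using
  \<open>E J = 1\<close> leaves \<open>J\<^sup>T K D = 0\<close>; the factor \<open>D\<close> is
  removed by its right inverse \<open>K\<close>.\<close>

lemma JK: "transpose_mat J * K = 0\<^sub>m m r"
proof -
  have "transpose_mat J = transpose_mat J * (K * D + transpose_mat E * transpose_mat J)"
    unfolding decomp using J by simp
  also have "\<dots> = transpose_mat J * (K * D) + transpose_mat J * (transpose_mat E * transpose_mat J)"
    using J K D E by (intro mult_add_distrib_mat[of _ m n]) auto
  also have "transpose_mat J * (transpose_mat E * transpose_mat J) = (transpose_mat J * transpose_mat E) * transpose_mat J"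
    using J E by (intro assoc_mult_mat[symmetric, of _ m n _ m _ n]) auto
  also have "transpose_mat J * transpose_mat E = transpose_mat (E * J)"
    using J E by (intro transpose_mult[symmetric, of _ m n]) auto
  also have "\<dots> * transpose_mat J = transpose_mat J" using EJ J by simp
  finally have *: "transpose_mat J = transpose_mat J * (K * D) + transpose_mat J" .
  have z: "transpose_mat J * (K * D) = 0\<^sub>m m n"
  proof (rule eq_matI)
    fix i j assume ij: "i < dim_row (0\<^sub>m m n :: int mat)" "j < dim_col (0\<^sub>m m n :: int mat)"
    have "transpose_mat J $$ (i, j) = (transpose_mat J * (K * D) + transpose_mat J) $$ (i, j)"
      using * by simp
    then show "(transpose_mat J * (K * D)) $$ (i, j) = 0\<^sub>m m n $$ (i, j)"
      using ij J K D by simp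
  qed (use J D in auto)
  have "transpose_mat J * K = transpose_mat J * K * (D * K)" unfolding DK using J K by simp
  also have "\<dots> = transpose_mat J * (K * (D * K))"
    using J K D by (intro assoc_mult_mat[of _ m n _ r _ r]) auto
  also have "K * (D * K) = K * D * K"
    using K D by (intro assoc_mult_mat[symmetric, of _ n r _ n _ r]) auto
  also have "transpose_mat J * (K * D * K) = transpose_mat J * (K * D) * K"
    using J K D by (intro assoc_mult_mat[symmetric, of _ m n _ n _ r]) auto
  also have "\<dots> = 0\<^sub>m m r" unfolding z using K by simp
  finally show ?thesis .
qed

text \<open>The blocks of the product are \<open>D K\<close>, \<open>D E\<^sup>T\<close>,
  \<open>J\<^sup>T K\<close> and \<open>(E J)\<^sup>T\<close>. This is the completion to inverse
  integer matrices that the comparison of complementary minors asks for.\<close>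

lemma unimodular: "(D @\<^sub>r transpose_mat J) * transpose_mat (transpose_mat K @\<^sub>r E) = 1\<^sub>m n"
proof -
  have e: "transpose_mat (transpose_mat K @\<^sub>r E) = four_block_mat K (transpose_mat E) (0\<^sub>m 0 r) (0\<^sub>m 0 m)"
    using K E unfolding append_rows_def by (subst transpose_four_block_mat[of _ r n _ 0 _ m]) auto
  have "(D @\<^sub>r transpose_mat J) * transpose_mat (transpose_mat K @\<^sub>r E)
      = four_block_mat D (0\<^sub>m r 0) (transpose_mat J) (0\<^sub>m m 0) * four_block_mat K (transpose_mat E) (0\<^sub>m 0 r) (0\<^sub>m 0 m)"
    unfolding e using D J by (simp add: append_rows_def)
  also have "\<dots> = four_block_mat (D * K + 0\<^sub>m r 0 * 0\<^sub>m 0 r) (D * transpose_mat E + 0\<^sub>m r 0 * 0\<^sub>m 0 m)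
      (transpose_mat J * K + 0\<^sub>m m 0 * 0\<^sub>m 0 r) (transpose_mat J * transpose_mat E + 0\<^sub>m m 0 * 0\<^sub>m 0 m)"
    by (rule mult_four_block_mat) (use D E J K in auto)
  also have "transpose_mat J * transpose_mat E = transpose_mat (E * J)"
    using J E by (intro transpose_mult[symmetric, of _ m n]) auto
  finally show ?thesis by (simp add: DK DE JK EJ n)
qed

definition Q :: "nat set \<Rightarrow> int mat" where
  "Q B = split_rows r (D @\<^sub>r E) B"

definition N :: "int mat" where
  "N = D @\<^sub>r (- E)"

lemma DE_carrier: "D @\<^sub>r E \<in> carrier_mat n n"
  using carrier_append_rows[OF D E] n by simp

lemma Q_carrier [simp]: "Q B \<in> carrier_mat n n"
  unfolding Q_def using DE_carrier by simp

lemma N_carrier [simp]: "N \<in> carrier_mat n n"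
  unfolding N_def using carrier_append_rows[OF D, of "- E" m] E n by simp

lemma Q_mult: "c \<in> carrier_vec n \<Longrightarrow>
    Q B *\<^sub>v c = (D *\<^sub>v restrict_vec B c) @\<^sub>v (E *\<^sub>v restrict_vec (- B) c)"
  unfolding Q_def by (rule split_rows_mult_vec[OF D E])

lemma N_mult: "c \<in> carrier_vec n \<Longrightarrow> N *\<^sub>v c = (D *\<^sub>v c) @\<^sub>v (- (E *\<^sub>v c))"
  unfolding N_def using E mat_mult_append[OF D, of "- E" m c] by simp

lemma basesD:
  assumes "B \<in> bases D"
  shows "B \<subseteq> {..<n}" "card B = r" "det (submatrix D UNIV B) \<noteq> 0"
  using assms D by (auto simp: bases_def)

lemma finite_bases: "finite (bases D)"
  by (rule finite_subset[of _ "Pow {..<n}"]) (use basesD(1) in auto)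

lemma abs_det_complement:
  assumes "B \<subseteq> {..<n}" "card B = r"
  shows "\<bar>det (submatrix D UNIV B)\<bar> = \<bar>det (submatrix E UNIV ({..<n} - B))\<bar>"
  using J K by (intro abs_det_complementary_cols[OF D _ _ E n unimodular assms]) auto

lemma abs_det_Q_eq:
  assumes "B \<subseteq> {..<n}" "card B = r"
  shows "\<bar>det (Q B)\<bar> = \<bar>det (submatrix D UNIV B)\<bar>\<^sup>2"
  unfolding Q_def abs_det_split_rows[OF D E n assms] abs_det_complement[OF assms, symmetric]
  by (simp only: power2_eq_square)

lemma abs_det_Q:
  assumes "B \<in> bases D"
  shows "\<bar>det (Q B)\<bar> = (int (multiplicity_of D B))\<^sup>2"
  using abs_det_Q_eq[OF basesD(1,2)[OF assms]] by (simp add: multiplicity_of_def)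

text \<open>A nonzero determinant forces \<open>card B = r\<close>, since otherwise no Leibniz term
  survives. Hence the Laplace expansion over all subsets is a sum over bases.\<close>

lemma bases_iff: "B \<in> bases D \<longleftrightarrow> B \<subseteq> {..<n} \<and> det (Q B) \<noteq> 0"
proof
  assume B: "B \<in> bases D"
  then show "B \<subseteq> {..<n} \<and> det (Q B) \<noteq> 0"
    using abs_det_Q_eq[of B] basesD[OF B] by auto
next
  assume B: "B \<subseteq> {..<n} \<and> det (Q B) \<noteq> 0"
  then have c: "card B = r"
    using det_split_rows_nonzero_card[OF DE_carrier, of r B] n by (simp add: Q_def)
  with B abs_det_Q_eq[of B] show "B \<in> bases D" using D by (auto simp: bases_def)
qed

lemma bases_complement:
  assumes "B \<in> bases D"
  shows "{..<n} - B \<in> bases E" "multiplicity_of E ({..<n} - B) = multiplicity_of D B"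
proof -
  note B = basesD[OF assms]
  have "card ({..<n} - B) = m" using B n by (simp add: card_Diff_subset finite_subset)
  then show "{..<n} - B \<in> bases E" using abs_det_complement[OF B(1,2)] B E by (auto simp: bases_def)
  show "multiplicity_of E ({..<n} - B) = multiplicity_of D B"
    using abs_det_complement[OF B(1,2)] by (simp add: multiplicity_of_def)
qed

section \<open>Kernels, disjointness of open cells and coordinates\<close>

abbreviation "Dr \<equiv> real_mat D"
abbreviation "Er \<equiv> real_mat E"

lemma Dr: "Dr \<in> carrier_mat r n" and Er: "Er \<in> carrier_mat m n"
  using D E by auto

lemma Dr_carrier [simp]: "c \<in> carrier_vec n \<Longrightarrow> Dr *\<^sub>v c \<in> carrier_vec r"
  and Er_carrier [simp]: "c \<in> carrier_vec n \<Longrightarrow> Er *\<^sub>v c \<in> carrier_vec m"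
  using Dr Er by auto

lemma D_carrier [simp]: "c \<in> carrier_vec n \<Longrightarrow> D *\<^sub>v c \<in> carrier_vec r"
  and E_carrier [simp]: "c \<in> carrier_vec n \<Longrightarrow> E *\<^sub>v c \<in> carrier_vec m"
  using D E by auto

text \<open>Applied to \<open>b\<close> in the kernel of \<open>E\<close>, the decomposition of the
  identity gives \<open>b = D\<^sup>T (K\<^sup>T b)\<close>, a vector of the row space of
  \<open>D\<close>, which is orthogonal to the kernel of \<open>D\<close>.\<close>

lemma kernels_orthogonal:
  assumes a: "a \<in> carrier_vec n" "Dr *\<^sub>v a = 0\<^sub>v r" and b: "b \<in> carrier_vec n" "Er *\<^sub>v b = 0\<^sub>v m"
  shows "a \<bullet> b = 0"
proof -
  let ?Kr = "real_mat K" and ?Jr = "real_mat J"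
  have KJ: "?Kr \<in> carrier_mat n r" "?Jr \<in> carrier_mat n m" using K J by auto
  have "real_mat (J * E + transpose_mat D * transpose_mat K)
      = ?Jr * Er + transpose_mat Dr * transpose_mat ?Kr"
  proof -
    have "real_mat (J * E) = ?Jr * Er" by (rule of_int_hom.mat_hom_mult[OF J E])
    moreover have "real_mat (transpose_mat D * transpose_mat K) = transpose_mat Dr * transpose_mat ?Kr"
      using D K by (subst of_int_hom.mat_hom_mult[of _ n r _ n]) (auto simp: map_mat_transpose)
    ultimately show ?thesis using D E K J by (intro eq_matI) (auto simp: scalar_prod_def)
  qed
  then have "1\<^sub>m n = ?Jr * Er + transpose_mat Dr * transpose_mat ?Kr"
    using decomp' by (simp add: of_int_hom.mat_hom_one)
  then have "b = (?Jr * Er + transpose_mat Dr * transpose_mat ?Kr) *\<^sub>v b"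
    using b(1) by (metis one_mult_mat_vec)
  also have "\<dots> = ?Jr *\<^sub>v (Er *\<^sub>v b) + transpose_mat Dr *\<^sub>v (transpose_mat ?Kr *\<^sub>v b)"
    using Dr Er KJ b(1)
    by (simp add: add_mult_distrib_mat_vec[of _ n n] assoc_mult_mat_vec[of _ n m] assoc_mult_mat_vec[of _ n r])
  also have "\<dots> = transpose_mat Dr *\<^sub>v (transpose_mat ?Kr *\<^sub>v b)"
    using Dr KJ b by (auto intro!: eq_vecI)
  finally have "a \<bullet> b = (transpose_mat Dr *\<^sub>v (transpose_mat ?Kr *\<^sub>v b)) \<bullet> a"
    using a(1) b(1) by (metis comm_scalar_prod)
  also have "\<dots> = (transpose_mat ?Kr *\<^sub>v b) \<bullet> (Dr *\<^sub>v a)"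
    by (rule transpose_vec_mult_scalar[OF Dr a(1)]) (use KJ b in auto)
  also have "\<dots> = 0" unfolding a(2) using KJ b by simp
  finally show ?thesis .
qed

text \<open>A vector annihilated by \<open>N\<close> lies in both kernels, so it is orthogonal to
  itself.\<close>

lemma det_N_nonzero: "det N \<noteq> 0"
proof
  assume "det N = 0"
  then obtain v where v: "v \<in> carrier_vec n" "v \<noteq> 0\<^sub>v n" "N *\<^sub>v v = 0\<^sub>v n"
    using det_0_iff_vec_prod_zero[OF N_carrier] by blast
  have z: "(D *\<^sub>v v) @\<^sub>v (- (E *\<^sub>v v)) = 0\<^sub>v r @\<^sub>v 0\<^sub>v m"
    using v by (simp add: N_mult zero_vec_append n)
  then have "D *\<^sub>v v = 0\<^sub>v r" "- (E *\<^sub>v v) = 0\<^sub>v m"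
    using append_vec_eq[of "D *\<^sub>v v" r "0\<^sub>v r" "- (E *\<^sub>v v)" "0\<^sub>v m"] v by auto
  then have "D *\<^sub>v v = 0\<^sub>v r" "E *\<^sub>v v = 0\<^sub>v m"
    by (auto simp: vec_eq_iff)
  then have "Dr *\<^sub>v real_vec v = 0\<^sub>v r" "Er *\<^sub>v real_vec v = 0\<^sub>v m"
    using v by (simp_all add: real_mat_mult_real_vec[OF D] real_mat_mult_real_vec[OF E] of_int_hom.vec_hom_zero)
  then have "real_vec v \<bullet> real_vec v = 0"
    using v by (intro kernels_orthogonal) auto
  then have "(\<Sum>i = 0..<n. real_of_int (v $ i) * real_of_int (v $ i)) = 0"
    using v by (simp add: scalar_prod_def)
  then have "v $ i = 0" if "i < n" for i
    using that by (subst (asm) sum_nonneg_eq_0_iff) auto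
  then have "v = 0\<^sub>v n" using v by (intro eq_vecI) auto
  with v show False by simp
qed

lemma open_cells_disjoint:
  assumes B: "B \<subseteq> {..<n}" and C: "C \<subseteq> {..<n}"
    and c: "c \<in> carrier_vec n" "\<forall>i<n. 0 < c $ i \<and> c $ i < 1"
    and d: "d \<in> carrier_vec n" "\<forall>i<n. 0 < d $ i \<and> d $ i < 1"
    and k: "k \<in> carrier_vec n"
    and eD: "Dr *\<^sub>v restrict_vec B c = Dr *\<^sub>v restrict_vec C d + Dr *\<^sub>v real_vec k"
    and eE: "Er *\<^sub>v restrict_vec (- B) c = Er *\<^sub>v restrict_vec (- C) d - Er *\<^sub>v real_vec k"
  shows "B = C \<and> k = 0\<^sub>v n"
proof -
  define a where "a = restrict_vec B c - restrict_vec C d - real_vec k"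
  define b where "b = restrict_vec (- B) c - restrict_vec (- C) d + real_vec k"
  have ab: "a \<in> carrier_vec n" "b \<in> carrier_vec n" using c d k by (simp_all add: a_def b_def)
  have cancel: "u + v - u - v = 0\<^sub>v l" "u - v - u + v = 0\<^sub>v l"
    if "u \<in> carrier_vec l" "v \<in> carrier_vec l" for u v :: "real vec" and l
    using that by (auto intro!: eq_vecI)
  have "Dr *\<^sub>v a = Dr *\<^sub>v restrict_vec B c - Dr *\<^sub>v restrict_vec C d - Dr *\<^sub>v real_vec k"
    unfolding a_def using c d k by (simp add: mult_minus_distrib_mat_vec[OF Dr])
  also have "\<dots> = 0\<^sub>v r" unfolding eD by (rule cancel) (use d k in simp_all)
  finally have a0: "Dr *\<^sub>v a = 0\<^sub>v r" .
  have "Er *\<^sub>v b = Er *\<^sub>v restrict_vec (- B) c - Er *\<^sub>v restrict_vec (- C) d + Er *\<^sub>v real_vec k"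
    unfolding b_def using c d k by (simp add: mult_minus_distrib_mat_vec[OF Er] mult_add_distrib_mat_vec[OF Er])
  also have "\<dots> = 0\<^sub>v m" unfolding eE by (rule cancel) (use d k in simp_all)
  finally have b0: "Er *\<^sub>v b = 0\<^sub>v m" .
  have "0 = a \<bullet> b" using kernels_orthogonal[OF ab(1) a0 ab(2) b0] by simp
  also have "\<dots> = (\<Sum>i = 0..<n. a $ i * b $ i)" using ab by (simp add: scalar_prod_def)
  finally have s: "(\<Sum>i = 0..<n. - (a $ i * b $ i)) = 0" by (simp add: sum_negf)
  define \<alpha> \<beta> \<alpha>' \<beta>' where "\<alpha> i = restrict_vec B c $ i" and "\<beta> i = restrict_vec (- B) c $ i"
    and "\<alpha>' i = restrict_vec C d $ i" and "\<beta>' i = restrict_vec (- C) d $ i" for i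
  have ai: "a $ i = \<alpha> i - \<alpha>' i - k $ i" and bi: "b $ i = \<beta> i - \<beta>' i + k $ i" if "i < n" for i
    using that c d k by (simp_all add: a_def b_def \<alpha>_def \<beta>_def \<alpha>'_def \<beta>'_def)
  have P: "if i \<in> B then 0 < \<alpha> i \<and> \<alpha> i < 1 \<and> \<beta> i = 0 else \<alpha> i = 0 \<and> 0 < \<beta> i \<and> \<beta> i < 1"
    and P': "if i \<in> C then 0 < \<alpha>' i \<and> \<alpha>' i < 1 \<and> \<beta>' i = 0 else \<alpha>' i = 0 \<and> 0 < \<beta>' i \<and> \<beta>' i < 1"
    if "i < n" for i
    using that c d by (simp_all add: \<alpha>_def \<beta>_def \<alpha>'_def \<beta>'_def)
  have "a $ i * b $ i = 0" if "i < n" for i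
  proof -
    have "\<forall>i\<in>{0..<n}. - (a $ i * b $ i) = 0"
      using pack_term(1)[OF P P'] s by (subst sum_nonneg_eq_0_iff[symmetric]) (auto simp: ai bi)
    with that show ?thesis by simp
  qed
  then have *: "(i \<in> B) = (i \<in> C) \<and> k $ i = 0" if "i < n" for i
    using pack_term(2)[OF P[OF that] P'[OF that], of "k $ i"] that by (simp add: ai bi)
  have "B = C" using * B C by auto
  moreover have "k = 0\<^sub>v n" using * k by (intro eq_vecI) auto
  ultimately show ?thesis by simp
qed

lemma Qr_mult: "c \<in> carrier_vec n \<Longrightarrow>
    real_mat (Q B) *\<^sub>v c = (Dr *\<^sub>v restrict_vec B c) @\<^sub>v (Er *\<^sub>v restrict_vec (- B) c)"
proof -
  assume c: "c \<in> carrier_vec n"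
  have "real_mat (Q B) = split_rows r (Dr @\<^sub>r Er) B"
    unfolding Q_def using D E by (intro eq_matI) (auto simp: split_rows_def append_rows_def)
  then show ?thesis using split_rows_mult_vec[OF Dr Er c] by simp
qed

lemma coords_unique:
  assumes B: "B \<in> bases D" and c: "c \<in> carrier_vec n" "c' \<in> carrier_vec n"
    and e: "Dr *\<^sub>v restrict_vec B c = Dr *\<^sub>v restrict_vec B c'"
      "Er *\<^sub>v restrict_vec (- B) c = Er *\<^sub>v restrict_vec (- B) c'"
  shows "c = c'"
proof -
  have Qc: "real_mat (Q B) \<in> carrier_mat n n" by simp
  have "det (real_mat (Q B)) \<noteq> 0" using B bases_iff by simp
  moreover have "Dr *\<^sub>v restrict_vec B (c - c') = 0\<^sub>v r" "Er *\<^sub>v restrict_vec (- B) (c - c') = 0\<^sub>v m"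
    using c by (simp_all add: restrict_vec_minus[OF c] mult_minus_distrib_mat_vec[OF Dr]
        mult_minus_distrib_mat_vec[OF Er] e minus_cancel_vec[of _ r] minus_cancel_vec[of _ m])
  then have "real_mat (Q B) *\<^sub>v (c - c') = 0\<^sub>v n"
    using c by (simp add: Qr_mult[of "c - c'"] zero_vec_append[symmetric] n[symmetric])
  ultimately have "c - c' = 0\<^sub>v n"
    using det_0_iff_vec_prod_zero[OF Qc] c by (metis minus_carrier_vec)
  then have "c $ i = c' $ i" if "i < n" for i
    using that c by (metis carrier_vecD eq_iff_diff_eq_0 index_minus_vec(1) index_zero_vec(1))
  then show ?thesis using c by (intro eq_vecI) auto
qed

lemma coords_exist:
  assumes B: "B \<in> bases D" and x: "x \<in> carrier_vec r" and y: "y \<in> carrier_vec m"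
  obtains c where "c \<in> carrier_vec n" "x = Dr *\<^sub>v restrict_vec B c" "y = Er *\<^sub>v restrict_vec (- B) c"
proof -
  let ?Q = "real_mat (Q B)" and ?z = "x @\<^sub>v y"
  have Qc: "?Q \<in> carrier_mat n n" by simp
  have d: "det ?Q \<noteq> 0" using B bases_iff by simp
  have z: "?z \<in> carrier_vec n" using x y n by auto
  note adj = adj_mat[OF Qc]
  define c where "c = (1 / det ?Q) \<cdot>\<^sub>v (adj_mat ?Q *\<^sub>v ?z)"
  have c: "c \<in> carrier_vec n" using adj(1) z by (auto simp: c_def)
  have "?Q *\<^sub>v c = (1 / det ?Q) \<cdot>\<^sub>v (?Q *\<^sub>v (adj_mat ?Q *\<^sub>v ?z))"
    unfolding c_def using adj(1) z by (intro mult_mat_vec[OF Qc]) auto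
  also have "?Q *\<^sub>v (adj_mat ?Q *\<^sub>v ?z) = (?Q * adj_mat ?Q) *\<^sub>v ?z"
    using adj(1) z by (intro assoc_mult_mat_vec[symmetric, OF Qc]) auto
  also have "\<dots> = det ?Q \<cdot>\<^sub>v ?z" unfolding adj(2)
  proof (rule eq_vecI)
    fix i assume "i < dim_vec (det ?Q \<cdot>\<^sub>v ?z)"
    then have i: "i < n" using z by (metis carrier_vecD index_smult_vec(2))
    then show "((det ?Q \<cdot>\<^sub>m 1\<^sub>m n) *\<^sub>v ?z) $ i = (det ?Q \<cdot>\<^sub>v ?z) $ i"
      using z carrier_vecD[OF z] by (simp add: smult_scalar_prod_distrib[of _ n] scalar_prod_left_unit del: index_append_vec)
  qed (use carrier_vecD[OF z] in simp)
  also have "(1 / det ?Q) \<cdot>\<^sub>v (det ?Q \<cdot>\<^sub>v ?z) = ?z" using d by (intro eq_vecI) auto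
  finally have "(Dr *\<^sub>v restrict_vec B c) @\<^sub>v (Er *\<^sub>v restrict_vec (- B) c) = x @\<^sub>v y"
    using c by (simp add: Qr_mult)
  then have "x = Dr *\<^sub>v restrict_vec B c" "y = Er *\<^sub>v restrict_vec (- B) c"
    using append_vec_eq[of "Dr *\<^sub>v restrict_vec B c" r x "Er *\<^sub>v restrict_vec (- B) c" y] x c by auto
  with c show ?thesis by (rule that)
qed

end

lemma vec_first_append [simp]: "u \<in> carrier_vec k \<Longrightarrow> vec_first (u @\<^sub>v v) k = u"
  unfolding vec_first_def by (intro eq_vecI) auto

lemma vec_last_append [simp]: "v \<in> carrier_vec l \<Longrightarrow> vec_last (u @\<^sub>v v) l = v"
  unfolding vec_last_def by (intro eq_vecI) auto

lemma vec_first_add: "u \<in> carrier_vec (k + l) \<Longrightarrow> v \<in> carrier_vec (k + l) \<Longrightarrow>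
    vec_first (u + v) k = vec_first u k + vec_first v k"
  unfolding vec_first_def by (intro eq_vecI) auto

lemma vec_last_add: "u \<in> carrier_vec (k + l) \<Longrightarrow> v \<in> carrier_vec (k + l) \<Longrightarrow>
    vec_last (u + v) l = vec_last u l + vec_last v l"
  unfolding vec_last_def by (intro eq_vecI) auto

lemma real_vec_add: "u \<in> carrier_vec k \<Longrightarrow> v \<in> carrier_vec k \<Longrightarrow> real_vec (u + v) = real_vec u + real_vec v"
  by (intro eq_vecI) auto

lemma real_vec_add_uminus:
  "u \<in> carrier_vec k \<Longrightarrow> v \<in> carrier_vec k \<Longrightarrow> real_vec (u + - v) = real_vec u - real_vec v"
  by (intro eq_vecI) auto

lemma mult_mat_vec_uminus:
  "A \<in> carrier_mat k l \<Longrightarrow> v \<in> carrier_vec l \<Longrightarrow> A *\<^sub>v (- v) = - (A *\<^sub>v (v :: 'a :: comm_ring_1 vec))"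
  by (auto intro!: eq_vecI)

lemma carrier_vec_arith:
  fixes a b c :: "'a :: ab_group_add vec"
  assumes "a \<in> carrier_vec k" "b \<in> carrier_vec k" "c \<in> carrier_vec k"
  shows "a + b + c = a + c + b" "a - b + c = a + c - b" "a + (b - c) = a + b - c"
    "a + (b + c) = a + b + c" "a + b = c + b + (a - c)"
  using assms by (auto intro!: eq_vecI)

lemma carrier_vec_cancel:
  fixes a b :: "'a :: ab_group_add vec"
  assumes "a \<in> carrier_vec k" "b \<in> carrier_vec k"
  shows "a - b + b = a" "a + b - b = a" "a - b = a + - b"
  using assms by (auto intro!: eq_vecI)

context dual_pair
begin

lemma restrict_diff: "c \<in> carrier_vec n \<Longrightarrow> restrict_vec ({..<n} - B) c = restrict_vec (- B) c"
  by (rule restrict_vec_cong[of _ n]) auto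

lemma mem_P1_iff: "B \<subseteq> {..<n} \<Longrightarrow> x \<in> cols_parallelepiped Dr B \<longleftrightarrow>
    (\<exists>c\<in>carrier_vec n. (\<forall>j<n. 0 \<le> c $ j \<and> c $ j \<le> 1) \<and> x = Dr *\<^sub>v restrict_vec B c)"
  by (rule cols_parallelepiped_iff[OF Dr])

lemma mem_P2_iff: "x \<in> cols_parallelepiped Er ({..<n} - B) \<longleftrightarrow>
    (\<exists>c\<in>carrier_vec n. (\<forall>j<n. 0 \<le> c $ j \<and> c $ j \<le> 1) \<and> x = Er *\<^sub>v restrict_vec (- B) c)"
  using cols_parallelepiped_iff[OF Er, of "{..<n} - B"] by (simp add: restrict_diff cong: bex_cong)

end

lemma mult_mat_vec_zero: "A \<in> carrier_mat k l \<Longrightarrow> A *\<^sub>v 0\<^sub>v l = (0\<^sub>v k :: 'a :: semiring_0 vec)"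
  by (auto intro!: eq_vecI)

lemma translate_zero: "S \<subseteq> carrier_vec k \<Longrightarrow> translate S (0\<^sub>v k) = S"
  by (force simp: translate_def)

lemma translate_UN: "translate (\<Union>i\<in>I. S i) t = (\<Union>i\<in>I. translate (S i) t)"
  by (auto simp: translate_def)

lemma at_right_zero_neq_bot: "at_right (0 :: real) \<noteq> bot"
  by simp

text \<open>\<open>s B\<close> are the coordinates of \<open>(w, w')\<close> with respect to the
  columns of \<open>Q B\<close>. Being a shifting vector enters only as the condition that none of
  them vanishes.\<close>

locale shifted_dual_pair = dual_pair +
  fixes w w' :: "real vec" and s :: "nat set \<Rightarrow> real vec"
  assumes s: "\<And>B. B \<in> bases D \<Longrightarrow> s B \<in> carrier_vec n"
    and s_nonzero: "\<And>B i. B \<in> bases D \<Longrightarrow> i < n \<Longrightarrow> s B $ i \<noteq> 0"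
    and w_eq: "\<And>B. B \<in> bases D \<Longrightarrow> w = Dr *\<^sub>v restrict_vec B (s B)"
    and w'_eq: "\<And>B. B \<in> bases D \<Longrightarrow> w' = Er *\<^sub>v restrict_vec (- B) (s B)"
    and w: "w \<in> carrier_vec r" and w': "w' \<in> carrier_vec m"
begin

text \<open>The half-open version of \<open>P(B)\<close>: the points \<open>(x, y)\<close> that a
  small positive multiple of \<open>(w, w')\<close> moves into the open cell.\<close>

definition half_open :: "nat set \<Rightarrow> real vec \<Rightarrow> real vec \<Rightarrow> bool" where
  "half_open B x y \<longleftrightarrow> (\<exists>c\<in>carrier_vec n. (\<forall>i<n. half_unit (s B $ i) (c $ i)) \<and>
     x = Dr *\<^sub>v restrict_vec B c \<and> y = Er *\<^sub>v restrict_vec (- B) c)"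

lemma line_eq:
  assumes B: "B \<in> bases D" and c: "c \<in> carrier_vec n"
  shows "Dr *\<^sub>v restrict_vec B c + \<epsilon> \<cdot>\<^sub>v w = Dr *\<^sub>v restrict_vec B (c + \<epsilon> \<cdot>\<^sub>v s B)"
    and "Er *\<^sub>v restrict_vec (- B) c + \<epsilon> \<cdot>\<^sub>v w' = Er *\<^sub>v restrict_vec (- B) (c + \<epsilon> \<cdot>\<^sub>v s B)"
  using c s[OF B]
  by (simp_all add: w_eq[OF B] w'_eq[OF B] restrict_vec_add[of _ n] restrict_vec_smult
      mult_add_distrib_mat_vec[OF Dr] mult_mat_vec[OF Dr] mult_add_distrib_mat_vec[OF Er] mult_mat_vec[OF Er])

lemma half_open_eventually:
  assumes B: "B \<in> bases D" and h: "half_open B x y"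
  shows "\<forall>\<^sub>F \<epsilon> in at_right 0. \<exists>c\<in>carrier_vec n. (\<forall>i<n. 0 < c $ i \<and> c $ i < 1) \<and>
    x + \<epsilon> \<cdot>\<^sub>v w = Dr *\<^sub>v restrict_vec B c \<and> y + \<epsilon> \<cdot>\<^sub>v w' = Er *\<^sub>v restrict_vec (- B) c"
proof -
  obtain c where c: "c \<in> carrier_vec n" "\<forall>i<n. half_unit (s B $ i) (c $ i)"
    "x = Dr *\<^sub>v restrict_vec B c" "y = Er *\<^sub>v restrict_vec (- B) c"
    using h by (auto simp: half_open_def)
  have "\<forall>\<^sub>F \<epsilon> in at_right 0. \<forall>i\<in>{..<n}. 0 < c $ i + \<epsilon> * s B $ i \<and> c $ i + \<epsilon> * s B $ i < 1"
    by (intro eventually_ball_finite ballI half_unit_eventually) (use c s_nonzero[OF B] in auto)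
  then show ?thesis
  proof (rule eventually_mono)
    fix \<epsilon> assume *: "\<forall>i\<in>{..<n}. 0 < c $ i + \<epsilon> * s B $ i \<and> c $ i + \<epsilon> * s B $ i < 1"
    show "\<exists>c\<in>carrier_vec n. (\<forall>i<n. 0 < c $ i \<and> c $ i < 1) \<and>
      x + \<epsilon> \<cdot>\<^sub>v w = Dr *\<^sub>v restrict_vec B c \<and> y + \<epsilon> \<cdot>\<^sub>v w' = Er *\<^sub>v restrict_vec (- B) c"
    proof (intro bexI conjI)
      show "\<forall>i<n. 0 < (c + \<epsilon> \<cdot>\<^sub>v s B) $ i \<and> (c + \<epsilon> \<cdot>\<^sub>v s B) $ i < 1"
        using * c s[OF B] by simp
    qed (use c s[OF B] line_eq[OF B c(1)] in auto)
  qed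
qed

lemma half_open_associated:
  assumes B: "B \<in> bases D" and h: "half_open B x y"
  shows "associated w (cols_parallelepiped Dr B) x" "associated w' (cols_parallelepiped Er ({..<n} - B)) y"
  unfolding associated_def mem_P1_iff[OF basesD(1)[OF B]] mem_P2_iff
  by (rule eventually_mono[OF half_open_eventually[OF B h]]; meson less_imp_le)+

lemma half_open_closed: "B \<in> bases D \<Longrightarrow> half_open B x y \<Longrightarrow> x \<in> cols_parallelepiped Dr B"
  unfolding half_open_def mem_P1_iff[OF basesD(1)] using half_unit_bounds by blast

lemma half_openI:
  assumes B: "B \<in> bases D" and x: "x \<in> carrier_vec r" and y: "y \<in> carrier_vec m"
    and f: "\<exists>\<^sub>F \<epsilon> in at_right 0. x + \<epsilon> \<cdot>\<^sub>v w \<in> cols_parallelepiped Dr B"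
    and a: "associated w' (cols_parallelepiped Er ({..<n} - B)) y"
  shows "half_open B x y"
proof -
  obtain c where c: "c \<in> carrier_vec n" "x = Dr *\<^sub>v restrict_vec B c" "y = Er *\<^sub>v restrict_vec (- B) c"
    using coords_exist[OF B x y] by blast
  have *: "\<exists>\<^sub>F \<epsilon> in at_right 0. y + \<epsilon> \<cdot>\<^sub>v w' \<in> cols_parallelepiped Er ({..<n} - B) \<and>
      x + \<epsilon> \<cdot>\<^sub>v w \<in> cols_parallelepiped Dr B"
    using frequently_eventually_conj[OF f] a by (simp add: associated_def)
  have "half_unit (s B $ i) (c $ i)" if i: "i < n" for i
  proof (rule frequently_in_unit_imp_half_unit[OF _ s_nonzero[OF B i]], rule frequently_elim1[OF *])
    fix \<epsilon> assume "y + \<epsilon> \<cdot>\<^sub>v w' \<in> cols_parallelepiped Er ({..<n} - B) \<and> x + \<epsilon> \<cdot>\<^sub>v w \<in> cols_parallelepiped Dr B"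
    then obtain d e where d: "d \<in> carrier_vec n" "\<forall>j<n. 0 \<le> d $ j \<and> d $ j \<le> 1" "x + \<epsilon> \<cdot>\<^sub>v w = Dr *\<^sub>v restrict_vec B d"
      and e: "e \<in> carrier_vec n" "\<forall>j<n. 0 \<le> e $ j \<and> e $ j \<le> 1" "y + \<epsilon> \<cdot>\<^sub>v w' = Er *\<^sub>v restrict_vec (- B) e"
      unfolding mem_P1_iff[OF basesD(1)[OF B]] mem_P2_iff by blast
    \<comment> \<open>The two memberships provide unrelated coefficient vectors. Since
      \<open>d\<close> matters only on \<open>B\<close> and \<open>e\<close> only off
      \<open>B\<close>, they can be glued, and uniqueness of coordinates identifies the result with
      \<open>c + \<epsilon> \<cdot>\<^sub>v s B\<close>.\<close>
    define f where "f = vec n (\<lambda>i. if i \<in> B then d $ i else e $ i)"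
    have f: "f \<in> carrier_vec n" by (simp add: f_def)
    have rf: "restrict_vec B f = restrict_vec B d" "restrict_vec (- B) f = restrict_vec (- B) e"
      using d(1) e(1) by (auto simp: f_def intro!: eq_vecI)
    have "c + \<epsilon> \<cdot>\<^sub>v s B = f"
    proof (rule coords_unique[OF B _ f])
      show "Dr *\<^sub>v restrict_vec B (c + \<epsilon> \<cdot>\<^sub>v s B) = Dr *\<^sub>v restrict_vec B f"
        unfolding line_eq(1)[OF B c(1), symmetric] c(2)[symmetric] rf by (rule d(3))
      show "Er *\<^sub>v restrict_vec (- B) (c + \<epsilon> \<cdot>\<^sub>v s B) = Er *\<^sub>v restrict_vec (- B) f"
        unfolding line_eq(2)[OF B c(1), symmetric] c(3)[symmetric] rf by (rule e(3))
    qed (use c(1) s[OF B] in simp)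
    then have "c $ i + \<epsilon> * s B $ i = f $ i" using c(1) s[OF B] i
      by (metis carrier_vecD index_add_vec(1) index_smult_vec(1) index_smult_vec(2))
    with d(2) e(2) i show "0 \<le> c $ i + \<epsilon> * s B $ i \<and> c $ i + \<epsilon> * s B $ i \<le> 1"
      by (simp add: f_def)
  qed
  with c show ?thesis unfolding half_open_def by blast
qed

text \<open>One small \<open>\<epsilon>\<close> moves both points into open cells without changing
  their difference, so disjointness of the open cells applies.\<close>

lemma half_open_disjoint:
  assumes B: "B \<in> bases D" "half_open B x y" and C: "C \<in> bases D" "half_open C x' y'"
    and k: "k \<in> carrier_vec n"
    and x: "x = x' + real_vec (D *\<^sub>v k)" and y: "y = y' - real_vec (E *\<^sub>v k)"
    and x': "x' \<in> carrier_vec r" and y': "y' \<in> carrier_vec m"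
  shows "B = C \<and> k = 0\<^sub>v n"
proof -
  have ne: "at_right (0 :: real) \<noteq> bot" by simp
  obtain \<epsilon> c d where c: "c \<in> carrier_vec n" "\<forall>i<n. 0 < c $ i \<and> c $ i < 1"
      "x + \<epsilon> \<cdot>\<^sub>v w = Dr *\<^sub>v restrict_vec B c" "y + \<epsilon> \<cdot>\<^sub>v w' = Er *\<^sub>v restrict_vec (- B) c"
    and d: "d \<in> carrier_vec n" "\<forall>i<n. 0 < d $ i \<and> d $ i < 1"
      "x' + \<epsilon> \<cdot>\<^sub>v w = Dr *\<^sub>v restrict_vec C d" "y' + \<epsilon> \<cdot>\<^sub>v w' = Er *\<^sub>v restrict_vec (- C) d"
    using eventually_happens'[OF ne eventually_conj[OF half_open_eventually[OF B] half_open_eventually[OF C]]]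
    by blast
  have "Dr *\<^sub>v restrict_vec B c = Dr *\<^sub>v restrict_vec C d + Dr *\<^sub>v real_vec k"
    unfolding c(3)[symmetric] d(3)[symmetric] x real_mat_mult_real_vec[OF D k]
    by (rule carrier_vec_arith(1)[of _ r]) (use x' w k in simp_all)
  moreover have "Er *\<^sub>v restrict_vec (- B) c = Er *\<^sub>v restrict_vec (- C) d - Er *\<^sub>v real_vec k"
    unfolding c(4)[symmetric] d(4)[symmetric] y real_mat_mult_real_vec[OF E k]
    by (rule carrier_vec_arith(2)[of _ m]) (use y' w' k in simp_all)
  ultimately show ?thesis
    using open_cells_disjoint[OF basesD(1)[OF B(1)] basesD(1)[OF C(1)] c(1,2) d(1,2) k] by blast
qed

abbreviation "fst_part z \<equiv> real_vec (vec_first z r)"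
abbreviation "snd_part z \<equiv> real_vec (vec_last z m)"

section \<open>Counting coset points and covering\<close>

definition half_open_points :: "real vec \<Rightarrow> real vec \<Rightarrow> nat set \<Rightarrow> int vec set" where
  "half_open_points x y B = {z \<in> carrier_vec n. half_open B (x + fst_part z) (y + snd_part z)}"

lemma parts_add_Q:
  assumes "z \<in> carrier_vec n" "q \<in> carrier_vec n"
  shows "fst_part (z + Q B *\<^sub>v q) = fst_part z + Dr *\<^sub>v restrict_vec B (real_vec q)"
    and "snd_part (z + Q B *\<^sub>v q) = snd_part z + Er *\<^sub>v restrict_vec (- B) (real_vec q)"
proof -
  have 1: "Q B *\<^sub>v q \<in> carrier_vec (r + m)" "z \<in> carrier_vec (r + m)"
    using assms n mult_mat_vec_carrier[OF Q_carrier, of q B] by auto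
  show "fst_part (z + Q B *\<^sub>v q) = fst_part z + Dr *\<^sub>v restrict_vec B (real_vec q)"
    unfolding vec_first_add[OF 1(2,1)] unfolding Q_mult[OF assms(2)] using assms
    by (simp add: real_vec_add[of _ r] restrict_vec_real real_mat_mult_real_vec[OF D])
  show "snd_part (z + Q B *\<^sub>v q) = snd_part z + Er *\<^sub>v restrict_vec (- B) (real_vec q)"
    unfolding vec_last_add[OF 1(2,1)] unfolding Q_mult[OF assms(2)] using assms
    by (simp add: real_vec_add[of _ m] restrict_vec_real real_mat_mult_real_vec[OF E])
qed

lemma parts_add_N:
  assumes "z \<in> carrier_vec n" "q \<in> carrier_vec n"
  shows "fst_part (z + N *\<^sub>v q) = fst_part z + real_vec (D *\<^sub>v q)"
    and "snd_part (z + N *\<^sub>v q) = snd_part z - real_vec (E *\<^sub>v q)"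
proof -
  have 1: "N *\<^sub>v q \<in> carrier_vec (r + m)" "z \<in> carrier_vec (r + m)"
    using assms n mult_mat_vec_carrier[OF N_carrier, of q] by auto
  show "fst_part (z + N *\<^sub>v q) = fst_part z + real_vec (D *\<^sub>v q)"
    unfolding vec_first_add[OF 1(2,1)] unfolding N_mult[OF assms(2)] using assms
    by (simp add: real_vec_add[of _ r])
  show "snd_part (z + N *\<^sub>v q) = snd_part z - real_vec (E *\<^sub>v q)"
    unfolding vec_last_add[OF 1(2,1)] unfolding N_mult[OF assms(2)] using assms
    by (simp add: real_vec_add_uminus[of _ m])
qed

text \<open>Adding \<open>Q B *\<^sub>v q\<close> to a point adds \<open>q\<close> to its
  coordinates, and each coordinate has exactly one integer shift into the half-open unit interval.
  So every coset of the lattice of \<open>Q B\<close> meets the cell once, wherever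
  \<open>(x, y)\<close> lies.\<close>

lemma half_open_points_transversal:
  assumes B: "B \<in> bases D" and x: "x \<in> carrier_vec r" and y: "y \<in> carrier_vec m"
  shows "lattice_transversal (Q B) (half_open_points x y B)"
  unfolding lattice_transversal_def carrier_matD[OF Q_carrier]
proof (intro conjI ballI)
  show "half_open_points x y B \<subseteq> carrier_vec n" by (auto simp: half_open_points_def)
  fix z :: "int vec" assume z: "z \<in> carrier_vec n"
  have x1: "x + fst_part z' \<in> carrier_vec r" and y1: "y + snd_part z' \<in> carrier_vec m" for z' :: "int vec"
    using x y by auto
  obtain c where c: "c \<in> carrier_vec n" "x + fst_part z = Dr *\<^sub>v restrict_vec B c"
    "y + snd_part z = Er *\<^sub>v restrict_vec (- B) c"
    using coords_exist[OF B x1 y1] by blast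
  define q where "q = vec n (\<lambda>i. THE k. half_unit (s B $ i) (c $ i - of_int k))"
  have q: "q \<in> carrier_vec n" by (simp add: q_def)
  have qi: "half_unit (s B $ i) (c $ i - of_int (q $ i))"
    "half_unit (s B $ i) (c $ i - of_int k) \<Longrightarrow> k = q $ i" if "i < n" for i k
    using theI'[OF half_unit_int_shift[OF s_nonzero[OF B that]], of "c $ i"]
      half_unit_int_shift[OF s_nonzero[OF B that], of "c $ i"] that by (auto simp: q_def)
  have Qq: "Q B *\<^sub>v q' \<in> carrier_vec n" if "q' \<in> carrier_vec n" for q'
    using that by (rule mult_mat_vec_carrier[OF Q_carrier])
  have inv: "z - Q B *\<^sub>v q = z + Q B *\<^sub>v (- q)"
    unfolding mult_mat_vec_uminus[OF Q_carrier q] by (rule carrier_vec_cancel(3)[OF z Qq[OF q]])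
  have cq: "c - real_vec q = c + real_vec (- q)" using c q by (intro eq_vecI) auto
  have mem: "z - Q B *\<^sub>v q \<in> half_open_points x y B"
  proof -
    have "half_open B (x + fst_part (z - Q B *\<^sub>v q)) (y + snd_part (z - Q B *\<^sub>v q))"
      unfolding half_open_def
    proof (intro bexI conjI)
      show "\<forall>i<n. half_unit (s B $ i) ((c - real_vec q) $ i)" using qi c q by simp
      show "c - real_vec q \<in> carrier_vec n" using c q by simp
      show "x + fst_part (z - Q B *\<^sub>v q) = Dr *\<^sub>v restrict_vec B (c - real_vec q)"
      proof -
        have "x + fst_part (z - Q B *\<^sub>v q) = (x + fst_part z) + Dr *\<^sub>v restrict_vec B (real_vec (- q))"
          unfolding inv using z q x by (subst parts_add_Q) (auto intro!: carrier_vec_arith(4)[of _ r])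
        then show ?thesis unfolding c(2) cq using c(1) q
          by (simp add: restrict_vec_add[of _ n] mult_add_distrib_mat_vec[OF Dr])
      qed
      show "y + snd_part (z - Q B *\<^sub>v q) = Er *\<^sub>v restrict_vec (- B) (c - real_vec q)"
      proof -
        have "y + snd_part (z - Q B *\<^sub>v q) = (y + snd_part z) + Er *\<^sub>v restrict_vec (- B) (real_vec (- q))"
          unfolding inv using z q y by (subst parts_add_Q) (auto intro!: carrier_vec_arith(4)[of _ m])
        then show ?thesis unfolding c(3) cq using c(1) q
          by (simp add: restrict_vec_add[of _ n] mult_add_distrib_mat_vec[OF Er])
      qed
    qed
    then show ?thesis using z Qq[OF q] by (simp add: half_open_points_def)
  qed
  show "\<exists>!y'. y' \<in> half_open_points x y B \<and> (\<exists>q\<in>carrier_vec n. z = y' + Q B *\<^sub>v q)"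
  proof (rule ex1I[of _ "z - Q B *\<^sub>v q"])
    show "z - Q B *\<^sub>v q \<in> half_open_points x y B \<and> (\<exists>q'\<in>carrier_vec n. z = z - Q B *\<^sub>v q + Q B *\<^sub>v q')"
      using mem q carrier_vec_cancel(1)[OF z Qq[OF q]] by (intro conjI bexI[of _ q]) simp_all
  next
    fix y' assume "y' \<in> half_open_points x y B \<and> (\<exists>q\<in>carrier_vec n. z = y' + Q B *\<^sub>v q)"
    then obtain p where y': "y' \<in> carrier_vec n" "half_open B (x + fst_part y') (y + snd_part y')"
      and p: "p \<in> carrier_vec n" and zp: "z = y' + Q B *\<^sub>v p"
      by (auto simp: half_open_points_def)
    obtain d where d: "d \<in> carrier_vec n" "\<forall>i<n. half_unit (s B $ i) (d $ i)"
      "x + fst_part y' = Dr *\<^sub>v restrict_vec B d" "y + snd_part y' = Er *\<^sub>v restrict_vec (- B) d"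
      using y'(2) by (auto simp: half_open_def)
    have "x + fst_part z = (x + fst_part y') + Dr *\<^sub>v restrict_vec B (real_vec p)"
      unfolding zp using y' p x by (subst parts_add_Q) (auto intro!: carrier_vec_arith(4)[of _ r])
    then have 1: "Dr *\<^sub>v restrict_vec B c = Dr *\<^sub>v restrict_vec B (d + real_vec p)"
      unfolding c(2) d(3) using d(1) p by (simp add: restrict_vec_add[of _ n] mult_add_distrib_mat_vec[OF Dr])
    have "y + snd_part z = (y + snd_part y') + Er *\<^sub>v restrict_vec (- B) (real_vec p)"
      unfolding zp using y' p y by (subst parts_add_Q) (auto intro!: carrier_vec_arith(4)[of _ m])
    then have 2: "Er *\<^sub>v restrict_vec (- B) c = Er *\<^sub>v restrict_vec (- B) (d + real_vec p)"
      unfolding c(3) d(4) using d(1) p by (simp add: restrict_vec_add[of _ n] mult_add_distrib_mat_vec[OF Er])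
    have "c = d + real_vec p" using d(1) p by (intro coords_unique[OF B c(1) _ 1 2]) simp
    then have "d $ i = c $ i - of_int (p $ i)" if "i < n" for i using that d(1) p by simp
    then have "p $ i = q $ i" if "i < n" for i using that d(2) qi(2)[OF that] by simp
    then have "p = q" using p q by (intro eq_vecI) auto
    then show "y' = z - Q B *\<^sub>v q" using zp carrier_vec_cancel(2)[OF y'(1) Qq[OF p]] by simp
  qed
qed

lemma half_open_points_card:
  assumes B: "B \<in> bases D" and x: "x \<in> carrier_vec r" and y: "y \<in> carrier_vec m"
  shows "finite (half_open_points x y B)" "card (half_open_points x y B) = nat \<bar>det (Q B)\<bar>"
  using lattice_transversal_card[OF Q_carrier _ half_open_points_transversal[OF assms]] B bases_iff
  by auto

lemma half_open_cover:
  assumes x: "x \<in> carrier_vec r" and y: "y \<in> carrier_vec m"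
  obtains B k where "B \<in> bases D" "k \<in> carrier_vec n"
    "half_open B (x - real_vec (D *\<^sub>v k)) (y + real_vec (E *\<^sub>v k))"
proof -
  obtain R where R: "finite R" "card R = nat \<bar>det N\<bar>" "lattice_transversal N R"
    using lattice_transversal_exists[OF N_carrier det_N_nonzero] by blast
  have R1: "\<exists>!\<rho>. \<rho> \<in> R \<and> (\<exists>q\<in>carrier_vec n. z = \<rho> + N *\<^sub>v q)" if "z \<in> carrier_vec n" for z
    using R(3) that unfolding lattice_transversal_def carrier_matD[OF N_carrier] by blast
  have Rc: "R \<subseteq> carrier_vec n"
    using R(3) unfolding lattice_transversal_def carrier_matD[OF N_carrier] by blast
  \<comment> \<open>The class of \<open>z\<close> modulo the tiling lattice. This lattice is spanned
    by \<open>N\<close>, whereas the points in each single cell were counted with the lattice of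
    \<open>Q B\<close>.\<close>
  define \<rho> where "\<rho> z = (THE \<rho>. \<rho> \<in> R \<and> (\<exists>q\<in>carrier_vec n. z = \<rho> + N *\<^sub>v q))" for z
  have \<rho>: "\<rho> z \<in> R" "\<exists>q\<in>carrier_vec n. z = \<rho> z + N *\<^sub>v q" if "z \<in> carrier_vec n" for z
    using theI'[OF R1[OF that]] by (auto simp: \<rho>_def)
  have Nq: "N *\<^sub>v q \<in> carrier_vec n" if "q \<in> carrier_vec n" for q
    using that by (rule mult_mat_vec_carrier[OF N_carrier])
  have same: "\<exists>k\<in>carrier_vec n. z = z' + N *\<^sub>v k"
    if z: "z \<in> carrier_vec n" and z': "z' \<in> carrier_vec n" and e: "\<rho> z = \<rho> z'" for z z'
  proof -
    obtain q q' where q: "q \<in> carrier_vec n" "z = \<rho> z + N *\<^sub>v q"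
      and q': "q' \<in> carrier_vec n" "z' = \<rho> z' + N *\<^sub>v q'" using \<rho>(2)[OF z] \<rho>(2)[OF z'] by blast
    have "\<rho> z' \<in> carrier_vec n" using \<rho>(1)[OF z'] Rc by auto
    then have "z = z' + N *\<^sub>v (q - q')"
      unfolding mult_minus_distrib_mat_vec[OF N_carrier q(1) q'(1)]
      using carrier_vec_arith(5)[OF Nq[OF q(1)] _ Nq[OF q'(1)], of "\<rho> z'"] q(2) q'(2) e
      by (metis Nq comm_add_vec q(1) q'(1))
    then show ?thesis using q q' by (intro bexI[of _ "q - q'"]) auto
  qed
  let ?S = "half_open_points x y"
  define X where "X = Sigma (bases D) ?S"
  have inj: "inj_on (\<lambda>(B, z). \<rho> z) X"
  proof (rule inj_onI, clarify)
    fix B z C z' assume *: "(B, z) \<in> X" "(C, z') \<in> X" "\<rho> z = \<rho> z'"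
    then have B: "B \<in> bases D" "half_open B (x + fst_part z) (y + snd_part z)" "z \<in> carrier_vec n"
      and C: "C \<in> bases D" "half_open C (x + fst_part z') (y + snd_part z')" "z' \<in> carrier_vec n"
      by (auto simp: X_def half_open_points_def)
    obtain k where k: "k \<in> carrier_vec n" "z = z' + N *\<^sub>v k" using same[OF B(3) C(3) *(3)] by blast
    have "B = C \<and> k = 0\<^sub>v n"
    proof (rule half_open_disjoint[OF B(1,2) C(1,2) k(1)])
      show "x + fst_part z = x + fst_part z' + real_vec (D *\<^sub>v k)"
        unfolding k(2) parts_add_N[OF C(3) k(1)]
        by (rule carrier_vec_arith(4)[of _ r]) (use x k in simp_all)
      show "y + snd_part z = y + snd_part z' - real_vec (E *\<^sub>v k)"
        unfolding k(2) parts_add_N[OF C(3) k(1)]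
        by (rule carrier_vec_arith(3)[of _ m]) (use y k in simp_all)
    qed (use x y in auto)
    moreover from this have "N *\<^sub>v k = 0\<^sub>v n" by (auto simp: carrier_matD[OF N_carrier] intro!: eq_vecI)
    ultimately show "B = C \<and> z = z'" using k(2) C(3) by simp
  qed
  have fX: "finite X" unfolding X_def
    by (rule finite_SigmaI[OF finite_bases]) (use half_open_points_card[OF _ x y] in blast)
  have "int (card X) = (\<Sum>B\<in>bases D. int (card (?S B)))"
    unfolding X_def using half_open_points_card[OF _ x y] by (subst card_SigmaI[OF finite_bases]) auto
  also have "\<dots> = (\<Sum>B\<in>bases D. \<bar>det (Q B)\<bar>)"
    by (rule sum.cong) (use half_open_points_card[OF _ x y] in auto)
  also have "\<dots> = (\<Sum>B\<in>Pow {..<n}. \<bar>det (Q B)\<bar>)"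
    by (rule sum.mono_neutral_left) (use bases_iff basesD(1) in auto)
  also have "\<dots> \<ge> \<bar>det N\<bar>"
    unfolding Q_def N_def by (rule det_append_rows_uminus_le[OF D E n])
  finally have "card R \<le> card X" using R(2) by simp
  moreover have sub: "(\<lambda>(B, z). \<rho> z) ` X \<subseteq> R"
    using \<rho>(1) by (auto simp: X_def half_open_points_def)
  ultimately have img: "(\<lambda>(B, z). \<rho> z) ` X = R"
    using card_image[OF inj] R(1) card_mono[OF R(1) sub] by (intro card_subset_eq) auto
  have z0: "0\<^sub>v n \<in> carrier_vec n" by simp
  \<comment> \<open>The class of 0 is the class of the point \<open>(x, y)\<close> itself. The
    \<open>z\<close> found is a lattice vector \<open>N *\<^sub>v k\<close>, which is added to
    \<open>(x, y)\<close>; the claim subtracts, so it is witnessed by \<open>- k\<close>.\<close>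
  from \<rho>(1)[OF z0] img obtain B z where Bz: "(B, z) \<in> X" "\<rho> z = \<rho> (0\<^sub>v n)" by auto
  then have B: "B \<in> bases D" "half_open B (x + fst_part z) (y + snd_part z)" "z \<in> carrier_vec n"
    by (auto simp: X_def half_open_points_def)
  obtain k where k: "k \<in> carrier_vec n" "z = 0\<^sub>v n + N *\<^sub>v k" using same[OF B(3) z0 Bz(2)] by blast
  have "fst_part z = fst_part (0\<^sub>v n) + real_vec (D *\<^sub>v k)" "snd_part z = snd_part (0\<^sub>v n) - real_vec (E *\<^sub>v k)"
    unfolding k(2) by (rule parts_add_N[OF z0 k(1)])+
  moreover have "fst_part (0\<^sub>v n) = 0\<^sub>v r" "snd_part (0\<^sub>v n) = 0\<^sub>v m"
    using n by (auto simp: vec_first_def vec_last_def intro!: eq_vecI)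
  moreover have "x + (0\<^sub>v r + real_vec d) = x - real_vec (- d)" if "d \<in> carrier_vec r" for d
    using x that by (auto intro!: eq_vecI)
  moreover have "y + (0\<^sub>v m - real_vec d) = y + real_vec (- d)" if "d \<in> carrier_vec m" for d
    using y that by (auto intro!: eq_vecI)
  ultimately have "x + fst_part z = x - real_vec (D *\<^sub>v (- k))" "y + snd_part z = y + real_vec (E *\<^sub>v (- k))"
    using k(1) by (simp_all add: mult_mat_vec_uminus[OF D] mult_mat_vec_uminus[OF E])
  with B have "half_open B (x - real_vec (D *\<^sub>v (- k))) (y + real_vec (E *\<^sub>v (- k)))" by simp
  with B(1) k(1) show ?thesis by (intro that[of B "- k"]) auto
qed

section \<open>The slices of the tiling\<close>

definition M :: "int mat" where "M = D * J"

definition L :: "int mat" where "L = D * transpose_mat D"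

lemma M_carrier: "M \<in> carrier_mat r m" and L_carrier: "L \<in> carrier_mat r r"
  using D J by (auto simp: M_def L_def)

definition idx :: "nat set \<Rightarrow> int vec set" where
  "idx B = {z \<in> carrier_vec m. associated w' (cols_parallelepiped Er ({..<n} - B)) (real_vec z)}"

definition tile :: "nat set \<Rightarrow> int vec \<Rightarrow> real vec set" where
  "tile B z = translate (cols_parallelepiped Dr B) (real_vec (M *\<^sub>v z))"

definition tiles :: "real vec set" where
  "tiles = (\<Union>B\<in>bases D. \<Union>z\<in>idx B. tile B z)"

lemma M_vec [simp]: "z \<in> carrier_vec m \<Longrightarrow> M *\<^sub>v z \<in> carrier_vec r"
  and L_vec [simp]: "u \<in> carrier_vec r \<Longrightarrow> L *\<^sub>v u \<in> carrier_vec r"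
  using M_carrier L_carrier by (auto intro: mult_mat_vec_carrier)

text \<open>\<open>(z, u)\<close> are coordinates on the integer vectors \<open>k\<close> adapted to
  the slice: \<open>E J = 1\<close> and \<open>E D\<^sup>T = 0\<close> make \<open>z\<close> the
  component visible in the second factor, and \<open>u\<close> only produces a translation in the
  first.\<close>

lemma lattice_vec:
  assumes z: "z \<in> carrier_vec m" and u: "u \<in> carrier_vec r"
  defines "k \<equiv> J *\<^sub>v z + transpose_mat D *\<^sub>v u"
  shows "k \<in> carrier_vec n" "D *\<^sub>v k = M *\<^sub>v z + L *\<^sub>v u" "E *\<^sub>v k = z"
proof -
  have Dt: "transpose_mat D \<in> carrier_mat n r" using D by simp
  have c: "J *\<^sub>v z \<in> carrier_vec n" "transpose_mat D *\<^sub>v u \<in> carrier_vec n"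
    using mult_mat_vec_carrier[OF J z] mult_mat_vec_carrier[OF Dt u] .
  then show "k \<in> carrier_vec n" by (simp add: k_def)
  show "D *\<^sub>v k = M *\<^sub>v z + L *\<^sub>v u"
    unfolding k_def M_def L_def mult_add_distrib_mat_vec[OF D c] assoc_mult_mat_vec[OF D J z] assoc_mult_mat_vec[OF D Dt u] ..
  have "E *\<^sub>v k = (E * J) *\<^sub>v z + (E * transpose_mat D) *\<^sub>v u"
    unfolding k_def mult_add_distrib_mat_vec[OF E c] assoc_mult_mat_vec[OF E J z] assoc_mult_mat_vec[OF E Dt u] ..
  also have "\<dots> = z" unfolding EJ ED using z u by (intro eq_vecI) auto
  finally show "E *\<^sub>v k = z" .
qed

lemma lattice_vec_zero:
  assumes z: "z \<in> carrier_vec m" and u: "u \<in> carrier_vec r"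
    and k: "J *\<^sub>v z + transpose_mat D *\<^sub>v u = 0\<^sub>v n"
  shows "z = 0\<^sub>v m" "u = 0\<^sub>v r"
proof -
  have Dt: "transpose_mat D \<in> carrier_mat n r" and Kt: "transpose_mat K \<in> carrier_mat r n" using D K by auto
  have "z = E *\<^sub>v 0\<^sub>v n" using lattice_vec(3)[OF z u] k by simp
  then show z0: "z = 0\<^sub>v m" using mult_mat_vec_zero[OF E] by simp
  have "transpose_mat D *\<^sub>v u = J *\<^sub>v z + transpose_mat D *\<^sub>v u"
    unfolding z0 mult_mat_vec_zero[OF J] using mult_mat_vec_carrier[OF Dt u] by simp
  then have "transpose_mat K *\<^sub>v (transpose_mat D *\<^sub>v u) = 0\<^sub>v r"
    unfolding k using mult_mat_vec_zero[OF Kt] by simp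
  moreover have "transpose_mat K * transpose_mat D = 1\<^sub>m r"
    using DK transpose_mult[OF D K] by simp
  ultimately show "u = 0\<^sub>v r" using assoc_mult_mat_vec[OF Kt Dt u] u by simp
qed

text \<open>Every \<open>k\<close> has such coordinates, namely \<open>z = E k\<close> and
  \<open>u = K\<^sup>T k\<close>, by the dual decomposition of the identity.\<close>

lemma lattice_vec_surj:
  assumes k: "k \<in> carrier_vec n"
  shows "D *\<^sub>v k = M *\<^sub>v (E *\<^sub>v k) + L *\<^sub>v (transpose_mat K *\<^sub>v k)"
proof -
  have Dt: "transpose_mat D \<in> carrier_mat n r" and Kt: "transpose_mat K \<in> carrier_mat r n" using D K by auto
  have "k = (J * E + transpose_mat D * transpose_mat K) *\<^sub>v k" unfolding decomp' using k by simp
  also have "\<dots> = (J * E) *\<^sub>v k + (transpose_mat D * transpose_mat K) *\<^sub>v k"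
    by (rule add_mult_distrib_mat_vec) (use J E Dt Kt k in auto)
  also have "\<dots> = J *\<^sub>v (E *\<^sub>v k) + transpose_mat D *\<^sub>v (transpose_mat K *\<^sub>v k)"
    unfolding assoc_mult_mat_vec[OF J E k] assoc_mult_mat_vec[OF Dt Kt k] ..
  finally have "D *\<^sub>v k = D *\<^sub>v (J *\<^sub>v (E *\<^sub>v k) + transpose_mat D *\<^sub>v (transpose_mat K *\<^sub>v k))"
    by (rule arg_cong)
  also have "\<dots> = M *\<^sub>v (E *\<^sub>v k) + L *\<^sub>v (transpose_mat K *\<^sub>v k)"
    by (rule lattice_vec(2)) (use mult_mat_vec_carrier[OF Kt k] k in auto)
  finally show ?thesis .
qed

lemma append_carrier: "a \<in> carrier_vec r \<Longrightarrow> b \<in> carrier_vec m \<Longrightarrow> a @\<^sub>v b \<in> carrier_vec n"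
  by (simp add: n)

lemma cell_subset: "B \<in> bases D \<Longrightarrow> cols_parallelepiped Dr B \<subseteq> carrier_vec r"
  by (rule cols_parallelepiped_subset[OF Dr basesD(1)])

lemma idx_carrier: "z \<in> idx B \<Longrightarrow> z \<in> carrier_vec m"
  by (simp add: idx_def)

lemma tile_subset: "B \<in> bases D \<Longrightarrow> z \<in> idx B \<Longrightarrow> tile B z \<subseteq> carrier_vec r"
  unfolding tile_def by (rule translate_subset[OF cell_subset]) (auto simp: idx_carrier)

lemma tiles_subset: "tiles \<subseteq> carrier_vec r"
  using tile_subset by (auto simp: tiles_def)

lemma mem_tile_iff:
  "B \<in> bases D \<Longrightarrow> z \<in> idx B \<Longrightarrow> x \<in> carrier_vec r \<Longrightarrow>
    x \<in> tile B z \<longleftrightarrow> x - real_vec (M *\<^sub>v z) \<in> cols_parallelepiped Dr B"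
  unfolding tile_def by (rule mem_translate_iff[OF cell_subset]) (auto simp: idx_carrier)

text \<open>Translates a tile back into a cell of the tiling: the membership of the tile supplies
  the first factor, and the association of \<open>z\<close> with \<open>B\<close> supplies the
  second.\<close>

lemma half_open_of_tile:
  assumes B: "B \<in> bases D" and z: "z \<in> idx B" and t: "t \<in> carrier_vec r" and x: "x \<in> carrier_vec r"
    and f: "\<exists>\<^sub>F \<epsilon> in at_right 0. x + \<epsilon> \<cdot>\<^sub>v w \<in> translate (tile B z) t"
  shows "half_open B (x - t - real_vec (M *\<^sub>v z)) (real_vec z)"
proof (rule half_openI[OF B])
  have zc: "z \<in> carrier_vec m" using z by (rule idx_carrier)
  have e: "x + \<epsilon> \<cdot>\<^sub>v w - t - real_vec (M *\<^sub>v z) = x - t - real_vec (M *\<^sub>v z) + \<epsilon> \<cdot>\<^sub>v w" for \<epsilon>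
  proof -
    have "real_vec (M *\<^sub>v z) \<in> carrier_vec r" using zc by simp
    then show ?thesis using x t w by (intro eq_vecI) (auto simp del: index_mult_mat_vec dim_mult_mat_vec)
  qed
  show "\<exists>\<^sub>F \<epsilon> in at_right 0. x - t - real_vec (M *\<^sub>v z) + \<epsilon> \<cdot>\<^sub>v w \<in> cols_parallelepiped Dr B"
  proof (rule frequently_elim1[OF f])
    fix \<epsilon> assume "x + \<epsilon> \<cdot>\<^sub>v w \<in> translate (tile B z) t"
    then have "x + \<epsilon> \<cdot>\<^sub>v w - t \<in> tile B z"
      using mem_translate_iff[OF tile_subset[OF B z] t] x w by simp
    then show "x - t - real_vec (M *\<^sub>v z) + \<epsilon> \<cdot>\<^sub>v w \<in> cols_parallelepiped Dr B"
      using mem_tile_iff[OF B z] x w t by (simp add: e)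
  qed
qed (use z x t in \<open>auto simp: idx_def\<close>)

text \<open>The two cell points obtained from the tiles differ by the lattice vector with
  coordinates \<open>(y - z, v - u)\<close>. Disjointness makes this vector zero, hence also its
  coordinates.\<close>

lemma tile_unique:
  assumes B: "B \<in> bases D" and C: "C \<in> bases D" and z: "z \<in> idx B" and y: "y \<in> idx C"
    and u: "u \<in> carrier_vec r" and v: "v \<in> carrier_vec r" and x: "x \<in> carrier_vec r"
    and fB: "\<exists>\<^sub>F \<epsilon> in at_right 0. x + \<epsilon> \<cdot>\<^sub>v w \<in> translate (tile B z) (real_vec (L *\<^sub>v u))"
    and fC: "\<exists>\<^sub>F \<epsilon> in at_right 0. x + \<epsilon> \<cdot>\<^sub>v w \<in> translate (tile C y) (real_vec (L *\<^sub>v v))"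
  shows "B = C \<and> z = y \<and> u = v"
proof -
  have zc: "z \<in> carrier_vec m" "y \<in> carrier_vec m" using z y idx_carrier by auto
  let ?k = "J *\<^sub>v (y - z) + transpose_mat D *\<^sub>v (v - u)"
  have c: "y - z \<in> carrier_vec m" "v - u \<in> carrier_vec r" using zc u v by auto
  note k = lattice_vec[OF c]
  have HB: "half_open B (x - real_vec (L *\<^sub>v u) - real_vec (M *\<^sub>v z)) (real_vec z)"
    by (rule half_open_of_tile[OF B z _ x fB]) (use u in simp)
  have HC: "half_open C (x - real_vec (L *\<^sub>v v) - real_vec (M *\<^sub>v y)) (real_vec y)"
    by (rule half_open_of_tile[OF C y _ x fC]) (use v in simp)
  have e1: "x - real_vec a - real_vec b = x - real_vec a' - real_vec b' + real_vec ((b' - b) + (a' - a))"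
    if "a \<in> carrier_vec r" "b \<in> carrier_vec r" "a' \<in> carrier_vec r" "b' \<in> carrier_vec r" for a b a' b' :: "int vec"
    using that x by (intro eq_vecI) auto
  have e2: "real_vec z = real_vec y - real_vec (y - z)" using zc by (intro eq_vecI) auto
  have "B = C \<and> ?k = 0\<^sub>v n"
  proof (rule half_open_disjoint[OF B HB C HC k(1)])
    show "x - real_vec (L *\<^sub>v u) - real_vec (M *\<^sub>v z)
        = x - real_vec (L *\<^sub>v v) - real_vec (M *\<^sub>v y) + real_vec (D *\<^sub>v ?k)"
      unfolding k(2) mult_minus_distrib_mat_vec[OF M_carrier zc(2,1)] mult_minus_distrib_mat_vec[OF L_carrier v u]
      by (rule e1) (use zc u v in auto)
    show "real_vec z = real_vec y - real_vec (E *\<^sub>v ?k)" unfolding k(3) by (rule e2)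
  qed (use x v zc in auto)
  moreover from this have "y - z = 0\<^sub>v m" "v - u = 0\<^sub>v r" using lattice_vec_zero[OF c] by auto
  then have "\<forall>i<m. (y - z) $ i = 0" "\<forall>i<r. (v - u) $ i = 0" by simp_all
  then have "z = y" "u = v" using zc u v by (auto intro!: eq_vecI)
  ultimately show ?thesis by simp
qed

lemma L_zero: "real_vec (L *\<^sub>v 0\<^sub>v r) = 0\<^sub>v r"
  unfolding mult_mat_vec_zero[OF L_carrier] by (rule of_int_hom.vec_hom_zero)

lemma approachable_tile:
  assumes B: "B \<in> bases D" and z: "z \<in> idx B"
  shows "approachable r w (tile B z)"
proof -
  have "approachable r w (cols_parallelepiped Dr B)"
    using approachable_cols_parallelepiped[OF Dr basesD(1)[OF B] s[OF B]] unfolding w_eq[OF B, symmetric] .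
  then show ?thesis
    unfolding tile_def using idx_carrier[OF z] by (intro approachable_translate cell_subset[OF B] w) simp_all
qed

lemma approachable_tiles: "approachable r w tiles"
  unfolding tiles_def by (intro approachable_UN approachable_tile)

lemma tiles_meet_only_at_boundary:
  assumes B: "B \<in> bases D" and C: "C \<in> bases D" and z: "z \<in> idx B" and y: "y \<in> idx C" and distinct: "(B, z) \<noteq> (C, y)"
  shows "meet_only_at_boundary r (tile B z) (tile C y)"
proof (rule meet_only_at_boundaryI[OF tile_subset[OF B z] approachable_tile[OF B z] tile_subset[OF C y] approachable_tile[OF C y] _ w])
  fix x assume x: "x \<in> carrier_vec r" and e: "\<forall>\<^sub>F \<epsilon> in at_right 0. x + \<epsilon> \<cdot>\<^sub>v w \<in> tile B z"
    "\<forall>\<^sub>F \<epsilon> in at_right 0. x + \<epsilon> \<cdot>\<^sub>v w \<in> tile C y"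
  have "B = C \<and> z = y \<and> (0\<^sub>v r :: int vec) = 0\<^sub>v r"
    by (rule tile_unique[OF B C z y zero_carrier_vec zero_carrier_vec x];
        unfold L_zero translate_zero[OF tile_subset[OF B z]] translate_zero[OF tile_subset[OF C y]])
      (use e eventually_frequently[OF at_right_zero_neq_bot] in auto)
  with distinct show False by simp
qed

text \<open>Fixing one integer point \<open>a\<close> associated with \<open>P\<^sub>1(B)\<close>
  embeds the index set, by \<open>z\<close> going to \<open>(a, z)\<close>, into the finite set of
  integer points of the half-open cell. Finiteness is what allows a single tile to be selected from
  a union.\<close>

lemma finite_idx:
  assumes B: "B \<in> bases D"
  shows "finite (idx B)"
proof -
  \<comment> \<open>The corner of the unit cube that belongs to the half-open cube; it is mapped to
    an integer point by the integer matrix \<open>D\<close>.\<close>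
  define q :: "int vec" where "q = vec n (\<lambda>i. if 0 < s B $ i then 0 else 1)"
  have q: "q \<in> carrier_vec n" by (simp add: q_def)
  define a where "a = D *\<^sub>v restrict_vec B q"
  have a: "a \<in> carrier_vec r" using q by (simp add: a_def)
  have ra: "real_vec a = Dr *\<^sub>v restrict_vec B (real_vec q)"
    unfolding a_def restrict_vec_real using q by (simp add: real_mat_mult_real_vec[OF D])
  have "\<forall>\<^sub>F \<epsilon> in at_right 0. \<forall>i\<in>{..<n}. 0 < real_vec q $ i + \<epsilon> * s B $ i \<and> real_vec q $ i + \<epsilon> * s B $ i < 1"
    by (intro eventually_ball_finite ballI half_unit_eventually)
      (use s_nonzero[OF B] in \<open>auto simp: q_def half_unit_def\<close>)
  then have ev: "\<forall>\<^sub>F \<epsilon> in at_right 0. real_vec a + \<epsilon> \<cdot>\<^sub>v w \<in> cols_parallelepiped Dr B"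
  proof (rule eventually_mono)
    fix \<epsilon> assume *: "\<forall>i\<in>{..<n}. 0 < real_vec q $ i + \<epsilon> * s B $ i \<and> real_vec q $ i + \<epsilon> * s B $ i < 1"
    have "0 \<le> (real_vec q + \<epsilon> \<cdot>\<^sub>v s B) $ i \<and> (real_vec q + \<epsilon> \<cdot>\<^sub>v s B) $ i \<le> 1" if "i < n" for i
      using *[rule_format, of i] that s[OF B] q by simp
    moreover have "real_vec q + \<epsilon> \<cdot>\<^sub>v s B \<in> carrier_vec n" using q s[OF B] by simp
    moreover have "real_vec a + \<epsilon> \<cdot>\<^sub>v w = Dr *\<^sub>v restrict_vec B (real_vec q + \<epsilon> \<cdot>\<^sub>v s B)"
      unfolding ra by (rule line_eq(1)[OF B]) (use q in simp)
    ultimately show "real_vec a + \<epsilon> \<cdot>\<^sub>v w \<in> cols_parallelepiped Dr B"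
      unfolding mem_P1_iff[OF basesD(1)[OF B]] by blast
  qed
  have "half_open B (real_vec a) (real_vec z)" if "z \<in> idx B" for z
    by (rule half_openI[OF B _ _ eventually_frequently[OF at_right_zero_neq_bot ev]]) (use that a in \<open>auto simp: idx_def\<close>)
  then have "a @\<^sub>v z \<in> half_open_points (0\<^sub>v r) (0\<^sub>v m) B" if "z \<in> idx B" for z
    using that append_carrier[OF a idx_carrier[OF that]] a idx_carrier[OF that]
    by (simp add: half_open_points_def)
  then have "(\<lambda>z. a @\<^sub>v z) ` idx B \<subseteq> half_open_points (0\<^sub>v r) (0\<^sub>v m) B" by blast
  then have "finite ((\<lambda>z. a @\<^sub>v z) ` idx B)"
    using half_open_points_card(1)[OF B] by (meson finite_subset zero_carrier_vec)
  moreover have "inj_on (\<lambda>z. a @\<^sub>v z) (idx B)" using append_vec_eq[OF a a] by (auto simp: inj_on_def)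
  ultimately show ?thesis by (rule finite_imageD)
qed

text \<open>Along the ray the tile may depend on \<open>\<epsilon>\<close>. As there are finitely
  many, one of them is met for arbitrarily small \<open>\<epsilon>\<close>, which suffices for
  \<open>half_open_of_tile\<close>.\<close>

lemma frequently_tile_of_tiles:
  assumes "\<exists>\<^sub>F \<epsilon> in at_right 0. x + \<epsilon> \<cdot>\<^sub>v w \<in> translate tiles t"
  obtains B z where "B \<in> bases D" "z \<in> idx B" "\<exists>\<^sub>F \<epsilon> in at_right 0. x + \<epsilon> \<cdot>\<^sub>v w \<in> translate (tile B z) t"
proof -
  have "\<exists>\<^sub>F \<epsilon> in at_right 0. \<exists>B\<in>bases D. \<exists>z\<in>idx B. x + \<epsilon> \<cdot>\<^sub>v w \<in> translate (tile B z) t"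
    using assms by (simp add: tiles_def translate_UN)
  from frequently_bex_finite[OF finite_bases this] obtain B where B: "B \<in> bases D" "\<exists>\<^sub>F \<epsilon> in at_right 0. \<exists>z\<in>idx B. x + \<epsilon> \<cdot>\<^sub>v w \<in> translate (tile B z) t"
    by blast
  from frequently_bex_finite[OF finite_idx[OF B(1)] B(2)] B(1) show ?thesis using that by blast
qed

lemma tiles_translates_meet_only_at_boundary:
  assumes u: "u \<in> carrier_vec r" and v: "v \<in> carrier_vec r" and uv: "u \<noteq> v"
  shows "meet_only_at_boundary r (translate tiles (real_vec (L *\<^sub>v u))) (translate tiles (real_vec (L *\<^sub>v v)))"
proof -
  have c: "real_vec (L *\<^sub>v u) \<in> carrier_vec r" "real_vec (L *\<^sub>v v) \<in> carrier_vec r" using u v by simp_all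
  show ?thesis
  proof (rule meet_only_at_boundaryI[OF translate_subset[OF tiles_subset c(1)]
        approachable_translate[OF approachable_tiles tiles_subset c(1) w]
        translate_subset[OF tiles_subset c(2)] approachable_translate[OF approachable_tiles tiles_subset c(2) w] _ w])
    fix x assume x: "x \<in> carrier_vec r"
      and e: "\<forall>\<^sub>F \<epsilon> in at_right 0. x + \<epsilon> \<cdot>\<^sub>v w \<in> translate tiles (real_vec (L *\<^sub>v u))"
        "\<forall>\<^sub>F \<epsilon> in at_right 0. x + \<epsilon> \<cdot>\<^sub>v w \<in> translate tiles (real_vec (L *\<^sub>v v))"
    obtain B z where B: "B \<in> bases D" "z \<in> idx B"
      "\<exists>\<^sub>F \<epsilon> in at_right 0. x + \<epsilon> \<cdot>\<^sub>v w \<in> translate (tile B z) (real_vec (L *\<^sub>v u))"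
      using frequently_tile_of_tiles[OF eventually_frequently[OF at_right_zero_neq_bot e(1)]] by blast
    obtain C y where C: "C \<in> bases D" "y \<in> idx C"
      "\<exists>\<^sub>F \<epsilon> in at_right 0. x + \<epsilon> \<cdot>\<^sub>v w \<in> translate (tile C y) (real_vec (L *\<^sub>v v))"
      using frequently_tile_of_tiles[OF eventually_frequently[OF at_right_zero_neq_bot e(2)]] by blast
    show False using tile_unique[OF B(1) C(1) B(2) C(2) u v x B(3) C(3)] uv by blast
  qed
qed

lemma tiles_translates_cover:
  "(\<Union>u\<in>carrier_vec r. translate tiles (real_vec (L *\<^sub>v u))) = carrier_vec r"
proof
  show "(\<Union>u\<in>carrier_vec r. translate tiles (real_vec (L *\<^sub>v u))) \<subseteq> carrier_vec r"
    by (intro UN_least translate_subset[OF tiles_subset]) simp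
  show "carrier_vec r \<subseteq> (\<Union>u\<in>carrier_vec r. translate tiles (real_vec (L *\<^sub>v u)))"
  proof
    fix p :: "real vec" assume p: "p \<in> carrier_vec r"
    \<comment> \<open>The covering is applied to the point \<open>(p, 0)\<close>, so that the second
      factor of the cell point is the integer vector \<open>E *\<^sub>v k\<close>, the index of the
      tile.\<close>
    obtain B k where B: "B \<in> bases D" and k: "k \<in> carrier_vec n"
      and h: "half_open B (p - real_vec (D *\<^sub>v k)) (0\<^sub>v m + real_vec (E *\<^sub>v k))"
      using half_open_cover[OF p zero_carrier_vec] by blast
    define z where "z = E *\<^sub>v k"
    define u where "u = transpose_mat K *\<^sub>v k"
    have z: "z \<in> carrier_vec m" using k by (simp add: z_def)
    have u: "u \<in> carrier_vec r" using K k by (auto simp: u_def intro: mult_mat_vec_carrier)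
    have "0\<^sub>v m + real_vec z = real_vec z" using z by simp
    then have zi: "z \<in> idx B" using half_open_associated(2)[OF B h] z by (simp add: idx_def z_def[symmetric])
    have Dk: "D *\<^sub>v k = M *\<^sub>v z + L *\<^sub>v u" unfolding z_def u_def by (rule lattice_vec_surj[OF k])
    have e: "p - real_vec (a + b) = p - real_vec b - real_vec a"
      if "a \<in> carrier_vec r" "b \<in> carrier_vec r" for a b :: "int vec"
      using that p by (intro eq_vecI) auto
    have "p - real_vec (L *\<^sub>v u) - real_vec (M *\<^sub>v z) \<in> cols_parallelepiped Dr B"
      using half_open_closed[OF B h] unfolding Dk e[OF M_vec[OF z] L_vec[OF u]] .
    then have "p - real_vec (L *\<^sub>v u) \<in> tile B z"
      using mem_tile_iff[OF B zi] p u by simp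
    then have "p - real_vec (L *\<^sub>v u) \<in> tiles" using B zi by (auto simp: tiles_def)
    then have "p \<in> translate tiles (real_vec (L *\<^sub>v u))"
      using mem_translate_iff[OF tiles_subset _ p] u by simp
    with u show "p \<in> (\<Union>u\<in>carrier_vec r. translate tiles (real_vec (L *\<^sub>v u)))" by blast
  qed
qed

text \<open>The integer points \<open>(a, z)\<close> of the half-open cell correspond to the points
  counted here by \<open>a + M z\<close>, so there are \<open>\<bar>det (Q B)\<bar>\<close> of them.
  Injectivity is uniqueness of the tile.\<close>

lemma tile_points_card:
  assumes B: "B \<in> bases D"
  shows "card {y :: int vec. y \<in> carrier_vec r \<and> real_vec y \<in> tiles \<and>
      (\<forall>\<^sub>F \<epsilon> in at_right 0. \<exists>z\<in>idx B. real_vec y + \<epsilon> \<cdot>\<^sub>v w \<in> tile B z)} = (multiplicity_of D B)\<^sup>2"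
    (is "card ?Y = _")
proof -
  let ?H = "half_open_points (0\<^sub>v r) (0\<^sub>v m) B"
  define f where "f p = vec_first p r + M *\<^sub>v vec_last p m" for p :: "int vec"
  have H: "p \<in> carrier_vec n \<and> half_open B (real_vec (vec_first p r)) (real_vec (vec_last p m))" if "p \<in> ?H" for p
    using that by (simp add: half_open_points_def)
  have shift: "real_vec (f p) + a - real_vec (M *\<^sub>v vec_last p m) = real_vec (vec_first p r) + a"
    if "a \<in> carrier_vec r" for p a
  proof -
    have "real_vec (b + c) + a - real_vec c = real_vec b + a"
      if "b \<in> carrier_vec r" "c \<in> carrier_vec r" for b c :: "int vec"
      using that \<open>a \<in> carrier_vec r\<close> by (intro eq_vecI) auto
    then show ?thesis by (simp add: f_def)
  qed
  have fc: "f p \<in> carrier_vec r" for p by (simp add: f_def)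
  have idx: "vec_last p m \<in> idx B" if "p \<in> ?H" for p
    using half_open_associated(2)[OF B] H[OF that] by (auto simp: idx_def)
  have ev: "\<forall>\<^sub>F \<epsilon> in at_right 0. real_vec (f p) + \<epsilon> \<cdot>\<^sub>v w \<in> tile B (vec_last p m)" if "p \<in> ?H" for p
  proof -
    have "\<forall>\<^sub>F \<epsilon> in at_right 0. real_vec (vec_first p r) + \<epsilon> \<cdot>\<^sub>v w \<in> cols_parallelepiped Dr B"
      using half_open_associated(1)[OF B] H[OF that] by (auto simp: associated_def)
    then show ?thesis
      by (rule eventually_mono) (use mem_tile_iff[OF B idx[OF that]] fc w shift in simp)
  qed
  have inj: "inj_on f ?H"
  proof (rule inj_onI)
    fix p p' assume p: "p \<in> ?H" "p' \<in> ?H" "f p = f p'"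
    have "\<exists>\<^sub>F \<epsilon> in at_right 0. real_vec (f p) + \<epsilon> \<cdot>\<^sub>v w \<in> translate (tile B (vec_last q m)) (real_vec (L *\<^sub>v 0\<^sub>v r))"
      if "q \<in> {p, p'}" for q
      unfolding L_zero using that eventually_frequently[OF at_right_zero_neq_bot ev[of q]] p
        translate_zero[OF tile_subset[OF B idx[of q]]] by auto
    then have l: "vec_last p m = vec_last p' m"
      using tile_unique[OF B B idx[OF p(1)] idx[OF p(2)] zero_carrier_vec zero_carrier_vec, of "real_vec (f p)"] fc
      by auto
    have "vec_first p r = vec_first p' r"
    proof -
      have cancel: "a = b" if "a + c = b + c" "a \<in> carrier_vec r" "b \<in> carrier_vec r" "c \<in> carrier_vec r" for a b c :: "int vec"
        by (metis carrier_vec_cancel(2) that)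
      have "vec_first p r + M *\<^sub>v vec_last p' m = vec_first p' r + M *\<^sub>v vec_last p' m"
        using p(3) unfolding f_def l .
      then show ?thesis by (rule cancel) simp_all
    qed
    with l show "p = p'"
      using H[OF p(1)] H[OF p(2)] vec_first_last_append[of p r m] vec_first_last_append[of p' r m] n by metis
  qed
  have "f ` ?H = ?Y"
  proof
    show "f ` ?H \<subseteq> ?Y"
    proof (rule image_subsetI)
      fix p assume p: "p \<in> ?H"
      have "real_vec (f p) \<in> tile B (vec_last p m)"
      proof -
        have "real_vec (f p) + 0\<^sub>v r - real_vec (M *\<^sub>v vec_last p m) = real_vec (vec_first p r) + 0\<^sub>v r"
          by (rule shift) simp
        then have "real_vec (f p) - real_vec (M *\<^sub>v vec_last p m) = real_vec (vec_first p r)"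
          using fc[of p] by simp
        then show ?thesis using mem_tile_iff[OF B idx[OF p]] half_open_closed[OF B] H[OF p] fc by auto
      qed
      then have "real_vec (f p) \<in> tiles" using B idx[OF p] by (auto simp: tiles_def)
      moreover have "\<forall>\<^sub>F \<epsilon> in at_right 0. \<exists>z\<in>idx B. real_vec (f p) + \<epsilon> \<cdot>\<^sub>v w \<in> tile B z"
        using ev[OF p] by (rule eventually_mono) (use idx[OF p] in blast)
      ultimately show "f p \<in> ?Y" using fc by simp
    qed
    show "?Y \<subseteq> f ` ?H"
    proof
      fix y assume y: "y \<in> ?Y"
      then have yc: "y \<in> carrier_vec r" by simp
      from y have "\<exists>\<^sub>F \<epsilon> in at_right 0. \<exists>z\<in>idx B. real_vec y + \<epsilon> \<cdot>\<^sub>v w \<in> tile B z"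
        using eventually_frequently[OF at_right_zero_neq_bot] by simp
      from frequently_bex_finite[OF finite_idx[OF B] this] obtain z
        where z: "z \<in> idx B" "\<exists>\<^sub>F \<epsilon> in at_right 0. real_vec y + \<epsilon> \<cdot>\<^sub>v w \<in> tile B z"
        by blast
      have zc: "z \<in> carrier_vec m" by (rule idx_carrier[OF z(1)])
      have "half_open B (real_vec y - 0\<^sub>v r - real_vec (M *\<^sub>v z)) (real_vec z)"
        by (rule half_open_of_tile[OF B z(1)]) (use z(2) yc translate_zero[OF tile_subset[OF B z(1)]] in auto)
      moreover have "real_vec y - 0\<^sub>v r - real_vec a = real_vec (y - a)" if "a \<in> carrier_vec r" for a
        using yc that by (intro eq_vecI) auto
      ultimately have h: "half_open B (real_vec (y - M *\<^sub>v z)) (real_vec z)" using zc by simp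
      have a: "y - M *\<^sub>v z \<in> carrier_vec r" using yc zc by simp
      have "(y - M *\<^sub>v z) @\<^sub>v z \<in> ?H" using h append_carrier[OF a zc] a zc by (simp add: half_open_points_def)
      moreover have "f ((y - M *\<^sub>v z) @\<^sub>v z) = y"
        using a zc carrier_vec_cancel(1)[OF yc M_vec[OF zc]] by (simp add: f_def)
      ultimately show "y \<in> f ` ?H" by force
    qed
  qed
  then have "card ?Y = card ?H" using card_image[OF inj] by simp
  also have "\<dots> = (multiplicity_of D B)\<^sup>2"
    using half_open_points_card(2)[OF B] abs_det_Q[OF B] by (simp add: nat_power_eq)
  finally show ?thesis .
qed

end

section \<open>Facets and shifting vectors\<close>

text \<open>\<open>g\<close> is row \<open>i\<close> of the inverse matrix, written with the
  adjugate.\<close>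

lemma invertible_coordinate_functional:
  assumes A: "(A :: real mat) \<in> carrier_mat k k" and d: "det A \<noteq> 0" and i: "i < k"
  obtains g where "g \<in> carrier_vec k" "\<And>c. c \<in> carrier_vec k \<Longrightarrow> g \<bullet> (A *\<^sub>v c) = c $ i"
proof -
  let ?g = "(1 / det A) \<cdot>\<^sub>v row (adj_mat A) i"
  note adj = adj_mat[OF A]
  have g: "?g \<in> carrier_vec k" using adj(1) by auto
  have "?g \<bullet> (A *\<^sub>v c) = c $ i" if c: "c \<in> carrier_vec k" for c
  proof -
    have Ac: "A *\<^sub>v c \<in> carrier_vec k" using A c by auto
    have rc: "row (adj_mat A) i \<in> carrier_vec k" using adj(1) i by auto
    have "row (adj_mat A) i \<bullet> (A *\<^sub>v c) = (adj_mat A *\<^sub>v (A *\<^sub>v c)) $ i"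
      using adj(1) i by simp
    also have "adj_mat A *\<^sub>v (A *\<^sub>v c) = (adj_mat A * A) *\<^sub>v c"
      by (rule assoc_mult_mat_vec[OF adj(1) A c, symmetric])
    also have "\<dots> $ i = det A * c $ i"
      unfolding adj(3) using i c
      by (simp add: smult_scalar_prod_distrib[of _ k] scalar_prod_left_unit)
    finally show ?thesis
      using smult_scalar_prod_distrib[OF rc Ac, of "1 / det A"] d by simp
  qed
  with g show ?thesis by (rule that)
qed

text \<open>One facet for each index \<open>i\<close> suffices later, since the opposite facet
  \<open>c $ i = 1\<close> has the same direction. For maximality, a face containing
  \<open>F\<close> is given by a functional that vanishes on all edge vectors except possibly the
  \<open>i\<close>-th.\<close>

lemma parallelepiped_facet:
  assumes A: "(A :: real mat) \<in> carrier_mat k k" and d: "det A \<noteq> 0" and i: "i < k"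
  defines "P \<equiv> {A *\<^sub>v c | c. c \<in> carrier_vec k \<and> (\<forall>j<k. 0 \<le> c $ j \<and> c $ j \<le> 1)}"
    and "F \<equiv> {A *\<^sub>v c | c. c \<in> carrier_vec k \<and> (\<forall>j<k. 0 \<le> c $ j \<and> c $ j \<le> 1) \<and> c $ i = 0}"
  shows "polytope_facet k F P"
proof -
  obtain g where g: "g \<in> carrier_vec k" "\<And>c. c \<in> carrier_vec k \<Longrightarrow> g \<bullet> (A *\<^sub>v c) = c $ i"
    using invertible_coordinate_functional[OF A d i] by blast
  have neg: "(- g) \<bullet> (A *\<^sub>v c) = - (c $ i)" if "c \<in> carrier_vec k" for c
    using g that A by (subst uminus_scalar_prod[symmetric]) auto
  have face: "polytope_face k F P"
    unfolding polytope_face_def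
  proof (intro bexI exI conjI)
    show "- g \<in> carrier_vec k" using g by simp
    show "\<forall>x\<in>P. scalar_prod (- g) x \<le> 0" using neg i by (auto simp: P_def)
    show "F = {x \<in> P. scalar_prod (- g) x = 0}" using neg by (auto simp: P_def F_def)
  qed
  have zF: "A *\<^sub>v 0\<^sub>v k \<in> F" using i by (auto simp: F_def intro!: exI[of _ "0\<^sub>v k"])
  have uF: "A *\<^sub>v unit_vec k j \<in> F" if "j < k" "j \<noteq> i" for j
    using that i unfolding F_def by (intro CollectI exI[of _ "unit_vec k j"]) (auto simp: unit_vec_def)
  have uP: "A *\<^sub>v unit_vec k i \<in> P"
    using i unfolding P_def by (intro CollectI exI[of _ "unit_vec k i"]) (auto simp: unit_vec_def)
  have "A *\<^sub>v unit_vec k i \<notin> F"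
  proof
    assume "A *\<^sub>v unit_vec k i \<in> F"
    then obtain c where "c \<in> carrier_vec k" "c $ i = 0" "A *\<^sub>v unit_vec k i = A *\<^sub>v c" by (auto simp: F_def)
    then have "unit_vec k i $ i = c $ i" using g(2)[of "unit_vec k i"] g(2)[of c] by simp
    then show False using i \<open>c $ i = 0\<close> by simp
  qed
  with uP have ne: "F \<noteq> P" by blast
  have max: "G = F" if G: "polytope_face k G P" "F \<subseteq> G" "G \<noteq> P" for G
  proof -
    obtain h b where h: "h \<in> carrier_vec k" and G_eq: "G = {x \<in> P. scalar_prod h x = b}"
      using G(1) by (auto simp: polytope_face_def)
    \<comment> \<open>The functional in the coordinates \<open>c\<close>. Evaluation at 0 and at the
      unit vectors other than the \<open>i\<close>-th reduces it to \<open>l $ i * c $ i\<close>;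
      then \<open>l $ i = 0\<close> would give \<open>G = P\<close>.\<close>
    define l where "l = transpose_mat A *\<^sub>v h"
    have l: "l \<in> carrier_vec k" using A h by (auto simp: l_def)
    have hl: "h \<bullet> (A *\<^sub>v c) = l \<bullet> c" if "c \<in> carrier_vec k" for c
      unfolding l_def by (rule transpose_vec_mult_scalar[OF A that h, symmetric])
    have "h \<bullet> (A *\<^sub>v 0\<^sub>v k) = b" using zF G(2) G_eq by auto
    then have b: "b = 0" using hl[of "0\<^sub>v k"] l by simp
    have lj: "l $ j = 0" if "j < k" "j \<noteq> i" for j
    proof -
      have "h \<bullet> (A *\<^sub>v unit_vec k j) = b" using uF[OF that] G(2) G_eq by auto
      then show ?thesis using hl[of "unit_vec k j"] l b that by simp
    qed
    have lc: "l \<bullet> c = l $ i * c $ i" if "c \<in> carrier_vec k" for c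
    proof -
      have "l \<bullet> c = (\<Sum>j\<in>{0..<k}. l $ j * c $ j)" using that by (simp add: scalar_prod_def)
      also have "\<dots> = (\<Sum>j\<in>{i}. l $ j * c $ j)" using lj i by (intro sum.mono_neutral_right) auto
      finally show ?thesis by simp
    qed
    have G2: "G = {A *\<^sub>v c | c. c \<in> carrier_vec k \<and> (\<forall>j<k. 0 \<le> c $ j \<and> c $ j \<le> 1) \<and> l $ i * c $ i = 0}"
      unfolding G_eq P_def b using hl lc by auto
    have "l $ i \<noteq> 0"
    proof
      assume "l $ i = 0"
      then have "G = P" unfolding G2 P_def by simp
      with G(3) show False ..
    qed
    then show "G = F" unfolding G2 F_def by simp
  qed
  show ?thesis unfolding polytope_facet_def using face zF ne max by blast
qed

text \<open>The positive and the negative part of \<open>c\<close>, scaled down into the unit cube,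
  are coordinates of two points of \<open>F\<close> whose difference is a multiple of
  \<open>A *\<^sub>v c\<close>.\<close>

lemma parallel_subspace_parallelepiped_facet:
  assumes A: "(A :: real mat) \<in> carrier_mat k k" and c: "c \<in> carrier_vec k" and ci: "c $ i = 0" and i: "i < k"
  defines "F \<equiv> {A *\<^sub>v c | c. c \<in> carrier_vec k \<and> (\<forall>j<k. 0 \<le> c $ j \<and> c $ j \<le> 1) \<and> c $ i = 0}"
  shows "A *\<^sub>v c \<in> parallel_subspace k F"
proof -
  interpret V: vec_space "TYPE(real)" k .
  let ?S = "{x - y | x y. x \<in> F \<and> y \<in> F}"
  have S: "?S \<subseteq> carrier_vec k" using A by (auto simp: F_def)
  \<comment> \<open>At least every \<open>\<bar>c $ j\<bar>\<close>, and positive even for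
    \<open>c = 0\<close>, so that division by it is safe.\<close>
  define T where "T = 1 + (\<Sum>j<k. \<bar>c $ j\<bar>)"
  have T: "1 \<le> T" by (simp add: T_def sum_nonneg)
  have cT: "\<bar>c $ j\<bar> \<le> T" if "j < k" for j
    using member_le_sum[of j "{..<k}" "\<lambda>j. \<bar>c $ j\<bar>"] that by (simp add: T_def)
  define a where "a = vec k (\<lambda>j. max (c $ j) 0 / T)"
  define b where "b = vec k (\<lambda>j. max (- (c $ j)) 0 / T)"
  have ab: "a \<in> carrier_vec k" "b \<in> carrier_vec k" by (simp_all add: a_def b_def)
  have "0 \<le> a $ j \<and> a $ j \<le> 1" "0 \<le> b $ j \<and> b $ j \<le> 1" if "j < k" for j
    using cT[OF that] T that by (auto simp: a_def b_def)
  moreover have "a $ i = 0" "b $ i = 0" using i ci by (simp_all add: a_def b_def)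
  ultimately have "A *\<^sub>v a \<in> F" "A *\<^sub>v b \<in> F" using ab by (auto simp: F_def)
  then have "A *\<^sub>v a - A *\<^sub>v b \<in> ?S" by blast
  then have "A *\<^sub>v a - A *\<^sub>v b \<in> V.span ?S" using V.in_own_span[OF S] by blast
  then have "T \<cdot>\<^sub>v (A *\<^sub>v a - A *\<^sub>v b) \<in> V.span ?S" by (rule V.smult_in_span[OF S])
  moreover have "A *\<^sub>v c = T \<cdot>\<^sub>v (A *\<^sub>v a - A *\<^sub>v b)"
  proof -
    have "c = T \<cdot>\<^sub>v (a - b)"
    proof (rule eq_vecI)
      fix j assume "j < dim_vec (T \<cdot>\<^sub>v (a - b))"
      then have j: "j < k" using ab by simp
      have "T * (max (c $ j) 0 / T - max (- (c $ j)) 0 / T) = c $ j"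
        using T by (simp add: field_simps max_def)
      then show "c $ j = (T \<cdot>\<^sub>v (a - b)) $ j" using j by (simp add: a_def b_def)
    qed (use c ab in simp)
    then have "A *\<^sub>v c = A *\<^sub>v (T \<cdot>\<^sub>v (a - b))" by simp
    also have "\<dots> = T \<cdot>\<^sub>v (A *\<^sub>v (a - b))" by (rule mult_mat_vec[OF A]) (use ab in simp)
    also have "A *\<^sub>v (a - b) = A *\<^sub>v a - A *\<^sub>v b" by (rule mult_minus_distrib_mat_vec[OF A ab])
    finally show ?thesis .
  qed
  ultimately show ?thesis unfolding parallel_subspace_def by simp
qed

context dual_pair
begin

text \<open>Presents \<open>P(B)\<close> as the image of the unit cube under one invertible matrix,
  the form in which its facets were determined.\<close>

lemma product_cell_eq:
  assumes B: "B \<subseteq> {..<n}"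
  shows "{x @\<^sub>v y | x y. x \<in> cols_parallelepiped Dr B \<and> y \<in> cols_parallelepiped Er ({..<n} - B)}
    = {real_mat (Q B) *\<^sub>v c | c. c \<in> carrier_vec n \<and> (\<forall>j<n. 0 \<le> c $ j \<and> c $ j \<le> 1)}" (is "?L = ?R")
proof
  show "?R \<subseteq> ?L"
    unfolding mem_P1_iff[OF B] mem_P2_iff using Qr_mult by blast
  show "?L \<subseteq> ?R"
  proof
    fix p assume "p \<in> ?L"
    then obtain d e where d: "d \<in> carrier_vec n" "\<forall>j<n. 0 \<le> d $ j \<and> d $ j \<le> 1"
      and e: "e \<in> carrier_vec n" "\<forall>j<n. 0 \<le> e $ j \<and> e $ j \<le> 1"
      and p: "p = (Dr *\<^sub>v restrict_vec B d) @\<^sub>v (Er *\<^sub>v restrict_vec (- B) e)"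
      unfolding mem_P1_iff[OF B] mem_P2_iff by blast
    define f where "f = vec n (\<lambda>i. if i \<in> B then d $ i else e $ i)"
    have f: "f \<in> carrier_vec n" "\<forall>j<n. 0 \<le> f $ j \<and> f $ j \<le> 1" using d e by (simp_all add: f_def)
    have rf: "restrict_vec B f = restrict_vec B d" "restrict_vec (- B) f = restrict_vec (- B) e"
      using d(1) e(1) by (auto simp: f_def intro!: eq_vecI)
    have "p = real_mat (Q B) *\<^sub>v f" unfolding p Qr_mult[OF f(1)] rf ..
    with f show "p \<in> ?R" by blast
  qed
qed

text \<open>If the \<open>i\<close>-th coordinate of \<open>(w, w')\<close> with respect to
  \<open>Q B\<close> vanished, the vector would lie in the direction space of the facet
  \<open>c $ i = 0\<close>.\<close>

lemma shifted_dual_pair_of_generic: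
  assumes w: "w \<in> carrier_vec r" and w': "w' \<in> carrier_vec m"
    and generic: "\<And>B F. B \<in> bases D \<Longrightarrow>
      polytope_facet n F {x @\<^sub>v y | x y. x \<in> cols_parallelepiped Dr B \<and> y \<in> cols_parallelepiped Er ({..<n} - B)} \<Longrightarrow>
      w @\<^sub>v w' \<notin> parallel_subspace n F"
  shows "\<exists>s. shifted_dual_pair r m n D E K J w w' s"
proof -
  have "\<exists>c. B \<in> bases D \<longrightarrow> c \<in> carrier_vec n \<and> (\<forall>i<n. c $ i \<noteq> 0) \<and>
      w = Dr *\<^sub>v restrict_vec B c \<and> w' = Er *\<^sub>v restrict_vec (- B) c" for B
  proof (cases "B \<in> bases D")
    case B: True
    obtain c where c: "c \<in> carrier_vec n" "w = Dr *\<^sub>v restrict_vec B c" "w' = Er *\<^sub>v restrict_vec (- B) c"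
      using coords_exist[OF B w w'] by blast
    have "c $ i \<noteq> 0" if i: "i < n" for i
    proof
      assume ci: "c $ i = 0"
      have Qc: "real_mat (Q B) \<in> carrier_mat n n" by simp
      have d: "det (real_mat (Q B)) \<noteq> 0" using B bases_iff by simp
      have "w @\<^sub>v w' = real_mat (Q B) *\<^sub>v c" using c by (simp add: Qr_mult)
      then show False
        using generic[OF B, unfolded product_cell_eq[OF basesD(1)[OF B]], OF parallelepiped_facet[OF Qc d i]]
          parallel_subspace_parallelepiped_facet[OF Qc c(1) ci i] by simp
    qed
    with c show ?thesis by blast
  qed simp
  then obtain s where "\<And>B. B \<in> bases D \<Longrightarrow> s B \<in> carrier_vec n \<and> (\<forall>i<n. s B $ i \<noteq> 0) \<and>
      w = Dr *\<^sub>v restrict_vec B (s B) \<and> w' = Er *\<^sub>v restrict_vec (- B) (s B)" by metis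
  then have "shifted_dual_pair r m n D E K J w w' s"
    by unfold_locales (use w w' in auto)
  then show ?thesis by blast
qed

end

section \<open>Duality of shifted pairs and the standard matrices\<close>

lemma (in shifted_dual_pair) shifted_dual:
  "shifted_dual_pair m r n E D J K w' w (\<lambda>C. s ({..<n} - C))"
proof -
  interpret dual: dual_pair m r n E D J K by (rule dual)
  show ?thesis
  proof
    fix C assume C: "C \<in> bases E"
    have B: "{..<n} - C \<in> bases D" by (rule dual.bases_complement(1)[OF C])
    show "s ({..<n} - C) \<in> carrier_vec n" by (rule s[OF B])
    show "s ({..<n} - C) $ i \<noteq> 0" if "i < n" for i by (rule s_nonzero[OF B that])
    have "restrict_vec C (s ({..<n} - C)) = restrict_vec (- ({..<n} - C)) (s ({..<n} - C))"
      "restrict_vec (- C) (s ({..<n} - C)) = restrict_vec ({..<n} - C) (s ({..<n} - C))"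
      by (rule restrict_vec_cong[OF s[OF B]]; auto)+
    then show "w' = Er *\<^sub>v restrict_vec C (s ({..<n} - C))" "w = Dr *\<^sub>v restrict_vec (- C) (s ({..<n} - C))"
      using w_eq[OF B] w'_eq[OF B] by simp_all
  qed (use w w' in auto)
qed

text \<open>\<open>K\<close> and \<open>J\<close> are the inclusions of the first \<open>r\<close>
  and of the last \<open>m\<close> coordinates. In the decomposition of the identity, the block
  \<open>M\<close> of \<open>K D\<close> cancels against the block \<open>-M\<close> of
  \<open>E\<^sup>T J\<^sup>T\<close>.\<close>

lemma std_dual_pair:
  assumes M: "M \<in> carrier_mat r m"
  defines "K \<equiv> four_block_mat (1\<^sub>m r) (0\<^sub>m r 0) (0\<^sub>m m r) (0\<^sub>m m 0)"
    and "J \<equiv> four_block_mat (0\<^sub>m r m) (0\<^sub>m r 0) (1\<^sub>m m) (0\<^sub>m m 0)"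
  shows "dual_pair r m (r + m) (std_mat M) (std_mat_hat M) K J"
    and "std_mat M * J = M" and "std_mat_hat M * K = - transpose_mat M"
proof -
  let ?E = "- transpose_mat M"
  have Mt: "?E \<in> carrier_mat m r" "transpose_mat M \<in> carrier_mat m r" using M by auto
  have D_def: "std_mat M = four_block_mat (1\<^sub>m r) M (0\<^sub>m 0 r) (0\<^sub>m 0 m)"
    using M by (simp add: std_mat_def append_cols_def)
  have E_def: "std_mat_hat M = four_block_mat ?E (1\<^sub>m m) (0\<^sub>m 0 r) (0\<^sub>m 0 m)"
    using M by (simp add: std_mat_hat_def append_cols_def)
  have block: "four_block_mat X (0\<^sub>m k 0) (0\<^sub>m 0 l) (0\<^sub>m 0 0) = X" if "X \<in> carrier_mat k l" for X :: "int mat" and k l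
    using that by (intro eq_matI) auto
  have Dt: "transpose_mat (std_mat M) = four_block_mat (1\<^sub>m r) (0\<^sub>m r 0) (transpose_mat M) (0\<^sub>m m 0)"
    unfolding D_def using M by (subst transpose_four_block_mat[of _ r r _ m _ 0]) auto
  have Et: "transpose_mat (std_mat_hat M) = four_block_mat (- M) (0\<^sub>m r 0) (1\<^sub>m m) (0\<^sub>m m 0)"
    unfolding E_def using M Mt by (subst transpose_four_block_mat[of _ m r _ m _ 0]) (auto simp: transpose_uminus)
  have Jt: "transpose_mat J = four_block_mat (0\<^sub>m m r) (1\<^sub>m m) (0\<^sub>m 0 r) (0\<^sub>m 0 m)"
    unfolding J_def by (subst transpose_four_block_mat[of _ r m _ 0 _ m]) auto
  have DJ: "std_mat M * J = M"
    unfolding D_def J_def by (subst mult_four_block_mat[of _ r r _ m _ 0 _ _ m _ 0]) (use M in \<open>auto simp: block\<close>)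
  then show "std_mat M * J = M" .
  have EK: "std_mat_hat M * K = ?E"
    unfolding E_def K_def by (subst mult_four_block_mat[of _ m r _ m _ 0 _ _ r _ 0]) (use M Mt in \<open>auto simp: block\<close>)
  then show "std_mat_hat M * K = ?E" .
  show "dual_pair r m (r + m) (std_mat M) (std_mat_hat M) K J"
  proof
    show "std_mat M \<in> carrier_mat r (r + m)" unfolding D_def using M by (metis add.right_neutral four_block_carrier_mat one_carrier_mat zero_carrier_mat)
    show "std_mat_hat M \<in> carrier_mat m (r + m)" unfolding E_def using Mt by (metis add.right_neutral four_block_carrier_mat zero_carrier_mat)
    show "K \<in> carrier_mat (r + m) r" unfolding K_def by (metis add.right_neutral four_block_carrier_mat one_carrier_mat zero_carrier_mat)
    show "J \<in> carrier_mat (r + m) m" unfolding J_def by (metis add.right_neutral four_block_carrier_mat zero_carrier_mat)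
    show "std_mat M * K = 1\<^sub>m r"
      unfolding D_def K_def by (subst mult_four_block_mat[of _ r r _ m _ 0 _ _ r _ 0]) (use M in \<open>auto simp: block\<close>)
    show "std_mat_hat M * J = 1\<^sub>m m"
      unfolding E_def J_def by (subst mult_four_block_mat[of _ m r _ m _ 0 _ _ m _ 0]) (use M Mt in \<open>auto simp: block\<close>)
    show "std_mat_hat M * transpose_mat (std_mat M) = 0\<^sub>m m r"
      unfolding Dt unfolding E_def
      by (subst mult_four_block_mat[of _ m r _ m _ 0 _ _ r _ 0]) (use M Mt in \<open>auto simp: block uminus_l_inv_mat\<close>)
    have KD: "K * std_mat M = four_block_mat (1\<^sub>m r) M (0\<^sub>m m r) (0\<^sub>m m m)"
      unfolding K_def D_def by (subst mult_four_block_mat[of _ r r _ 0 _ m _ _ r _ m]) (use M in auto)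
    have EJ: "transpose_mat (std_mat_hat M) * transpose_mat J = four_block_mat (0\<^sub>m r r) (- M) (0\<^sub>m m r) (1\<^sub>m m)"
      unfolding Et Jt by (subst mult_four_block_mat[of _ r m _ 0 _ m _ _ r _ m]) (use M in auto)
    show "K * std_mat M + transpose_mat (std_mat_hat M) * transpose_mat J = 1\<^sub>m (r + m)"
      unfolding KD EJ by (subst add_four_block_mat[of _ r r _ m _ m]) (use M in \<open>auto intro!: eq_matI\<close>)
  qed simp
qed

theorem theorem7p5:
  fixes r n :: nat and M D D' :: "int mat" and w w' :: "real vec"
  assumes "r \<le> n"
    and "M \<in> carrier_mat r (n - r)"
    and "D = std_mat M"
    and "D' = std_mat_hat M"
    and "w \<in> carrier_vec r"
    and "w' \<in> carrier_vec (n - r)"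
    and "shifting_vector M (w @\<^sub>v w')"
  shows
    "(\<forall>B \<in> bases D. \<forall>C \<in> bases D. \<forall>z \<in> idx1 M w' B. \<forall>y \<in> idx1 M w' C.
        (B, z) \<noteq> (C, y) \<longrightarrow> meet_only_at_boundary r (tile1 M B z) (tile1 M C y))
     \<and>
     (\<forall>B \<in> bases D. \<forall>C \<in> bases D. \<forall>z \<in> idx2 M w B. \<forall>y \<in> idx2 M w C.
        (B, z) \<noteq> (C, y) \<longrightarrow> meet_only_at_boundary (n - r) (tile2 M B z) (tile2 M C y))
     \<and>
     ((\<Union>u \<in> carrier_vec r. translate (T1 M w') (real_vec ((D * transpose_mat D) *\<^sub>v u)))
          = carrier_vec r
      \<and> (\<forall>u \<in> carrier_vec r. \<forall>v \<in> carrier_vec r. u \<noteq> v \<longrightarrow>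
           meet_only_at_boundary r
             (translate (T1 M w') (real_vec ((D * transpose_mat D) *\<^sub>v u)))
             (translate (T1 M w') (real_vec ((D * transpose_mat D) *\<^sub>v v)))))
     \<and>
     ((\<Union>u \<in> carrier_vec (n - r).
          translate (T2 M w) (real_vec ((D' * transpose_mat D') *\<^sub>v u)))
          = carrier_vec (n - r)
      \<and> (\<forall>u \<in> carrier_vec (n - r). \<forall>v \<in> carrier_vec (n - r). u \<noteq> v \<longrightarrow>
           meet_only_at_boundary (n - r)
             (translate (T2 M w) (real_vec ((D' * transpose_mat D') *\<^sub>v u)))
             (translate (T2 M w) (real_vec ((D' * transpose_mat D') *\<^sub>v v)))))
     \<and>
     (\<forall>B \<in> bases D.
        card {y :: int vec. y \<in> carrier_vec r \<and> real_vec y \<in> T1 M w' \<and>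
          (\<forall>\<^sub>F \<epsilon> in at_right 0. \<exists>z \<in> idx1 M w' B. real_vec y + \<epsilon> \<cdot>\<^sub>v w \<in> tile1 M B z)}
        = (multiplicity_of D B)\<^sup>2)
     \<and>
     (\<forall>B \<in> bases D.
        card {y :: int vec. y \<in> carrier_vec (n - r) \<and> real_vec y \<in> T2 M w \<and>
          (\<forall>\<^sub>F \<epsilon> in at_right 0. \<exists>z \<in> idx2 M w B. real_vec y + \<epsilon> \<cdot>\<^sub>v w' \<in> tile2 M B z)}
        = (multiplicity_of D B)\<^sup>2)"
proof -
  define m where "m = n - r"
  have n: "n = r + m" using assms(1) by (simp add: m_def)
  have M: "M \<in> carrier_mat r m" and w': "w' \<in> carrier_vec m" using assms by (simp_all add: m_def)
  define K :: "int mat" where "K = four_block_mat (1\<^sub>m r) (0\<^sub>m r 0) (0\<^sub>m m r) (0\<^sub>m m 0)"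
  define J :: "int mat" where "J = four_block_mat (0\<^sub>m r m) (0\<^sub>m r 0) (1\<^sub>m m) (0\<^sub>m m 0)"
  note std = std_dual_pair[OF M, folded K_def J_def n, folded assms(3,4)]
  interpret std: dual_pair r m n D D' K J by (rule std(1))
  have P1: "P1 M B = cols_parallelepiped (real_mat D) B" for B by (simp add: P1_def assms(3))
  have P2: "P2 M B = cols_parallelepiped (real_mat D') ({..<n} - B)" for B
    unfolding P2_def assms(4)[symmetric] carrier_matD(2)[OF std.E] ..
  have "\<exists>s. shifted_dual_pair r m n D D' K J w w' s"
  proof (rule std.shifted_dual_pair_of_generic[OF assms(5) w'])
    fix B F assume "B \<in> bases D"
      "polytope_facet n F {x @\<^sub>v y |x y. x \<in> cols_parallelepiped (real_mat D) B \<and> y \<in> cols_parallelepiped (real_mat D') ({..<n} - B)}"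
    then show "w @\<^sub>v w' \<notin> parallel_subspace n F"
      using assms(7) M unfolding shifting_vector_def P12_def P1 P2 assms(3)[symmetric] n by auto
  qed
  then obtain s where s: "shifted_dual_pair r m n D D' K J w w' s" ..
  interpret primal: shifted_dual_pair r m n D D' K J w w' s by (rule s)
  interpret dual: shifted_dual_pair m r n D' D J K w' w "\<lambda>C. s ({..<n} - C)" by (rule primal.shifted_dual)
  \<comment> \<open>The minus sign in the translations of the second family is the sign of
    \<open>E K\<close>, the dual counterpart of \<open>M = D J\<close>.\<close>
  have primal_M: "primal.M = M" and dual_M: "dual.M = - transpose_mat M" unfolding primal.M_def dual.M_def by (rule std)+
  have primal_L: "primal.L = D * transpose_mat D" and dual_L: "dual.L = D' * transpose_mat D'" unfolding primal.L_def dual.L_def by (rule refl)+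
  have idx1: "idx1 M w' B = primal.idx B" for B using M by (simp add: idx1_def primal.idx_def P2)
  have tile1: "tile1 M B z = primal.tile B z" for B z by (simp add: tile1_def primal.tile_def P1 primal_M)
  have T1: "T1 M w' = primal.tiles" unfolding T1_def primal.tiles_def idx1 tile1 assms(3)[symmetric] ..
  \<comment> \<open>The dual results are indexed by bases of \<open>D'\<close>, the claims about
    \<open>T2\<close> by bases of \<open>D\<close>; complementation translates between the
    two.\<close>
  let ?c = "\<lambda>B. {..<n} - B"
  have cc: "?c (?c B) = B" if "B \<in> bases D" for B using std.basesD(1)[OF that] by auto
  have cB: "?c B \<in> bases D'" if "B \<in> bases D" for B by (rule std.bases_complement(1)[OF that])
  have img: "bases D' = ?c ` bases D"
  proof
    show "bases D' \<subseteq> ?c ` bases D"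
    proof
      fix C assume C: "C \<in> bases D'"
      then have "?c (?c C) = C" using dual.basesD(1) by auto
      with dual.bases_complement(1)[OF C] show "C \<in> ?c ` bases D" by (metis imageI)
    qed
  qed (use cB in auto)
  have idx2: "idx2 M w B = dual.idx (?c B)" if "B \<in> bases D" for B
    using M cc[OF that] by (simp add: idx2_def dual.idx_def P1)
  have tile2: "tile2 M B z = dual.tile (?c B) z" if z: "z \<in> dual.idx C" for B C z
  proof -
    have zc: "z \<in> carrier_vec r" using z by (rule dual.idx_carrier)
    have "(- transpose_mat M) *\<^sub>v z = - (transpose_mat M *\<^sub>v z)" using M zc by (intro uminus_mult_mat_vec) simp
    then have "real_vec ((- transpose_mat M) *\<^sub>v z) = - real_vec (transpose_mat M *\<^sub>v z)"
      using M by (auto intro!: eq_vecI)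
    then show ?thesis by (simp add: tile2_def dual.tile_def P2 dual_M)
  qed
  have T2: "T2 M w = dual.tiles"
    unfolding T2_def dual.tiles_def img assms(3)[symmetric] using idx2 tile2 by simp
  show ?thesis
    unfolding m_def[symmetric] idx1 tile1 T1 T2 primal_L[symmetric] dual_L[symmetric]
  proof (intro conjI ballI impI)
    fix B C z y assume "B \<in> bases D" "C \<in> bases D" "z \<in> primal.idx B" "y \<in> primal.idx C" "(B, z) \<noteq> (C, y)"
    then show "meet_only_at_boundary r (primal.tile B z) (primal.tile C y)" by (rule primal.tiles_meet_only_at_boundary)
  next
    fix B C z y assume *: "B \<in> bases D" "C \<in> bases D" "z \<in> idx2 M w B" "y \<in> idx2 M w C" "(B, z) \<noteq> (C, y)"
    then have zy: "z \<in> dual.idx (?c B)" "y \<in> dual.idx (?c C)" using idx2 by auto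
    have "(?c B, z) \<noteq> (?c C, y)" using *(5) cc[OF *(1)] cc[OF *(2)] by auto
    then show "meet_only_at_boundary m (tile2 M B z) (tile2 M C y)"
      unfolding tile2[OF zy(1)] tile2[OF zy(2)]
      by (rule dual.tiles_meet_only_at_boundary[OF cB[OF *(1)] cB[OF *(2)] zy])
  next
    show "(\<Union>u\<in>carrier_vec r. translate primal.tiles (real_vec (primal.L *\<^sub>v u))) = carrier_vec r"
      by (rule primal.tiles_translates_cover)
  next
    fix u v :: "int vec" assume "u \<in> carrier_vec r" "v \<in> carrier_vec r" "u \<noteq> v"
    then show "meet_only_at_boundary r (translate primal.tiles (real_vec (primal.L *\<^sub>v u))) (translate primal.tiles (real_vec (primal.L *\<^sub>v v)))"
      by (rule primal.tiles_translates_meet_only_at_boundary)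
  next
    show "(\<Union>u\<in>carrier_vec m. translate dual.tiles (real_vec (dual.L *\<^sub>v u))) = carrier_vec m"
      by (rule dual.tiles_translates_cover)
  next
    fix u v :: "int vec" assume "u \<in> carrier_vec m" "v \<in> carrier_vec m" "u \<noteq> v"
    then show "meet_only_at_boundary m (translate dual.tiles (real_vec (dual.L *\<^sub>v u))) (translate dual.tiles (real_vec (dual.L *\<^sub>v v)))"
      by (rule dual.tiles_translates_meet_only_at_boundary)
  next
    fix B assume "B \<in> bases D"
    then show "card {y. y \<in> carrier_vec r \<and> real_vec y \<in> primal.tiles \<and>
        (\<forall>\<^sub>F \<epsilon> in at_right 0. \<exists>z\<in>primal.idx B. real_vec y + \<epsilon> \<cdot>\<^sub>v w \<in> primal.tile B z)} = (multiplicity_of D B)\<^sup>2"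
      by (rule primal.tile_points_card)
  next
    fix B assume B: "B \<in> bases D"
    show "card {y. y \<in> carrier_vec m \<and> real_vec y \<in> dual.tiles \<and>
        (\<forall>\<^sub>F \<epsilon> in at_right 0. \<exists>z\<in>idx2 M w B. real_vec y + \<epsilon> \<cdot>\<^sub>v w' \<in> tile2 M B z)} = (multiplicity_of D B)\<^sup>2"
      using dual.tile_points_card[OF cB[OF B]] std.bases_complement(2)[OF B] tile2
      by (simp add: idx2[OF B] cong: bex_cong)
  qed
qed

end
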